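(* Let $\mathcal{F}$ be a family of pairs $(f,g)$ of non-negative measurable functions on $\mathbb{R}^n$. Suppose that for some $p_0>0$ and every $w_0\in A_\infty$, $$\int_{\mathbb{R}^n}f(x)^{p_0}w_0(x)\,dx\le C\int_{\mathbb{R}^n}g(x)^{p_0}w_0(x)\,dx,\qquad(f,g)\in\mathcal{F}.$$ Then given $p(\cdot)\in\mathcal{P}_0$ and a weight $w$, suppose there exists $s$, $0<s\le p_-$, such that $w^s\in A_{p(\cdot)/s}$ and the maximal operator $M$ is bounded on $L^{(p(\cdot)/s)'}(w^{-s})$. Then $$\|f\|_{L^{p(\cdot)}(w)}\le C\|g\|_{L^{p(\cdot)}(w)},\qquad(f,g)\in\mathcal{F}.$$
   Context: $\mathcal{P}$ is the set of measurable $p(\cdot):\mathbb{R}^n\to[1,\infty]$; $\mathcal{P}_0$ is the set of measurable $p(\cdot):\mathbb{R}^n\to(0,\infty)$; $p_-=\operatorname{ess\,inf}p$. For $p(\cdot)\in\mathcal{P}$ the conjugate exponent $p'(\cdot)$ is defined pointwise by $1/p(x)+1/p'(x)=1$, $1/\infty=0$. For $p(\cdot)\in\mathcal{P}$ or $\mathcal{P}_0$, with $\mathbb{R}^n_\infty=\{x:p(x)=\infty\}$, $$\|f\|_{p(\cdot)}=\inf\Big\{\lambda>0:\int_{\mathbb{R}^n\setminus\mathbb{R}^n_\infty}\Big(\frac{|f(x)|}{\lambda}\Big)^{p(x)}dx+\lambda^{-1}\|f\|_{L^\infty(\mathbb{R}^n_\infty)}\le1\Big\}$$ (a quasi-norm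 in general for $\mathcal{P}_0$). A weight is a non-negative measurable function; $\|f\|_{L^{p(\cdot)}(w)}:=\|fw\|_{p(\cdot)}$, and $L^{p(\cdot)}(w)$ is the set of measurable $f$ for which this is finite. For $r(\cdot)\in\mathcal{P}$, $w\in A_{r(\cdot)}$ iff $0<w<\infty$ a.e. and $\sup_B|B|^{-1}\|w\chi_B\|_{r(\cdot)}\|w^{-1}\chi_B\|_{r'(\cdot)}<\infty$. $Mf(x)=\sup_{B\ni x}\frac1{|B|}\int_B|f(y)|\,dy$; $M$ is bounded on $L^{r(\cdot)}(v)$ if $\|(Mf)v\|_{r(\cdot)}\le C\|fv\|_{r(\cdot)}$ for all $f\in L^{r(\cdot)}(v)$. In the hypothesis, $A_\infty=\bigcup_{t>1}A_t$ with the classical classes: $w_0\in A_t$ iff $\sup_B\big(\frac1{|B|}\int_Bw_0\big)\big(\frac1{|B|}\int_Bw_0^{1-t'}\big)^{t-1}<\infty$. Suprema are over balls in $\mathbb{R}^n$. Convention: an inequality over $(f,g)\in\mathcal{F}$ (norm or weighted integral) means that it holds, with constant independent of the pair, for every pair $(f,g)\in\mathcal{F}$ for which the left-hand side is finite. *)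

theory Defs
  imports "HOL-Probability.Essential_Supremum"
begin

text \<open>
  Exponents, weights and non-negative functions on \<open>\<real>\<^sup>n\<close> take values in \<open>[0,\<infinity>]\<close> (type
  \<^typ>\<open>ennreal\<close>); \<open>measurable\<close> means Lebesgue measurable.
\<close>

text \<open>
  Real powers on \<open>[0,\<infinity>]\<close>, with \<open>0\<close> and \<open>\<infinity>\<close> exchanged by negative exponents. (The library
  convention \<^term>\<open>0 powr a = (0::real)\<close> would be wrong for \<open>a < 0\<close>.)
\<close>

definition ennpow :: "ennreal \<Rightarrow> real \<Rightarrow> ennreal" (infixr "pow\<^sub>\<infinity>" 80)
  where "x pow\<^sub>\<infinity> a =
    (if a = 0 then 1
     else if x = 0 then (if 0 < a then 0 else \<infinity>)
     else if x = \<infinity> then (if 0 < a then \<infinity> else 0)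
     else ennreal (enn2real x powr a))"

definition essinf :: "'a measure \<Rightarrow> ('a \<Rightarrow> ennreal) \<Rightarrow> ennreal"
  where "essinf M f = Sup {z. AE x in M. z \<le> f x}"

definition balls :: "(real ^ 'n) set set"
  where "balls = {ball c r | c r. 0 < r}"

definition exponents0 :: "(real ^ 'n \<Rightarrow> ennreal) set"
  where "exponents0 = {p \<in> borel_measurable lebesgue. \<forall>x. 0 < p x \<and> p x < \<infinity>}"

text \<open>
  The solution \<open>p'\<close> of \<open>1/p + 1/p' = 1\<close> for \<open>1 \<le> p \<le> \<infinity>\<close>. For \<open>p < 1\<close> truncated subtraction
  gives \<open>\<infinity>\<close>; below, \<open>p(\<cdot>)/s\<close> with \<open>s \<le> p\<^sub>-\<close> can be \<open>< 1\<close> only on a null set, to which none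
  of the following notions is sensitive.
\<close>

definition conj_exp :: "ennreal \<Rightarrow> ennreal"
  where "conj_exp p = inverse (1 - inverse p)"

lemma conj_exp: "1 \<le> p \<Longrightarrow> inverse p + inverse (conj_exp p) = 1"
proof -
  assume "1 \<le> p"
  then have "inverse p \<le> 1"
    by (cases p rule: ennreal_cases)
      (auto simp: inverse_ennreal field_simps simp flip: ennreal_1)
  moreover have "inverse (inverse x) = x" for x :: ennreal
    by (cases x rule: ennreal_cases; cases "x = 0") (auto simp: inverse_ennreal ennreal_eq_0_iff)
  ultimately show ?thesis
    by (simp add: conj_exp_def)
qed

text \<open>
  The norm \<open>\<parallel>f\<parallel>\<^bsub>p(\<cdot>)\<^esub>\<close>, for \<open>f\<close> standing for the modulus of a function; it is \<open>\<infinity>\<close> if no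
  \<open>\<lambda>\<close> is admissible.
\<close>

definition var_modular :: "(real ^ 'n \<Rightarrow> ennreal) \<Rightarrow> (real ^ 'n \<Rightarrow> ennreal) \<Rightarrow> real \<Rightarrow> ennreal"
  where "var_modular p f l =
    (\<integral>\<^sup>+x\<in>{x. p x \<noteq> \<infinity>}. (f x / ennreal l) pow\<^sub>\<infinity> enn2real (p x) \<partial>lebesgue)
    + inverse (ennreal l) * esssup lebesgue (\<lambda>x. f x * indicator {x. p x = \<infinity>} x)"

definition var_norm :: "(real ^ 'n \<Rightarrow> ennreal) \<Rightarrow> (real ^ 'n \<Rightarrow> ennreal) \<Rightarrow> ennreal"
  where "var_norm p f = Inf {ennreal l | l. 0 < l \<and> var_modular p f l \<le> 1}"

definition wvar_norm ::
  "(real ^ 'n \<Rightarrow> ennreal) \<Rightarrow> (real ^ 'n \<Rightarrow> ennreal) \<Rightarrow> (real ^ 'n \<Rightarrow> ennreal) \<Rightarrow> ennreal"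
  where "wvar_norm p w f = var_norm p (\<lambda>x. f x * w x)"

definition A_var :: "(real ^ 'n \<Rightarrow> ennreal) \<Rightarrow> (real ^ 'n \<Rightarrow> ennreal) set"
  where "A_var r = {w \<in> borel_measurable lebesgue.
    (AE x in lebesgue. 0 < w x \<and> w x < \<infinity>) \<and>
    (SUP B\<in>balls. inverse (emeasure lebesgue B)
        * var_norm r (\<lambda>x. w x * indicator B x)
        * var_norm (\<lambda>x. conj_exp (r x)) (\<lambda>x. inverse (w x) * indicator B x)) < \<infinity>}"

text \<open>
  The classical classes. As for \<open>A\<^bsub>r(\<cdot>)\<^esub>\<close>, weights are positive and finite almost everywhere;
  this only excludes the degenerate weights \<open>0\<close> and \<open>\<infinity>\<close>, which the convention
  \<open>0 * \<infinity> = 0\<close> would otherwise let in. The exponents \<open>1 - t'\<close> and \<open>t - 1\<close> use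
  \<open>t' = t / (t - 1)\<close>.
\<close>

definition A_class :: "real \<Rightarrow> (real ^ 'n \<Rightarrow> ennreal) set"
  where "A_class t = {w \<in> borel_measurable lebesgue.
    (AE x in lebesgue. 0 < w x \<and> w x < \<infinity>) \<and>
    (SUP B\<in>balls. ((\<integral>\<^sup>+x\<in>B. w x \<partial>lebesgue) / emeasure lebesgue B)
        * ((\<integral>\<^sup>+x\<in>B. w x pow\<^sub>\<infinity> (1 - t / (t - 1)) \<partial>lebesgue) / emeasure lebesgue B)
            pow\<^sub>\<infinity> (t - 1)) < \<infinity>}"

definition A_infinity :: "(real ^ 'n \<Rightarrow> ennreal) set"
  where "A_infinity = (\<Union>t\<in>{1<..}. A_class t)"

definition maximal :: "(real ^ 'n \<Rightarrow> real) \<Rightarrow> real ^ 'n \<Rightarrow> ennreal"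
  where "maximal f x =
    (SUP B\<in>{B \<in> balls. x \<in> B}. (\<integral>\<^sup>+y\<in>B. ennreal \<bar>f y\<bar> \<partial>lebesgue) / emeasure lebesgue B)"

definition maximal_bounded :: "(real ^ 'n \<Rightarrow> ennreal) \<Rightarrow> (real ^ 'n \<Rightarrow> ennreal) \<Rightarrow> bool"
  where "maximal_bounded r v \<longleftrightarrow> (\<exists>C>0. \<forall>f \<in> borel_measurable lebesgue.
    wvar_norm r v (\<lambda>x. ennreal \<bar>f x\<bar>) < \<infinity> \<longrightarrow>
    wvar_norm r v (maximal f) \<le> ennreal C * wvar_norm r v (\<lambda>x. ennreal \<bar>f x\<bar>))"

end

theory Submission
  imports Defs
begin

text \<open>
  Dividing all exponents by \<open>s\<close> reduces the claim to a Banach function space. Put \<open>P = p / s\<close>,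
  \<open>W = w\<^sup>s\<close>, \<open>r = p\<^sub>0 / s\<close>, \<open>\<phi> = f\<^sup>s\<close> and \<open>\<gamma> = g\<^sup>s\<close>. The norm of \<open>f\<close> in \<open>L\<^sup>p(w)\<close> is then a power of the
  norm of \<open>\<phi>\<close> in \<open>X = L\<^sup>P(W)\<close>, and \<open>M\<close> is bounded on the associate space \<open>X' = L\<^bsup>P'\<^esup>(1/W)\<close>.

  Testing by duality, the norm of \<open>\<phi>\<close> in \<open>X\<close> is comparable with \<open>\<integral>\<phi> h\<close> for some \<open>h\<close> of norm at most one in
  \<open>X'\<close> (\<open>var_dual\<close>). The algorithm of Rubio de Francia (\<open>rubio_de_francia\<close>) replaces \<open>h\<close> by a
  majorant \<open>H\<close> of comparable norm in \<open>X'\<close> that is an \<open>A\<^sub>1\<close> weight. If the hypothesis were given at the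
  exponent \<open>r = 1\<close>, the chain \<open>\<integral>\<phi> h \<le> \<integral>\<phi> H \<le> C \<integral>\<gamma> H\<close> and Hoelder's inequality (\<open>var_hoelder\<close>)
  would finish the proof.

  For general \<open>r\<close> the hypothesis is applied to a weight \<open>H F\<^bsup>1-r\<^esup>\<close>, where \<open>F\<close> majorizes both functions
  and is integrable against \<open>H\<close>. On the one hand \<open>\<gamma>\<^sup>r F\<^bsup>1-r\<^esup>\<close> is at most a multiple of \<open>F\<close>, on the other
  hand \<open>\<phi>\<close> is controlled by \<open>\<phi>\<^sup>r F\<^bsup>1-r\<^esup>\<close>, for \<open>r \<ge> 1\<close> up to a small multiple of \<open>F\<close>; so the inequality at the exponent \<open>r\<close> gives one at the
  exponent one. The point is to choose \<open>F\<close> with \<open>H F\<^bsup>1-r\<^esup>\<close> in \<open>A\<^sub>\<infinity>\<close> (\<open>L1_majorant\<close>). This is again the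
  algorithm of Rubio de Francia, now for the maximal operator of the measure \<open>H dx\<close>: since \<open>H\<close> is an
  \<open>A\<^sub>1\<close> weight, this measure is doubling, and its maximal operator is bounded on \<open>L\<^sup>q(H)\<close> for \<open>q > 1\<close>
  (\<open>wmax_strong_type\<close>). It yields \<open>u\<close> that is an \<open>A\<^sub>1\<close> weight relative to \<open>H dx\<close>, and products
  \<open>H u\<close> and \<open>H u\<^bsup>1-t\<^esup>\<close> are in \<open>A\<^sub>1\<close> and \<open>A\<^sub>t\<close> (\<open>A1_mult\<close>, \<open>A1_factor_A_class\<close>).

  The constant in the hypothesis may depend on the weight in an arbitrary way, while the weight just
  described depends on the pair \<open>(f, g)\<close>. The conclusion is therefore proved by contradiction: if it
  fails, there is a sequence of pairs that violate it with constants growing as fast as desired. The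
  test functions \<open>h\<close> and the functions to be majorized by \<open>F\<close> are summed over the sequence with
  geometric weights, so that a single weight, hence a single constant, serves all the pairs. The
  price is a factor \<open>8\<^sup>N\<close>, which is beaten by the growth of the constants.
\<close>

section \<open>Real powers on the extended half-line\<close>

lemma ennpow_0 [simp]: "x pow\<^sub>\<infinity> 0 = 1"
  by (simp add: ennpow_def)

lemma ennpow_zero: "0 < a \<Longrightarrow> 0 pow\<^sub>\<infinity> a = 0"
  by (simp add: ennpow_def)

lemma ennpow_ennreal: "0 < x \<Longrightarrow> ennreal x pow\<^sub>\<infinity> a = ennreal (x powr a)"
  by (auto simp: ennpow_def)

lemma ennpow_ennreal_nonneg: "0 \<le> x \<Longrightarrow> 0 < a \<Longrightarrow> ennreal x pow\<^sub>\<infinity> a = ennreal (x powr a)"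
  by (cases "x = 0") (auto simp: ennpow_def)

lemma ennpow_1 [simp]: "x pow\<^sub>\<infinity> 1 = x"
  by (cases x) (auto simp: ennpow_def)

lemma ennpow_one [simp]: "1 pow\<^sub>\<infinity> a = 1"
  by (simp add: ennpow_def)

lemma ennpow_eq_0_iff: "0 < a \<Longrightarrow> x pow\<^sub>\<infinity> a = 0 \<longleftrightarrow> x = 0"
  by (cases x) (auto simp: ennpow_def ennreal_eq_0_iff)

lemma ennpow_eq_top_iff: "0 < a \<Longrightarrow> x pow\<^sub>\<infinity> a = \<infinity> \<longleftrightarrow> x = \<infinity>"
  by (cases x) (auto simp: ennpow_def)

lemma ennpow_pos: "0 < x \<Longrightarrow> x < \<infinity> \<Longrightarrow> 0 < x pow\<^sub>\<infinity> a"
  by (cases x) (auto simp: ennpow_def ennreal_eq_0_iff)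

lemma ennpow_finite: "0 < x \<Longrightarrow> x < \<infinity> \<Longrightarrow> x pow\<^sub>\<infinity> a < \<infinity>"
  by (cases x) (auto simp: ennpow_def ennreal_eq_0_iff)

lemma ennpow_mono: assumes "0 \<le> a" "x \<le> y" shows "x pow\<^sub>\<infinity> a \<le> y pow\<^sub>\<infinity> a"
proof (cases "a = 0 \<or> x = 0 \<or> y = \<infinity>")
  case True
  with assms show ?thesis by (auto simp: ennpow_def)
next
  case False
  obtain x' y' where xy: "x = ennreal x'" "y = ennreal y'" "0 \<le> x'" "0 \<le> y'"
    using False assms by (cases x; cases y) (auto simp: top_unique)
  then have "0 < x'" "x' \<le> y'"
    using False assms by (auto simp: less_le)
  then show ?thesis
    using xy False assms by (simp add: ennpow_ennreal powr_mono2)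
qed

lemma ennpow_antimono: assumes "a \<le> 0" "x \<le> y" shows "y pow\<^sub>\<infinity> a \<le> x pow\<^sub>\<infinity> a"
proof (cases "a = 0 \<or> x = 0 \<or> y = \<infinity>")
  case True
  with assms show ?thesis by (auto simp: ennpow_def)
next
  case False
  obtain x' y' where xy: "x = ennreal x'" "y = ennreal y'" "0 \<le> x'" "0 \<le> y'"
    using False assms by (cases x; cases y) (auto simp: top_unique)
  then have "0 < x'" "x' \<le> y'"
    using False assms by (auto simp: less_le)
  then show ?thesis
    using xy False assms by (simp add: ennpow_ennreal powr_mono2')
qed

lemma ennpow_mult: assumes "0 < a \<or> (0 < x \<and> x < \<infinity>)"
  shows "(x * y) pow\<^sub>\<infinity> a = x pow\<^sub>\<infinity> a * y pow\<^sub>\<infinity> a"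
proof (cases "0 < x \<and> x < \<infinity> \<and> 0 < y \<and> y < \<infinity>")
  case True
  then obtain x' y' where xy: "x = ennreal x'" "y = ennreal y'" "0 < x'" "0 < y'"
    by (cases x; cases y) auto
  then show ?thesis
    by (simp add: ennpow_ennreal powr_mult flip: ennreal_mult)
next
  case False
  consider "a = 0" | "a \<noteq> 0" "x = 0" | "a \<noteq> 0" "x = \<infinity>" | "a \<noteq> 0" "0 < x" "x < \<infinity>" "y = 0" | "a \<noteq> 0" "0 < x" "x < \<infinity>" "y = \<infinity>"
    using False by (auto simp: zero_less_iff_neq_zero less_top[symmetric])
  then show ?thesis
    using assms ennpow_pos[of x a] ennpow_finite[of x a]
    by cases (auto simp: ennpow_def ennreal_top_mult ennreal_mult_top ennreal_eq_0_iff enn2real_eq_0_iff)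
qed

lemma ennpow_divide: assumes "0 < a" "0 < l"
  shows "(x / ennreal l) pow\<^sub>\<infinity> a = x pow\<^sub>\<infinity> a / ennreal (l powr a)"
  using assms
  by (auto simp: divide_ennreal_def ennpow_mult inverse_ennreal ennpow_ennreal powr_minus inverse_powr
      simp flip: powr_minus_divide)

lemma ennpow_ennpow: "(x pow\<^sub>\<infinity> a) pow\<^sub>\<infinity> b = x pow\<^sub>\<infinity> (a * b)"
proof (cases "0 < x \<and> x < \<infinity>")
  case True
  then obtain x' where "x = ennreal x'" "0 < x'"
    by (cases x) auto
  then show ?thesis
    by (simp add: ennpow_ennreal powr_powr)
next
  case False
  then have "x = 0 \<or> x = \<infinity>"
    by (auto simp: zero_less_iff_neq_zero less_top[symmetric])
  then show ?thesis
    by (auto simp: ennpow_def zero_less_mult_iff)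
qed

lemma ennpow_add: assumes "(0 < a \<and> 0 < b) \<or> (0 < x \<and> x < \<infinity>)"
  shows "x pow\<^sub>\<infinity> (a + b) = x pow\<^sub>\<infinity> a * x pow\<^sub>\<infinity> b"
proof (cases "0 < x \<and> x < \<infinity>")
  case True
  then obtain x' where "x = ennreal x'" "0 < x'"
    by (cases x) auto
  then show ?thesis
    by (simp add: ennpow_ennreal powr_add ennreal_mult)
next
  case False
  then have "x = 0 \<or> x = \<infinity>"
    by (auto simp: zero_less_iff_neq_zero less_top[symmetric])
  then show ?thesis
    using assms by (auto simp: ennpow_def)
qed

lemma ennpow_le_self: assumes "x \<le> 1" "1 \<le> a" shows "x pow\<^sub>\<infinity> a \<le> x"
proof (cases x)
  case (real x')
  then show ?thesis
    using assms powr_mono'[of 1 a x']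
    by (auto simp: ennpow_ennreal_nonneg)
qed (use assms in auto)

lemma measurable_ennpow [measurable (raw)]:
  assumes [measurable]: "f \<in> borel_measurable M" "a \<in> borel_measurable M"
  shows "(\<lambda>x. f x pow\<^sub>\<infinity> a x) \<in> borel_measurable M"
  unfolding ennpow_def by measurable

section \<open>Variable Lebesgue norms\<close>

text \<open>
  A stand-in for \<open>\<parallel>h\<parallel> \<le> l\<close>: each of the two parts of the modular is bounded by one, instead of their
  sum. For exponents at least one, this changes the norm by at most a factor two
  (\<open>var_bounded_of_norm\<close>, \<open>var_norm_le_double\<close>), and no sharp constant matters below.
\<close>

definition var_bounded :: "(real ^ 'n \<Rightarrow> ennreal) \<Rightarrow> (real ^ 'n \<Rightarrow> ennreal) \<Rightarrow> real \<Rightarrow> bool"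
  where "var_bounded q h l \<longleftrightarrow>
    (\<integral>\<^sup>+x\<in>{x. q x \<noteq> \<infinity>}. (h x / ennreal l) pow\<^sub>\<infinity> enn2real (q x) \<partial>lebesgue) \<le> 1 \<and>
    (AE x in lebesgue. q x = \<infinity> \<longrightarrow> h x \<le> ennreal l)"

lemma ennreal_divide_mono: "x \<le> y \<Longrightarrow> 0 < l \<Longrightarrow> l \<le> l' \<Longrightarrow> x / ennreal l' \<le> y / ennreal l"
  by (auto simp: divide_ennreal_def inverse_ennreal intro!: mult_mono)

lemma ennreal_divide_1 [simp]: "x / (1 :: ennreal) = x"
  by (simp add: divide_ennreal_def)

lemma ennreal_divide_cmult:
  assumes "0 < c" "0 < l"
  shows "x / ennreal (c * l) = ennreal (1 / c) * (x / ennreal l)"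
proof -
  have "inverse (ennreal (c * l)) = ennreal (1 / c) * inverse (ennreal l)"
    using assms by (simp add: inverse_ennreal field_simps flip: ennreal_mult)
  then show ?thesis
    by (simp add: divide_ennreal_def mult_ac)
qed

lemma var_bounded_mono:
  assumes "var_bounded q h l" "0 < l" "l \<le> l'" "AE x in lebesgue. h' x \<le> h x"
  shows "var_bounded q h' l'"
  unfolding var_bounded_def
proof
  have "(\<integral>\<^sup>+x\<in>{x. q x \<noteq> \<infinity>}. (h' x / ennreal l') pow\<^sub>\<infinity> enn2real (q x) \<partial>lebesgue)
      \<le> (\<integral>\<^sup>+x\<in>{x. q x \<noteq> \<infinity>}. (h x / ennreal l) pow\<^sub>\<infinity> enn2real (q x) \<partial>lebesgue)"
    using assms
    by (intro nn_integral_mono_AE) (auto elim!: eventually_mono intro!: mult_right_mono ennpow_mono ennreal_divide_mono)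
  then show "(\<integral>\<^sup>+x\<in>{x. q x \<noteq> \<infinity>}. (h' x / ennreal l') pow\<^sub>\<infinity> enn2real (q x) \<partial>lebesgue) \<le> 1"
    using assms(1) by (auto simp: var_bounded_def)
  have "AE x in lebesgue. q x = \<infinity> \<longrightarrow> h x \<le> ennreal l"
    using assms(1) by (auto simp: var_bounded_def)
  then show "AE x in lebesgue. q x = \<infinity> \<longrightarrow> h' x \<le> ennreal l'"
    using assms(4)
  proof eventually_elim
    case (elim x)
    then show ?case
      using ennreal_leI[OF assms(3)] by (meson order_trans)
  qed
qed

lemma var_bounded_cmult:
  assumes "var_bounded q h l" "0 < c" "0 < l"
  shows "var_bounded q (\<lambda>x. ennreal c * h x) (c * l)"
proof -
  have "ennreal c * inverse (ennreal c) = 1"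
    using assms(2) by (simp add: inverse_ennreal flip: ennreal_mult)
  then have "ennreal c * h x * (inverse (ennreal c) * inverse (ennreal l)) = h x * inverse (ennreal l)" for x
    by (metis (no_types, lifting) mult.assoc mult.commute mult_1)
  moreover have "inverse (ennreal (c * l)) = inverse (ennreal c) * inverse (ennreal l)"
    using assms(2,3) by (simp add: inverse_ennreal flip: ennreal_mult)
  ultimately have "ennreal c * h x / ennreal (c * l) = h x / ennreal l" for x
    by (simp only: divide_ennreal_def)
  moreover have "ennreal c * h x \<le> ennreal (c * l)" if "h x \<le> ennreal l" for x
    using that assms(2,3) by (simp add: ennreal_mult mult_left_mono)
  ultimately show ?thesis
    using assms(1) by (auto simp: var_bounded_def elim!: eventually_mono)
qed

lemma var_bounded_AE_finite:
  fixes q h :: "real ^ 'n \<Rightarrow> ennreal"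
  assumes b: "var_bounded q h l" and l: "0 < l" and q: "AE x in lebesgue. 0 < q x"
    and [measurable]: "q \<in> borel_measurable lebesgue" "h \<in> borel_measurable lebesgue"
  shows "AE x in lebesgue. h x < \<infinity>"
proof -
  define G where "G x = (h x / ennreal l) pow\<^sub>\<infinity> enn2real (q x) * indicator {x. q x \<noteq> \<infinity>} x" for x
  have [measurable]: "G \<in> borel_measurable lebesgue"
    unfolding G_def by measurable
  have "(\<integral>\<^sup>+x. G x \<partial>lebesgue) \<noteq> \<infinity>"
    using b unfolding var_bounded_def G_def by (auto simp: top_unique)
  then have "AE x in lebesgue. G x \<noteq> \<infinity>"
    by (intro nn_integral_PInf_AE) auto
  moreover have "AE x in lebesgue. q x = \<infinity> \<longrightarrow> h x \<le> ennreal l"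
    using b by (simp add: var_bounded_def)
  ultimately show ?thesis
    using q
  proof eventually_elim
    case (elim x)
    show ?case
    proof (rule ccontr)
      assume "\<not> h x < \<infinity>"
      then have *: "h x = \<infinity>"
        by (simp add: less_top[symmetric])
      with elim have "q x \<noteq> \<infinity>" by (auto simp: top_unique)
      moreover have "0 < enn2real (q x)"
        using elim \<open>q x \<noteq> \<infinity>\<close> by (cases "q x") auto
      moreover have "\<infinity> / ennreal l = \<infinity>"
        by (simp add: ennreal_top_divide)
      ultimately have "G x = \<infinity>"
        using * by (simp add: G_def ennpow_def)
      with elim show False by simp
    qed
  qed
qed

lemma var_bounded_of_modular:
  assumes "0 < l" "var_modular q h l \<le> 1"
  shows "var_bounded q h l"
proof -
  let ?E = "esssup lebesgue (\<lambda>x. h x * indicator {x. q x = \<infinity>} x)"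
  have "inverse (ennreal l) * ?E \<le> 1"
    by (rule order_trans[OF _ assms(2)[unfolded var_modular_def]]) simp
  then have "ennreal l * (inverse (ennreal l) * ?E) \<le> ennreal l * 1"
    by (intro mult_left_mono) auto
  also have "ennreal l * (inverse (ennreal l) * ?E) = ?E"
    using assms(1) by (simp add: inverse_ennreal mult.assoc[symmetric] flip: ennreal_mult)
  finally have E: "?E \<le> ennreal l" by simp
  have "AE x in lebesgue. h x * indicator {x. q x = \<infinity>} x \<le> ?E"
    by (rule esssup_AE)
  then have "AE x in lebesgue. q x = \<infinity> \<longrightarrow> h x \<le> ennreal l"
    by eventually_elim (use E in \<open>auto intro: order_trans\<close>)
  moreover have "(\<integral>\<^sup>+x\<in>{x. q x \<noteq> \<infinity>}. (h x / ennreal l) pow\<^sub>\<infinity> enn2real (q x) \<partial>lebesgue) \<le> var_modular q h l"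
    unfolding var_modular_def by simp
  ultimately show ?thesis
    using assms(2) by (auto simp: var_bounded_def)
qed

lemma var_modular_antimono:
  assumes "0 < l" "l \<le> L"
  shows "var_modular q h L \<le> var_modular q h l"
  unfolding var_modular_def using assms
  by (intro add_mono nn_integral_mono mult_right_mono ennpow_mono ennreal_divide_mono)
     (auto simp: inverse_ennreal)

lemma var_modular_le_1:
  assumes "var_norm q h < ennreal L"
  shows "var_modular q h L \<le> 1"
proof -
  obtain l where l: "0 < l" "var_modular q h l \<le> 1" "ennreal l < ennreal L"
    using assms unfolding var_norm_def Inf_less_iff by auto
  then have "l \<le> L"
    by (auto simp: ennreal_less_iff)
  then show ?thesis
    using var_modular_antimono[of l L q h] l by (auto intro: order_trans)
qed

lemma var_bounded_of_norm:
  assumes "var_norm q h < ennreal L"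
  shows "var_bounded q h L"
proof (rule var_bounded_of_modular[OF _ var_modular_le_1[OF assms]])
  show "0 < L"
    using le_less_trans[OF zero_le assms] by simp
qed

lemma var_norm_le: "0 < l \<Longrightarrow> var_modular q h l \<le> 1 \<Longrightarrow> var_norm q h \<le> ennreal l"
  unfolding var_norm_def by (auto intro!: Inf_lower)

text \<open>
  Exponents at least one make the modular subhomogeneous, so doubling \<open>l\<close> halves both of its parts.
\<close>

lemma var_norm_le_double:
  fixes q h :: "real ^ 'n \<Rightarrow> ennreal"
  assumes "var_bounded q h l" "0 < l" "\<And>x. 1 \<le> q x"
    and [measurable]: "q \<in> borel_measurable lebesgue" "h \<in> borel_measurable lebesgue"
  shows "var_norm q h \<le> ennreal (2 * l)"
proof (rule var_norm_le)
  have pw: "(h x / ennreal (2 * l)) pow\<^sub>\<infinity> enn2real (q x) \<le> ennreal (1/2) * (h x / ennreal l) pow\<^sub>\<infinity> enn2real (q x)"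
    if "q x \<noteq> \<infinity>" for x
  proof -
    have q: "1 \<le> enn2real (q x)"
      using assms(3)[of x] that by (cases "q x") auto
    have "h x / ennreal (2 * l) = ennreal (1/2) * (h x / ennreal l)"
      using assms(2) by (simp only: ennreal_divide_cmult zero_less_numeral)
    then have "(h x / ennreal (2 * l)) pow\<^sub>\<infinity> enn2real (q x)
        = ennreal (1/2) pow\<^sub>\<infinity> enn2real (q x) * (h x / ennreal l) pow\<^sub>\<infinity> enn2real (q x)"
      using q by (simp add: ennpow_mult)
    also have "\<dots> \<le> ennreal (1/2) * (h x / ennreal l) pow\<^sub>\<infinity> enn2real (q x)"
      using q by (intro mult_right_mono ennpow_le_self) (simp_all only: ennreal_le_1 zero_le)
    finally show ?thesis .
  qed
  have "(\<integral>\<^sup>+x\<in>{x. q x \<noteq> \<infinity>}. (h x / ennreal (2*l)) pow\<^sub>\<infinity> enn2real (q x) \<partial>lebesgue)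
    \<le> (\<integral>\<^sup>+x. ennreal (1/2) * ((h x / ennreal l) pow\<^sub>\<infinity> enn2real (q x) * indicator {x. q x \<noteq> \<infinity>} x) \<partial>lebesgue)"
    using pw by (intro nn_integral_mono) (auto split: split_indicator)
  also have "\<dots> = ennreal (1/2) * (\<integral>\<^sup>+x\<in>{x. q x \<noteq> \<infinity>}. (h x / ennreal l) pow\<^sub>\<infinity> enn2real (q x) \<partial>lebesgue)"
    by (intro nn_integral_cmult) measurable
  also have "\<dots> \<le> ennreal (1/2) * 1"
    using assms(1) by (intro mult_left_mono) (auto simp: var_bounded_def)
  finally have 1: "(\<integral>\<^sup>+x\<in>{x. q x \<noteq> \<infinity>}. (h x / ennreal (2*l)) pow\<^sub>\<infinity> enn2real (q x) \<partial>lebesgue) \<le> ennreal (1/2)"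
    by simp
  have "esssup lebesgue (\<lambda>x. h x * indicator {x. q x = \<infinity>} x) \<le> ennreal l"
    using assms(1) by (intro esssup_I) (auto simp: var_bounded_def elim!: eventually_mono split: split_indicator)
  then have "inverse (ennreal (2*l)) * esssup lebesgue (\<lambda>x. h x * indicator {x. q x = \<infinity>} x) \<le> inverse (ennreal (2*l)) * ennreal l"
    by (intro mult_left_mono) auto
  also have "\<dots> = ennreal (1/2)"
    using assms(2) by (simp add: inverse_ennreal flip: ennreal_mult)
  finally have "var_modular q h (2 * l) \<le> ennreal (1/2) + ennreal (1/2)"
    unfolding var_modular_def using 1 by (intro add_mono)
  also have "ennreal (1/2) + ennreal (1/2) = 1"
    by (subst ennreal_plus[symmetric]) auto
  finally show "var_modular q h (2 * l) \<le> 1" .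
qed (use assms in auto)

lemma suminf_half: "(\<Sum>k. ennreal ((1/2) ^ Suc k)) = 1"
  using power_half_series by (intro suminf_ennreal_eq[where x=1, simplified]) auto

text \<open>
  A crude form of the convexity of the power function, at the cost of weights \<open>4\<^bsup>-k\<^esup>\<close> in place of
  \<open>2\<^bsup>-k\<^esup>\<close>. A sum with weights \<open>2\<^bsup>-k\<^esup>\<close> is at most the supremum of its terms, so the left-hand side is
  bounded by the powers of the numbers \<open>2\<^bsup>-k\<^esup> z\<^sub>k\<close>, and these are at most \<open>2\<^bsup>-k\<^esup> z\<^sub>k\<^sup>a\<close> because \<open>a \<ge> 1\<close>.
\<close>

lemma power_suminf_le:
  assumes a: "1 \<le> a"
  shows "(\<Sum>k. ennreal ((1/4) ^ Suc k) * z k) pow\<^sub>\<infinity> a \<le> (\<Sum>k. ennreal ((1/2) ^ Suc k) * z k pow\<^sub>\<infinity> a)"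
proof -
  define R where "R = (\<Sum>k. ennreal ((1/2) ^ Suc k) * z k pow\<^sub>\<infinity> a)"
  have z: "ennreal ((1/2) ^ Suc k) * z k \<le> R pow\<^sub>\<infinity> (1/a)" for k
  proof -
    have "(ennreal ((1/2) ^ Suc k) * z k) pow\<^sub>\<infinity> a \<le> ennreal ((1/2) ^ Suc k) * z k pow\<^sub>\<infinity> a"
      using a power_le_one[of "1/2::real" "Suc k"]
      by (subst ennpow_mult) (auto intro!: mult_right_mono ennpow_le_self simp: ennreal_le_1 simp del: power_Suc)
    also have "\<dots> \<le> R"
      unfolding R_def using sum_le_suminf[of "\<lambda>k. ennreal ((1/2) ^ Suc k) * z k pow\<^sub>\<infinity> a" "{k}"] by simp
    finally have "((ennreal ((1/2) ^ Suc k) * z k) pow\<^sub>\<infinity> a) pow\<^sub>\<infinity> (1/a) \<le> R pow\<^sub>\<infinity> (1/a)"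
      using a by (intro ennpow_mono) auto
    then show ?thesis
      using a by (simp add: ennpow_ennpow)
  qed
  have "(\<Sum>k. ennreal ((1/4) ^ Suc k) * z k) = (\<Sum>k. ennreal ((1/2) ^ Suc k) * (ennreal ((1/2) ^ Suc k) * z k))"
    by (simp add: mult.assoc[symmetric] power_mult_distrib[symmetric] flip: ennreal_mult)
  also have "\<dots> \<le> (\<Sum>k. ennreal ((1/2) ^ Suc k) * R pow\<^sub>\<infinity> (1/a))"
    by (intro suminf_le mult_left_mono z) auto
  also have "\<dots> = R pow\<^sub>\<infinity> (1/a)"
    by (simp only: ennreal_suminf_multc suminf_half mult_1)
  finally have "(\<Sum>k. ennreal ((1/4) ^ Suc k) * z k) pow\<^sub>\<infinity> a \<le> (R pow\<^sub>\<infinity> (1/a)) pow\<^sub>\<infinity> a"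
    using a by (intro ennpow_mono) auto
  also have "\<dots> = R"
    using a by (simp add: ennpow_ennpow)
  finally show ?thesis
    by (simp add: R_def)
qed

text \<open>
  Countable subadditivity of the norm, for geometrically decreasing norms. Both Rubio de Francia's
  series and the series over a sequence of pairs are of this form.
\<close>

lemma var_bounded_suminf:
  fixes q :: "real ^ 'n \<Rightarrow> ennreal"
  assumes "\<And>k. var_bounded q (h k) ((1/4) ^ Suc k * L)" "0 < L" "\<And>x. 1 \<le> q x"
    and [measurable]: "q \<in> borel_measurable lebesgue" "\<And>k. h k \<in> borel_measurable lebesgue"
  shows "var_bounded q (\<lambda>x. \<Sum>k. h k x) L"
  unfolding var_bounded_def
proof
  define z where "z k x = h k x / ennreal ((1/4) ^ Suc k * L)" for k x
  have [measurable]: "z k \<in> borel_measurable lebesgue" for k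
    unfolding z_def by measurable
  have h: "h k x / ennreal L = ennreal ((1/4) ^ Suc k) * z k x" for k x
    using assms(2) unfolding z_def
    by (simp add: divide_ennreal_def inverse_ennreal mult.left_commute[of _ "h k x"] field_simps flip: ennreal_mult)
  have zint: "(\<integral>\<^sup>+x\<in>{x. q x \<noteq> \<infinity>}. z k x pow\<^sub>\<infinity> enn2real (q x) \<partial>lebesgue) \<le> 1" for k
    using assms(1)[of k] by (simp add: var_bounded_def z_def)
  have "((\<Sum>k. h k x) / ennreal L) pow\<^sub>\<infinity> enn2real (q x) \<le> (\<Sum>k. ennreal ((1/2) ^ Suc k) * z k x pow\<^sub>\<infinity> enn2real (q x))"
    if "q x \<noteq> \<infinity>" for x
  proof -
    have "1 \<le> enn2real (q x)"
      using assms(3)[of x] that by (cases "q x") auto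
    then show ?thesis
      using power_suminf_le[of "enn2real (q x)" "\<lambda>k. z k x"] by (simp only: h flip: ennreal_suminf_divide)
  qed
  then have "(\<integral>\<^sup>+x\<in>{x. q x \<noteq> \<infinity>}. ((\<Sum>k. h k x) / ennreal L) pow\<^sub>\<infinity> enn2real (q x) \<partial>lebesgue)
     \<le> (\<integral>\<^sup>+x. (\<Sum>k. ennreal ((1/2) ^ Suc k) * (z k x pow\<^sub>\<infinity> enn2real (q x) * indicator {x. q x \<noteq> \<infinity>} x)) \<partial>lebesgue)"
    by (intro nn_integral_mono) (auto split: split_indicator)
  also have "\<dots> = (\<Sum>k. ennreal ((1/2) ^ Suc k) * (\<integral>\<^sup>+x\<in>{x. q x \<noteq> \<infinity>}. z k x pow\<^sub>\<infinity> enn2real (q x) \<partial>lebesgue))"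
    by (subst nn_integral_suminf) (auto intro!: suminf_cong nn_integral_cmult)
  also have "\<dots> \<le> (\<Sum>k. ennreal ((1/2) ^ Suc k) * 1)"
    by (intro suminf_le mult_left_mono zint) auto
  also have "\<dots> = 1"
    by (simp only: suminf_half mult_1_right)
  finally show "(\<integral>\<^sup>+x\<in>{x. q x \<noteq> \<infinity>}. ((\<Sum>k. h k x) / ennreal L) pow\<^sub>\<infinity> enn2real (q x) \<partial>lebesgue) \<le> 1" .
  have "AE x in lebesgue. \<forall>k. q x = \<infinity> \<longrightarrow> h k x \<le> ennreal ((1/4) ^ Suc k * L)"
    unfolding AE_all_countable using assms(1) by (auto simp: var_bounded_def)
  then show "AE x in lebesgue. q x = \<infinity> \<longrightarrow> (\<Sum>k. h k x) \<le> ennreal L"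
  proof eventually_elim
    case (elim x)
    show ?case
    proof
      assume "q x = \<infinity>"
      have "(\<Sum>k. h k x) \<le> (\<Sum>k. ennreal ((1/2) ^ Suc k) * ennreal L)"
      proof (intro suminf_le)
        fix k
        have "(1/4) ^ Suc k * L \<le> (1/2) ^ Suc k * L"
          using assms(2) by (intro mult_right_mono power_mono) auto
        then have "ennreal ((1/4) ^ Suc k * L) \<le> ennreal ((1/2) ^ Suc k) * ennreal L"
          using assms(2) by (subst ennreal_mult[symmetric]) (auto intro!: ennreal_leI)
        then show "h k x \<le> ennreal ((1/2) ^ Suc k) * ennreal L"
          using elim \<open>q x = \<infinity>\<close> by (meson order_trans)
      qed auto
      then show "(\<Sum>k. h k x) \<le> ennreal L"
        by (simp only: ennreal_suminf_multc suminf_half mult_1)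
    qed
  qed
qed

section \<open>Conjugate exponents, Hoelder inequality and duality\<close>

lemma one_le_inverse_ennreal:
  fixes x :: ennreal
  assumes "x \<le> 1" shows "1 \<le> inverse x"
proof (cases x)
  case (real r)
  show ?thesis
  proof (cases "r = 0")
    case False
    then have "0 < r" "r \<le> 1"
      using real assms by (auto simp: ennreal_le_1)
    then have "1 \<le> inverse r"
      by (rule one_le_inverse)
    then show ?thesis
      using real \<open>0 < r\<close> by (simp add: inverse_ennreal ennreal_ge_1)
  qed (use real in auto)
qed (use assms in \<open>auto simp: top_unique\<close>)

lemma conj_exp_gt_1:
  assumes "1 < a" shows "conj_exp (ennreal a) = ennreal (a / (a - 1))"
proof -
  have "1 - inverse (ennreal a) = ennreal (1 - inverse a)"
    using assms by (simp add: inverse_ennreal ennreal_minus flip: ennreal_1)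
  moreover have "0 < 1 - inverse a"
    using assms by (simp add: field_simps)
  moreover have "inverse (1 - inverse a) = a / (a - 1)"
    using assms by (simp add: field_simps)
  ultimately show ?thesis
    by (simp add: conj_exp_def inverse_ennreal)
qed

lemma conj_exp_le_1:
  assumes "a \<le> 1" shows "conj_exp a = \<infinity>"
proof -
  have "1 \<le> inverse a"
    using assms by (rule one_le_inverse_ennreal)
  then show ?thesis
    by (simp add: conj_exp_def diff_eq_0_iff_ennreal)
qed

lemma conj_exp_ge_1: "1 \<le> conj_exp a"
  unfolding conj_exp_def by (intro one_le_inverse_ennreal diff_le_self_ennreal)

lemma conj_exp_finite_iff: "a < \<infinity> \<Longrightarrow> conj_exp a \<noteq> \<infinity> \<longleftrightarrow> 1 < a"
  by (cases a; cases "a \<le> 1") (auto simp: conj_exp_gt_1 conj_exp_le_1 not_le one_less_ennreal)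

lemma measurable_conj_exp [measurable (raw)]:
  "p \<in> borel_measurable M \<Longrightarrow> (\<lambda>x. conj_exp (p x)) \<in> borel_measurable M"
  unfolding conj_exp_def by measurable

text \<open>
  Young's inequality without its constants: compare \<open>b\<close> with \<open>a\<^bsup>c-1\<^esup>\<close>, for which both terms on the
  right are equal to the left-hand side.
\<close>

lemma young_crude:
  fixes a b :: ennreal
  assumes c: "1 < c"
  shows "a * b \<le> a pow\<^sub>\<infinity> c + b pow\<^sub>\<infinity> (c / (c - 1))"
proof (cases "b \<le> a pow\<^sub>\<infinity> (c - 1)")
  case True
  then have "a * b \<le> a * a pow\<^sub>\<infinity> (c - 1)"
    by (intro mult_left_mono) auto
  also have "\<dots> = a pow\<^sub>\<infinity> c"
    using c ennpow_add[of 1 "c - 1" a] by simp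
  finally show ?thesis
    by (simp add: add_increasing2)
next
  case False
  then have "(a pow\<^sub>\<infinity> (c - 1)) pow\<^sub>\<infinity> (1 / (c - 1)) \<le> b pow\<^sub>\<infinity> (1 / (c - 1))"
    using c by (intro ennpow_mono) auto
  then have "a * b \<le> b pow\<^sub>\<infinity> (1 / (c - 1)) * b pow\<^sub>\<infinity> 1"
    using c by (intro mult_mono) (auto simp: ennpow_ennpow)
  also have "\<dots> = b pow\<^sub>\<infinity> (1 / (c - 1) + 1)"
    using c by (intro ennpow_add[symmetric]) auto
  also have "1 / (c - 1) + 1 = c / (c - 1)"
    using c by (simp add: field_simps)
  finally show ?thesis
    by (simp add: add_increasing)
qed

text \<open>
  Where \<open>P > 1\<close>, Young's inequality applies pointwise; where \<open>P = 1\<close>, the conjugate exponent is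
  infinite and \<open>h\<close> is bounded by \<open>m\<close>.
\<close>

lemma var_hoelder:
  fixes P :: "real ^ 'n \<Rightarrow> ennreal"
  assumes "var_bounded P k l" "var_bounded (\<lambda>x. conj_exp (P x)) h m" "0 < l" "0 < m"
    and P: "\<And>x. P x < \<infinity>" "AE x in lebesgue. 1 \<le> P x"
    and [measurable]: "P \<in> borel_measurable lebesgue" "k \<in> borel_measurable lebesgue" "h \<in> borel_measurable lebesgue"
  shows "(\<integral>\<^sup>+x. k x * h x \<partial>lebesgue) \<le> ennreal (2 * l * m)"
proof -
  define q where "q x = conj_exp (P x)" for x
  have [measurable]: "q \<in> borel_measurable lebesgue"
    unfolding q_def by measurable
  define u where "u x = (k x / ennreal l) pow\<^sub>\<infinity> enn2real (P x)" for x
  define v where "v x = (h x / ennreal m) pow\<^sub>\<infinity> enn2real (q x) * indicator {x. q x \<noteq> \<infinity>} x" for x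
  have [measurable]: "u \<in> borel_measurable lebesgue" "v \<in> borel_measurable lebesgue"
    unfolding u_def v_def by measurable
  have "AE x in lebesgue. q x = \<infinity> \<longrightarrow> h x \<le> ennreal m"
    using assms(2) unfolding var_bounded_def q_def by simp
  then have "AE x in lebesgue. (k x / ennreal l) * (h x / ennreal m) \<le> u x + v x"
    using P(2)
  proof eventually_elim
    case (elim x)
    obtain a where a: "P x = ennreal a" "1 \<le> a"
      using P(1)[of x] elim(2) by (cases "P x") auto
    show ?case
    proof (cases "a = 1")
      case True
      then have "h x \<le> ennreal m"
        using elim(1) a by (simp add: q_def conj_exp_le_1)
      then have "h x / ennreal m \<le> 1"
        using ennreal_divide_mono[of "h x" "ennreal m" m m] assms(4) by simp
      then have "(k x / ennreal l) * (h x / ennreal m) \<le> (k x / ennreal l) * 1"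
        by (intro mult_left_mono) auto
      also have "\<dots> = u x"
        using True a by (simp add: u_def)
      finally show ?thesis
        by (simp add: add_increasing2)
    next
      case False
      then show ?thesis
        using a young_crude[of a "k x / ennreal l" "h x / ennreal m"]
        by (simp add: u_def v_def q_def conj_exp_gt_1)
    qed
  qed
  then have "(\<integral>\<^sup>+x. (k x / ennreal l) * (h x / ennreal m) \<partial>lebesgue) \<le> (\<integral>\<^sup>+x. u x + v x \<partial>lebesgue)"
    by (rule nn_integral_mono_AE)
  also have "\<dots> = (\<integral>\<^sup>+x. u x \<partial>lebesgue) + (\<integral>\<^sup>+x. v x \<partial>lebesgue)"
    by (rule nn_integral_add) auto
  also have "\<dots> \<le> 1 + 1"
    using assms(1,2) P(1) unfolding u_def v_def var_bounded_def q_def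
    by (intro add_mono) (auto simp: less_top[symmetric])
  finally have *: "(\<integral>\<^sup>+x. (k x / ennreal l) * (h x / ennreal m) \<partial>lebesgue) \<le> 2"
    by simp
  have kh: "k x * h x = ennreal (l * m) * ((k x / ennreal l) * (h x / ennreal m))" for x
  proof -
    have "ennreal (l * m) * (inverse (ennreal l) * inverse (ennreal m)) = 1"
      using assms(3,4) by (simp add: inverse_ennreal field_simps flip: ennreal_mult)
    then show ?thesis
      unfolding divide_ennreal_def by (metis (no_types, lifting) mult.assoc mult.commute mult.left_commute mult_1)
  qed
  have "(\<integral>\<^sup>+x. k x * h x \<partial>lebesgue) = ennreal (l * m) * (\<integral>\<^sup>+x. (k x / ennreal l) * (h x / ennreal m) \<partial>lebesgue)"
    unfolding kh by (intro nn_integral_cmult) measurable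
  also have "\<dots> \<le> ennreal (l * m) * 2"
    by (intro mult_left_mono *) auto
  also have "\<dots> = ennreal (2 * l * m)"
    using assms(3,4) by (simp add: ennreal_mult mult_ac flip: ennreal_numeral)
  finally show ?thesis .
qed

lemma ennpow_conj_le:
  assumes "1 < a" "1 < T" "x < \<infinity>"
  shows "(x pow\<^sub>\<infinity> (a - 1) / ennreal T) pow\<^sub>\<infinity> (a / (a - 1)) \<le> x pow\<^sub>\<infinity> a / ennreal T"
proof -
  have "(x pow\<^sub>\<infinity> (a - 1) / ennreal T) pow\<^sub>\<infinity> (a / (a - 1)) = x pow\<^sub>\<infinity> a / ennreal (T powr (a / (a - 1)))"
    using assms by (subst ennpow_divide) (auto simp: ennpow_ennpow)
  also have "\<dots> \<le> x pow\<^sub>\<infinity> a / ennreal T"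
    using assms powr_mono[of 1 "a / (a - 1)" T] by (intro ennreal_divide_mono) (auto simp: field_simps)
  finally show ?thesis .
qed

text \<open>
  The extremal function of Hoelder's inequality is \<open>(k/l)\<^bsup>P-1\<^esup>\<close>, divided by the integral of \<open>(k/l)\<^sup>P\<close>.
  As \<open>P\<close> may be unbounded, this integral can be infinite for every \<open>l\<close> below the norm of \<open>k\<close>; it is
  therefore first restricted to a set on which it is finite but still larger than one.
\<close>

lemma var_dual:
  fixes P k :: "real ^ 'n \<Rightarrow> ennreal"
  assumes big: "1 < (\<integral>\<^sup>+x. (k x / ennreal l) pow\<^sub>\<infinity> enn2real (P x) \<partial>lebesgue)" and l: "0 < l"
    and P: "\<And>x. P x < \<infinity>" "AE x in lebesgue. 1 \<le> P x" and k: "AE x in lebesgue. k x < \<infinity>"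
    and [measurable]: "P \<in> borel_measurable lebesgue" "k \<in> borel_measurable lebesgue"
  shows "\<exists>h\<in>borel_measurable lebesgue. var_bounded (\<lambda>x. conj_exp (P x)) h 1 \<and>
    ennreal l \<le> (\<integral>\<^sup>+x. k x * h x \<partial>lebesgue)"
proof -
  define g where "g x = (k x / ennreal l) pow\<^sub>\<infinity> enn2real (P x)" for x
  have [measurable]: "g \<in> borel_measurable lebesgue"
    unfolding g_def by measurable
  \<comment> \<open>The integral of \<open>(k/l)\<^sup>P\<close> over each of these sets is finite, and the sets exhaust almost all of the
      space.\<close>
  define E where "E n = {x \<in> ball 0 (real n). g x \<le> of_nat n}" for n
  have E_eq: "E n = {x \<in> space lebesgue. x \<in> ball 0 (real n) \<and> g x \<le> of_nat n}" for n
    by (auto simp: E_def)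
  have [measurable]: "ball 0 r \<in> sets lebesgue" for r :: real by simp
  have [measurable]: "E n \<in> sets lebesgue" for n
    unfolding E_eq by measurable
  have E_mono: "m \<le> n \<Longrightarrow> E m \<subseteq> E n" for m n
    unfolding E_def by (auto intro: order_trans[of _ "of_nat m :: ennreal"])
  have gfin: "AE x in lebesgue. g x < \<infinity>"
    using k P(2)
  proof eventually_elim
    case (elim x)
    have "k x / ennreal l < \<infinity>"
      using elim l by (simp add: ennreal_divide_eq_top_iff less_top[symmetric])
    moreover have "0 < enn2real (P x)"
      using elim P(1)[of x] by (cases "P x") auto
    ultimately show ?case
      using ennpow_eq_top_iff[of "enn2real (P x)" "k x / ennreal l"] by (auto simp: g_def less_top)
  qed
  have "(\<integral>\<^sup>+x. g x \<partial>lebesgue) = (\<integral>\<^sup>+x. (SUP n. g x * indicator (E n) x) \<partial>lebesgue)"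
    using gfin
  proof (intro nn_integral_cong_AE, eventually_elim)
    case (elim x)
    obtain n1 n2 where "norm x < real n1" "g x < of_nat n2"
      using elim reals_Archimedean2 ennreal_Ex_less_of_nat by (metis infinity_ennreal_def)
    then have "x \<in> E (max n1 n2)"
      by (auto simp: E_def less_max_iff_disj intro: order_trans[OF less_imp_le, of _ "of_nat n2"])
    then have "g x \<le> (SUP n. g x * indicator (E n) x)"
      by (intro SUP_upper2[of "max n1 n2"]) auto
    moreover have "(SUP n. g x * indicator (E n) x) \<le> g x"
      by (intro SUP_least) (auto split: split_indicator)
    ultimately show ?case by (rule antisym)
  qed
  also have "\<dots> = (SUP n. \<integral>\<^sup>+x. g x * indicator (E n) x \<partial>lebesgue)"
    using E_mono by (intro nn_integral_monotone_convergence_SUP)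
      (auto simp: incseq_def le_fun_def intro!: mult_left_mono split: split_indicator)
  finally obtain n where n: "1 < (\<integral>\<^sup>+x. g x * indicator (E n) x \<partial>lebesgue)"
    using big by (auto simp: g_def less_SUP_iff)
  have "(\<integral>\<^sup>+x. g x * indicator (E n) x \<partial>lebesgue) \<le> (\<integral>\<^sup>+x. of_nat n * indicator (ball 0 (real n) :: (real ^ 'n) set) x \<partial>lebesgue)"
    by (intro nn_integral_mono) (auto simp: E_def split: split_indicator)
  also have "\<dots> = of_nat n * emeasure lebesgue (ball 0 (real n) :: (real ^ 'n) set)"
    by (subst nn_integral_cmult_indicator) auto
  also have "\<dots> < \<infinity>"
    using emeasure_lborel_ball_finite[of "0 :: real ^ 'n" "real n"]
    by (auto simp: ennreal_mult_less_top of_nat_less_top)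
  finally obtain T where T: "(\<integral>\<^sup>+x. g x * indicator (E n) x \<partial>lebesgue) = ennreal T" "1 < T"
    using n by (cases "\<integral>\<^sup>+x. g x * indicator (E n) x \<partial>lebesgue") (auto simp: one_less_ennreal)
  define h where "h x = (k x / ennreal l) pow\<^sub>\<infinity> (enn2real (P x) - 1) * indicator (E n) x / ennreal T" for x
  have [measurable]: "h \<in> borel_measurable lebesgue"
    unfolding h_def by measurable
  have gT: "(\<integral>\<^sup>+x. g x * indicator (E n) x / ennreal T \<partial>lebesgue) = 1"
    using T by (simp add: nn_integral_divide divide_ennreal)
  have kh: "AE x in lebesgue. k x * h x = ennreal l * (g x * indicator (E n) x / ennreal T)"
    using k P(2)
  proof eventually_elim
    case (elim x)
    define a where "a = enn2real (P x)"
    have a: "1 \<le> a"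
      using elim P(1)[of x] by (cases "P x") (auto simp: a_def)
    have "k x = ennreal l * (k x / ennreal l)"
      using l by (simp add: divide_ennreal_def inverse_ennreal mult.left_commute[of _ "k x"] flip: ennreal_mult)
    moreover have "(k x / ennreal l) * (k x / ennreal l) pow\<^sub>\<infinity> (a - 1) = (k x / ennreal l) pow\<^sub>\<infinity> a"
      using a ennpow_add[of 1 "a - 1" "k x / ennreal l"] by (cases "a = 1") auto
    ultimately have "k x * (k x / ennreal l) pow\<^sub>\<infinity> (a - 1) = ennreal l * g x"
      unfolding g_def a_def by (metis mult.assoc)
    then show ?case
      unfolding h_def a_def by (metis ennreal_times_divide mult.assoc)
  qed
  have "var_bounded (\<lambda>x. conj_exp (P x)) h 1"
    unfolding var_bounded_def
  proof
    have "(\<integral>\<^sup>+x\<in>{x. conj_exp (P x) \<noteq> \<infinity>}. (h x / ennreal 1) pow\<^sub>\<infinity> enn2real (conj_exp (P x)) \<partial>lebesgue)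
        \<le> (\<integral>\<^sup>+x. g x * indicator (E n) x / ennreal T \<partial>lebesgue)"
      using k
    proof (intro nn_integral_mono_AE, eventually_elim)
      case (elim x)
      show ?case
      proof (cases "conj_exp (P x) = \<infinity>")
        case False
        then obtain a where a: "P x = ennreal a" "1 < a"
          using conj_exp_finite_iff[OF P(1)[of x]] P(1)[of x] by (cases "P x") (auto simp: one_less_ennreal)
        have "k x / ennreal l < \<infinity>"
          using elim l by (simp add: ennreal_divide_eq_top_iff less_top[symmetric])
        then show ?thesis
          using a ennpow_conj_le[of a T "k x / ennreal l"] T(2)
          by (cases "x \<in> E n") (auto simp: h_def g_def conj_exp_gt_1 ennpow_zero)
      qed auto
    qed
    then show "(\<integral>\<^sup>+x\<in>{x. conj_exp (P x) \<noteq> \<infinity>}. (h x / ennreal 1) pow\<^sub>\<infinity> enn2real (conj_exp (P x)) \<partial>lebesgue) \<le> 1"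
      unfolding gT .
    show "AE x in lebesgue. conj_exp (P x) = \<infinity> \<longrightarrow> h x \<le> ennreal 1"
      using P(2)
    proof eventually_elim
      case (elim x)
      show ?case
      proof
        assume "conj_exp (P x) = \<infinity>"
        then have "P x = 1"
          using conj_exp_finite_iff[OF P(1)[of x]] elim by auto
        then show "h x \<le> ennreal 1"
          using T(2) ennreal_divide_mono[of 1 1 1 T] by (cases "x \<in> E n") (auto simp: h_def)
      qed
    qed
  qed
  moreover have "(\<integral>\<^sup>+x. k x * h x \<partial>lebesgue) = ennreal l"
  proof -
    have "(\<integral>\<^sup>+x. k x * h x \<partial>lebesgue) = (\<integral>\<^sup>+x. ennreal l * (g x * indicator (E n) x / ennreal T) \<partial>lebesgue)"
      by (rule nn_integral_cong_AE[OF kh])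
    also have "\<dots> = ennreal l"
      by (subst nn_integral_cmult) (auto simp: gT)
    finally show ?thesis .
  qed
  ultimately show ?thesis
    by (intro bexI[of _ h]) auto
qed

section \<open>Maximal operators of weighted measures and the algorithm of Rubio de Francia\<close>

text \<open>
  Averages with respect to the measure \<open>v dx\<close>. For \<open>v = 1\<close> the maximal operator is the
  Hardy-Littlewood operator, here applied to functions with values in \<open>[0,\<infinity>]\<close> so that it can be
  iterated.
\<close>

definition wavg :: "(real ^ 'n \<Rightarrow> ennreal) \<Rightarrow> (real ^ 'n) set \<Rightarrow> (real ^ 'n \<Rightarrow> ennreal) \<Rightarrow> ennreal"
  where "wavg v B f = (\<integral>\<^sup>+x\<in>B. f x * v x \<partial>lebesgue) / (\<integral>\<^sup>+x\<in>B. v x \<partial>lebesgue)"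

definition wmax :: "(real ^ 'n \<Rightarrow> ennreal) \<Rightarrow> (real ^ 'n \<Rightarrow> ennreal) \<Rightarrow> real ^ 'n \<Rightarrow> ennreal"
  where "wmax v f x = (SUP B\<in>{B \<in> balls. x \<in> B}. wavg v B f)"

text \<open>
  The \<open>A\<^sub>1\<close> weights relative to the measure \<open>v dx\<close>. Positivity and the defining inequality are required
  at every point: the weights constructed below satisfy them there, and no null sets have to be
  carried along.
\<close>

definition A1 :: "(real ^ 'n \<Rightarrow> ennreal) \<Rightarrow> (real ^ 'n \<Rightarrow> ennreal) set"
  where "A1 v = {u \<in> borel_measurable lebesgue. (\<forall>x. 0 < u x) \<and> (AE x in lebesgue. u x < \<infinity>) \<and>
    (\<exists>K>0. \<forall>B\<in>balls. \<forall>x\<in>B. wavg v B u \<le> ennreal K * u x)}"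

lemma balls_lebesgue [measurable]: "B \<in> balls \<Longrightarrow> B \<in> sets lebesgue"
  by (auto simp: balls_def)

lemma emeasure_balls:
  "(B :: (real ^ 'n) set) \<in> balls \<Longrightarrow> 0 < emeasure lebesgue B \<and> emeasure lebesgue B < \<infinity>"
  by (auto simp: balls_def emeasure_ball)

lemma open_wmax_gt: "open {x. a < wmax v f x}"
proof -
  have "{x. a < wmax v f x} = \<Union>{B \<in> balls. a < wavg v B f}"
    by (auto simp: wmax_def less_SUP_iff)
  then show ?thesis
    by (auto simp: balls_def)
qed

lemma measurable_wmax [measurable]: "wmax v f \<in> borel_measurable lebesgue"
proof -
  have "wmax v f \<in> borel_measurable borel"
    using open_wmax_gt[of _ v f] by (intro borel_measurableI_greater) auto
  then show ?thesis
    by (simp add: measurable_completion)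
qed

lemma wavg_le_wmax: "B \<in> balls \<Longrightarrow> x \<in> B \<Longrightarrow> wavg v B f \<le> wmax v f x"
  unfolding wmax_def by (auto intro: SUP_upper)

lemma wavg_suminf:
  assumes [measurable]: "\<And>k. f k \<in> borel_measurable lebesgue" "v \<in> borel_measurable lebesgue" "B \<in> balls"
  shows "wavg v B (\<lambda>x. \<Sum>k. f k x) = (\<Sum>k. wavg v B (f k))"
proof -
  have "(\<integral>\<^sup>+x\<in>B. (\<Sum>k. f k x) * v x \<partial>lebesgue) = (\<integral>\<^sup>+x. (\<Sum>k. f k x * v x * indicator B x) \<partial>lebesgue)"
    by simp
  also have "\<dots> = (\<Sum>k. \<integral>\<^sup>+x\<in>B. f k x * v x \<partial>lebesgue)"
    by (rule nn_integral_suminf) measurable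
  finally show ?thesis
    by (simp add: wavg_def)
qed

lemma wavg_cmult:
  assumes [measurable]: "f \<in> borel_measurable lebesgue" "v \<in> borel_measurable lebesgue" "B \<in> balls"
  shows "wavg v B (\<lambda>x. c * f x) = c * wavg v B f"
proof -
  have "(\<integral>\<^sup>+x\<in>B. c * f x * v x \<partial>lebesgue) = (\<integral>\<^sup>+x. c * (f x * v x * indicator B x) \<partial>lebesgue)"
    by (simp add: mult.assoc)
  also have "\<dots> = c * (\<integral>\<^sup>+x\<in>B. f x * v x \<partial>lebesgue)"
    by (rule nn_integral_cmult) measurable
  finally show ?thesis
    by (simp add: wavg_def ennreal_times_divide)
qed

lemma wavg_mono: "(\<And>x. x \<in> B \<Longrightarrow> f x \<le> g x) \<Longrightarrow> wavg v B f \<le> wavg v B g"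
  unfolding wavg_def by (intro divide_right_mono_ennreal nn_integral_mono) (auto intro!: mult_right_mono split: split_indicator)

lemma ball_integral_positive_near:
  fixes f :: "real ^ 'n \<Rightarrow> ennreal"
  assumes [measurable]: "f \<in> borel_measurable lebesgue" and f: "0 < (\<integral>\<^sup>+x. f x \<partial>lebesgue)"
  shows "\<exists>B\<in>balls. x \<in> B \<and> 0 < (\<integral>\<^sup>+x\<in>B. f x \<partial>lebesgue)"
proof -
  have [measurable]: "ball x r \<in> sets lebesgue" for r by simp
  have "(\<integral>\<^sup>+y. f y \<partial>lebesgue) = (\<integral>\<^sup>+y. (SUP n. f y * indicator (ball x (real (Suc n))) y) \<partial>lebesgue)"
  proof (intro nn_integral_cong antisym)
    fix y
    obtain n where "dist x y < real n"
      using reals_Archimedean2 by blast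
    then have "y \<in> ball x (real (Suc n))" by auto
    then show "f y \<le> (SUP n. f y * indicator (ball x (real (Suc n))) y)"
      by (intro SUP_upper2[of n]) auto
    show "(SUP n. f y * indicator (ball x (real (Suc n))) y) \<le> f y"
      by (intro SUP_least) (auto split: split_indicator)
  qed
  also have "\<dots> = (SUP n. \<integral>\<^sup>+y\<in>ball x (real (Suc n)). f y \<partial>lebesgue)"
    by (intro nn_integral_monotone_convergence_SUP)
      (auto simp: incseq_def le_fun_def intro!: mult_left_mono split: split_indicator)
  finally obtain n where "0 < (\<integral>\<^sup>+y\<in>ball x (real (Suc n)). f y \<partial>lebesgue)"
    using f by (auto simp: less_SUP_iff)
  then show ?thesis
    by (intro bexI[of _ "ball x (real (Suc n))"]) (auto simp: balls_def simp del: of_nat_Suc intro!: exI[of _ x] exI[of _ "real (Suc n)"])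
qed

definition max_bounded_on ::
  "(real ^ 'n \<Rightarrow> ennreal) \<Rightarrow> (real ^ 'n \<Rightarrow> ennreal) \<Rightarrow> (real ^ 'n \<Rightarrow> ennreal) \<Rightarrow> real \<Rightarrow> bool"
  where
  "max_bounded_on v q \<omega> C \<longleftrightarrow> (\<forall>h\<in>borel_measurable lebesgue. \<forall>l>0. var_bounded q (\<lambda>x. h x * \<omega> x) l \<longrightarrow>
     var_bounded q (\<lambda>x. wmax v h x * \<omega> x) (C * l))"

text \<open>
  The series \<open>H = \<Sum>\<^sub>k (4C)\<^bsup>-k\<^esup> M\<^sup>k h\<close> is a majorant of \<open>h\<close>, converges in the space on which \<open>M\<close> is
  bounded with constant \<open>C\<close>, and satisfies \<open>M H \<le> 4C H\<close> because \<open>M\<close> shifts the series by one term.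
  The general exponent and the general measure are used for the two applications: the variable
  exponent with Lebesgue measure, and a constant exponent with the measure of an \<open>A\<^sub>1\<close> weight.
\<close>

lemma rubio_de_francia:
  fixes v q \<omega> h :: "real ^ 'n \<Rightarrow> ennreal"
  assumes bdd: "max_bounded_on v q \<omega> C" and C: "0 < C" and q: "\<And>x. 1 \<le> q x"
    and h: "var_bounded q (\<lambda>x. h x * \<omega> x) l" "0 < l" "0 < (\<integral>\<^sup>+x. h x * v x \<partial>lebesgue)"
    and [measurable]: "v \<in> borel_measurable lebesgue" "q \<in> borel_measurable lebesgue"
      "\<omega> \<in> borel_measurable lebesgue" "h \<in> borel_measurable lebesgue"
    and v: "\<And>B. B \<in> balls \<Longrightarrow> (\<integral>\<^sup>+x\<in>B. v x \<partial>lebesgue) < \<infinity>"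
    and \<omega>: "AE x in lebesgue. 0 < \<omega> x"
  obtains H where "H \<in> A1 v" "\<And>x. h x \<le> H x" "var_bounded q (\<lambda>x. H x * \<omega> x) (4 * l)"
proof -
  define T where "T k = (wmax v ^^ k) h" for k
  have T_Suc: "T (Suc k) = wmax v (T k)" and T0: "T 0 = h" for k
    by (simp_all add: T_def)
  have [measurable]: "T k \<in> borel_measurable lebesgue" for k
    by (cases k) (simp_all add: T_Suc T0)
  have Tb: "var_bounded q (\<lambda>x. T k x * \<omega> x) (C ^ k * l)" for k
  proof (induction k)
    case 0
    then show ?case using h by (simp add: T0)
  next
    case (Suc k)
    then show ?case
      using bdd C h(2) by (auto simp: max_bounded_on_def T_Suc mult.assoc)
  qed
  \<comment> \<open>The factor 4 makes the \<open>k\<close>-th term of norm \<open>4\<^bsup>-k\<^esup> l\<close>, as \<open>var_bounded_suminf\<close> requires.\<close>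
  define D where "D = 4 * C"
  have D: "0 < D" using C by (simp add: D_def)
  define H where "H x = (\<Sum>k. ennreal (1 / D ^ k) * T k x)" for x
  have [measurable]: "H \<in> borel_measurable lebesgue"
    unfolding H_def by measurable
  have Hb: "var_bounded q (\<lambda>x. H x * \<omega> x) (4 * l)"
  proof -
    have "var_bounded q (\<lambda>x. ennreal (1 / D ^ k) * T k x * \<omega> x) ((1/4) ^ Suc k * (4 * l))" for k
    proof -
      have eq: "C ^ k * l = D ^ k * ((1/4) ^ Suc k * (4 * l))"
        by (simp add: D_def power_mult_distrib power_divide)
      show ?thesis
        using var_bounded_cmult[OF Tb[of k], of "1 / D ^ k"] C D h(2) by (simp add: eq mult.assoc)
    qed
    then have "var_bounded q (\<lambda>x. \<Sum>k. ennreal (1 / D ^ k) * T k x * \<omega> x) (4 * l)"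
      using h(2) q by (intro var_bounded_suminf) auto
    then show ?thesis
      by (simp add: H_def)
  qed
  have hH: "h x \<le> H x" for x
    unfolding H_def using sum_le_suminf[of "\<lambda>k. ennreal (1 / D ^ k) * T k x" "{0}"] by (simp add: T0)
  have avgH: "wavg v B H \<le> ennreal D * H x" if [measurable]: "B \<in> balls" and x: "x \<in> B" for B x
  proof -
    have "wavg v B H = (\<Sum>k. ennreal (1 / D ^ k) * wavg v B (T k))"
      unfolding H_def using that by (subst wavg_suminf) (auto simp: wavg_cmult)
    also have "\<dots> \<le> (\<Sum>k. ennreal D * (ennreal (1 / D ^ Suc k) * T (Suc k) x))"
    proof (intro suminf_le)
      fix k
      have "ennreal D * ennreal (1 / D ^ Suc k) = ennreal (1 / D ^ k)"
        using D by (simp flip: ennreal_mult)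
      moreover have "wavg v B (T k) \<le> T (Suc k) x"
        unfolding T_Suc using that by (rule wavg_le_wmax)
      ultimately show "ennreal (1 / D ^ k) * wavg v B (T k) \<le> ennreal D * (ennreal (1 / D ^ Suc k) * T (Suc k) x)"
        by (simp add: mult.assoc[symmetric] mult_left_mono del: power_Suc)
    qed auto
    also have "\<dots> = ennreal D * (\<Sum>k. ennreal (1 / D ^ Suc k) * T (Suc k) x)"
      by (rule ennreal_suminf_cmult)
    also have "\<dots> \<le> ennreal D * H x"
      unfolding H_def
      by (subst suminf_offset[of "\<lambda>k. ennreal (1 / D ^ k) * T k x" 1]) (auto intro!: mult_left_mono simp: add_increasing)
    finally show ?thesis .
  qed
  have Hpos: "0 < H x" for x
  proof -
    obtain B where B: "B \<in> balls" "x \<in> B" "0 < (\<integral>\<^sup>+x\<in>B. h x * v x \<partial>lebesgue)"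
      using ball_integral_positive_near[of "\<lambda>x. h x * v x" x] h(3) by auto
    then have "0 < wavg v B h"
      using v[of B] by (auto simp: wavg_def ennreal_zero_less_divide less_top[symmetric])
    also have "\<dots> \<le> wavg v B H"
      by (intro wavg_mono hH)
    also have "\<dots> \<le> ennreal D * H x"
      using B by (intro avgH)
    finally show ?thesis
      by (auto simp: zero_less_iff_neq_zero)
  qed
  have "AE x in lebesgue. H x < \<infinity>"
  proof -
    have "AE x in lebesgue. H x * \<omega> x < \<infinity>"
      using Hb h(2) less_le_trans[OF zero_less_one q] by (intro var_bounded_AE_finite[of q _ "4 * l"]) auto
    then show ?thesis
      using \<omega> by eventually_elim (auto simp: ennreal_mult_less_top)
  qed
  then have "H \<in> A1 v"
    using D Hpos avgH by (auto simp: A1_def intro!: exI[of _ D])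
  then show ?thesis
    using hH Hb by (rule that)
qed

section \<open>Weak and strong type of the maximal operator of a doubling weight\<close>

abbreviation A1_plain :: "(real ^ 'n \<Rightarrow> ennreal) set"
  where "A1_plain \<equiv> A1 (\<lambda>_. 1)"

lemma A1D:
  assumes "u \<in> A1 v"
  shows "u \<in> borel_measurable lebesgue" "\<And>x. 0 < u x" "AE x in lebesgue. u x < \<infinity>"
    "\<exists>K>0. \<forall>B\<in>balls. \<forall>x\<in>B. wavg v B u \<le> ennreal K * u x"
  using assms by (auto simp: A1_def)

lemma ball_integral_pos:
  fixes f :: "real ^ 'n \<Rightarrow> ennreal"
  assumes [measurable]: "f \<in> borel_measurable lebesgue" "B \<in> balls" and f: "\<And>x. 0 < f x"
  shows "0 < (\<integral>\<^sup>+x\<in>B. f x \<partial>lebesgue)"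
proof (rule ccontr)
  assume "\<not> 0 < (\<integral>\<^sup>+x\<in>B. f x \<partial>lebesgue)"
  then have "AE x in lebesgue. f x * indicator B x = 0"
    by (subst nn_integral_0_iff_AE[symmetric]) auto
  then have "AE x in lebesgue. x \<notin> B"
    by eventually_elim (use f in \<open>auto simp: zero_less_iff_neq_zero split: split_indicator_asm\<close>)
  then have "emeasure lebesgue B = 0"
    by (subst (asm) AE_iff_measurable[of B]) auto
  then show False
    using emeasure_balls[OF assms(2)] by simp
qed

lemma A1_integral_finite:
  fixes u v :: "real ^ 'n \<Rightarrow> ennreal"
  assumes u: "u \<in> A1 v" and v: "(\<integral>\<^sup>+x\<in>B. v x \<partial>lebesgue) < \<infinity>" and B: "B \<in> balls"
  shows "(\<integral>\<^sup>+x\<in>B. u x * v x \<partial>lebesgue) < \<infinity>"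
proof -
  obtain K where K: "wavg v B u \<le> ennreal K * u x" if "x \<in> B" for x
    using A1D(4)[OF u] B by blast
  have "\<exists>x\<in>B. u x < \<infinity>"
  proof (rule ccontr)
    assume "\<not> (\<exists>x\<in>B. u x < \<infinity>)"
    with A1D(3)[OF u] have "AE x in lebesgue. x \<notin> B"
      by (auto elim!: eventually_mono)
    then have "emeasure lebesgue B = 0"
      using B by (subst (asm) AE_iff_measurable[of B]) auto
    then show False
      using emeasure_balls[OF B] by simp
  qed
  then obtain x where x: "x \<in> B" "u x < \<infinity>" by blast
  then have "wavg v B u < \<infinity>"
    using K[of x] by (auto simp: ennreal_mult_less_top intro: le_less_trans)
  then show ?thesis
    using v by (auto simp: wavg_def ennreal_divide_eq_top_iff less_top[symmetric])
qed

lemma A1_plain_integral_finite: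
  "v \<in> A1_plain \<Longrightarrow> B \<in> balls \<Longrightarrow> (\<integral>\<^sup>+x\<in>B. v x \<partial>lebesgue) < \<infinity>"
  using A1_integral_finite[of v "\<lambda>_. 1" B] emeasure_balls[of B] by simp

text \<open>
  The average of \<open>v\<close> over the enlarged ball is at most \<open>K v(x)\<close> at every point \<open>x\<close> of the small ball;
  integrate over the small ball.
\<close>

lemma A1_plain_doubling:
  fixes v :: "real ^ 'n \<Rightarrow> ennreal"
  assumes v: "v \<in> A1_plain"
  obtains D where "0 < D" "\<And>c r. 0 < r \<Longrightarrow>
    (\<integral>\<^sup>+x\<in>ball c (5 * r). v x \<partial>lebesgue) \<le> ennreal D * (\<integral>\<^sup>+x\<in>ball c r. v x \<partial>lebesgue)"
proof -
  note [measurable] = A1D(1)[OF v]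
  obtain K where K: "0 < K" "\<And>B x. B \<in> balls \<Longrightarrow> x \<in> B \<Longrightarrow> wavg (\<lambda>_. 1) B v \<le> ennreal K * v x"
    using A1D(4)[OF v] by blast
  define n where "n = CARD('n)"
  have "(\<integral>\<^sup>+x\<in>ball c (5 * r). v x \<partial>lebesgue) \<le> ennreal (5 ^ n * K) * (\<integral>\<^sup>+x\<in>ball c r. v x \<partial>lebesgue)"
    if r: "0 < r" for c r
  proof -
    have [measurable]: "ball c r \<in> sets lebesgue" by simp
    define I where "I = (\<integral>\<^sup>+x\<in>ball c (5 * r). v x \<partial>lebesgue)"
    define m where "m = unit_ball_vol (real n) * r ^ n"
    have m: "0 < m" using r by (simp add: m_def)
    have e: "emeasure lebesgue (ball c r) = ennreal m" "emeasure lebesgue (ball c (5 * r)) = ennreal (5 ^ n * m)"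
      using r by (simp_all add: emeasure_ball m_def n_def power_mult_distrib mult_ac)
    have "I / ennreal (5 ^ n * m) \<le> ennreal K * v x" if "x \<in> ball c r" for x
      using K(2)[of "ball c (5 * r)" x] that r e unfolding I_def wavg_def balls_def by fastforce
    then have "(\<integral>\<^sup>+x. I / ennreal (5 ^ n * m) * indicator (ball c r) x \<partial>lebesgue)
      \<le> (\<integral>\<^sup>+x. ennreal K * (v x * indicator (ball c r) x) \<partial>lebesgue)"
      by (intro nn_integral_mono) (auto split: split_indicator)
    then have "I / ennreal (5 ^ n * m) * ennreal m \<le> ennreal K * (\<integral>\<^sup>+x\<in>ball c r. v x \<partial>lebesgue)"
      by (simp add: nn_integral_cmult_indicator nn_integral_cmult e(1)[simplified])
    then have "ennreal (5 ^ n) * (I / ennreal (5 ^ n * m) * ennreal m) \<le> ennreal (5 ^ n) * (ennreal K * (\<integral>\<^sup>+x\<in>ball c r. v x \<partial>lebesgue))"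
      by (intro mult_left_mono) auto
    also have "ennreal (5 ^ n) * (I / ennreal (5 ^ n * m) * ennreal m) = I * (ennreal (5 ^ n * m) * inverse (ennreal (5 ^ n * m)))"
      using m by (simp add: divide_ennreal_def ennreal_mult mult_ac)
    also have "\<dots> = I"
      using m by (simp add: inverse_ennreal field_simps flip: ennreal_mult)
    finally show ?thesis
      using K(1) by (simp add: I_def ennreal_mult mult_ac)
  qed
  then show ?thesis
    using K(1) by (intro that[of "5 ^ n * K"]) auto
qed

lemma emeasure_UN_countable_le:
  assumes C: "countable C" and [measurable]: "\<And>i. i \<in> C \<Longrightarrow> X i \<in> sets M"
  shows "emeasure M (\<Union>i\<in>C. X i) \<le> (\<integral>\<^sup>+i. emeasure M (X i) \<partial>count_space C)"
proof -
  have "indicator (\<Union>i\<in>C. X i) x \<le> (\<integral>\<^sup>+i. indicator (X i) x \<partial>count_space C)" for x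
  proof (cases "x \<in> (\<Union>i\<in>C. X i)")
    case True
    then obtain i where "i \<in> C" "x \<in> X i" by auto
    then show ?thesis
      using nn_integral_ge_point[of i C "\<lambda>i. indicator (X i) x :: ennreal"] by (auto split: split_indicator)
  qed auto
  then have "(\<integral>\<^sup>+x. indicator (\<Union>i\<in>C. X i) x \<partial>M) \<le> (\<integral>\<^sup>+x. \<integral>\<^sup>+i. indicator (X i) x \<partial>count_space C \<partial>M)"
    by (rule nn_integral_mono)
  also have "\<dots> = (\<integral>\<^sup>+i. \<integral>\<^sup>+x. indicator (X i) x \<partial>M \<partial>count_space C)"
    by (rule nn_integral_count_space_nn_integral[OF C]) auto
  also have "\<dots> = (\<integral>\<^sup>+i. emeasure M (X i) \<partial>count_space C)"
    by (intro nn_integral_cong) auto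
  finally show ?thesis
    using C by (subst (asm) nn_integral_indicator) (auto intro!: sets.countable_UN')
qed

text \<open>
  The superlevel set is a union of balls on which the average of \<open>\<psi>\<close> exceeds \<open>a\<close>. Vitali's lemma
  selects disjoint balls whose fivefold enlargements cover the set, and doubling compares the measure
  of the enlarged balls with that of the disjoint ones. Vitali's lemma needs bounded radii, whence
  the exhaustion by balls of radius at most \<open>R\<close>.
\<close>

lemma wmax_weak_type:
  fixes v \<psi> :: "real ^ 'n \<Rightarrow> ennreal"
  assumes v: "v \<in> A1_plain" and D: "0 < D" "\<And>c r. 0 < r \<Longrightarrow>
    (\<integral>\<^sup>+x\<in>ball c (5 * r). v x \<partial>lebesgue) \<le> ennreal D * (\<integral>\<^sup>+x\<in>ball c r. v x \<partial>lebesgue)"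
    and \<psi> [measurable]: "\<psi> \<in> borel_measurable lebesgue" and a: "0 < a"
  shows "(\<integral>\<^sup>+x\<in>{x. ennreal a < wmax v \<psi> x}. v x \<partial>lebesgue) \<le> ennreal (D / a) * (\<integral>\<^sup>+x. \<psi> x * v x \<partial>lebesgue)"
proof -
  note v_meas [measurable] = A1D(1)[OF v]
  define \<mu> where "\<mu> = density lebesgue v"
  define \<nu> where "\<nu> = density lebesgue (\<lambda>x. \<psi> x * v x)"
  have [measurable_cong, simp]: "sets \<mu> = sets lebesgue" "sets \<nu> = sets lebesgue"
    by (auto simp: \<mu>_def \<nu>_def)
  have em: "emeasure \<mu> A = (\<integral>\<^sup>+x\<in>A. v x \<partial>lebesgue)" if "A \<in> sets lebesgue" for A
    using that by (simp add: \<mu>_def emeasure_density)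
  have en: "emeasure \<nu> A = (\<integral>\<^sup>+x\<in>A. \<psi> x * v x \<partial>lebesgue)" if "A \<in> sets lebesgue" for A
    using that by (simp add: \<nu>_def emeasure_density)
  define K where "K R = {(c, r). 0 < r \<and> r \<le> real R \<and> ennreal a < wavg v (ball c r) \<psi>}" for R
  define S where "S R = (\<Union>(c, r)\<in>K R. ball c r)" for R
  have S_open: "open (S R)" for R
    by (auto simp: S_def)
  then have [measurable]: "S R \<in> sets lebesgue" for R
    by (simp add: borel_open)
  have "{x. ennreal a < wmax v \<psi> x} = (\<Union>R. S R)"
  proof (intro equalityI subsetI)
    fix x assume "x \<in> {x. ennreal a < wmax v \<psi> x}"
    then obtain c r where cr: "0 < r" "x \<in> ball c r" "ennreal a < wavg v (ball c r) \<psi>"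
      by (auto simp: wmax_def less_SUP_iff balls_def)
    moreover obtain R where "r \<le> real R"
      using real_arch_simple by blast
    ultimately show "x \<in> (\<Union>R. S R)"
      by (force simp: S_def K_def)
  next
    fix x assume "x \<in> (\<Union>R. S R)"
    then obtain c r where cr: "0 < r" "x \<in> ball c r" "ennreal a < wavg v (ball c r) \<psi>"
      by (auto simp: S_def K_def)
    then show "x \<in> {x. ennreal a < wmax v \<psi> x}"
      using wavg_le_wmax[of "ball c r" x v \<psi>] by (auto simp: balls_def intro: less_le_trans)
  qed
  moreover have "incseq S"
    by (rule incseq_SucI) (auto simp: S_def K_def intro!: UN_mono)
  ultimately have "(\<integral>\<^sup>+x\<in>{x. ennreal a < wmax v \<psi> x}. v x \<partial>lebesgue) = (SUP R. emeasure \<mu> (S R))"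
    using S_open by (subst SUP_emeasure_incseq) (auto simp: em)
  also have "\<dots> \<le> ennreal (D / a) * (\<integral>\<^sup>+x. \<psi> x * v x \<partial>lebesgue)"
  proof (rule SUP_least)
    fix R
    have cover: "S R \<subseteq> (\<Union>i\<in>K R. ball (fst i) (snd i))"
      by (force simp: S_def)
    have radius: "0 < snd i \<and> snd i \<le> real R" if "i \<in> K R" for i
      using that by (auto simp: K_def)
    obtain C where C: "countable C" "C \<subseteq> K R"
      "pairwise (\<lambda>i j. disjnt (ball (fst i) (snd i)) (ball (fst j) (snd j))) C"
      "S R \<subseteq> (\<Union>i\<in>C. ball (fst i) (5 * snd i))"
      by (rule Vitali_covering_lemma_balls[OF cover radius], assumption) (rule that)
    have CB: "0 < snd i" "ball (fst i) (snd i) \<in> balls" "ennreal a < wavg v (ball (fst i) (snd i)) \<psi>" if "i \<in> C" for i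
    proof -
      have "i \<in> K R"
        using C(2) that by blast
      then show "0 < snd i" "ennreal a < wavg v (ball (fst i) (snd i)) \<psi>"
        by (auto simp: K_def)
      then show "ball (fst i) (snd i) \<in> balls"
        unfolding balls_def by blast
    qed
    have each: "emeasure \<mu> (ball (fst i) (5 * snd i)) \<le> ennreal (D / a) * emeasure \<nu> (ball (fst i) (snd i))" if "i \<in> C" for i
    proof -
      let ?B = "ball (fst i) (snd i)"
      have fin: "0 < emeasure \<mu> ?B" "emeasure \<mu> ?B < \<infinity>"
        using ball_integral_pos[OF v_meas CB(2)[OF that] A1D(2)[OF v]] A1_plain_integral_finite[OF v CB(2)[OF that]]
        by (auto simp: em)
      have "ennreal a \<le> emeasure \<nu> ?B / emeasure \<mu> ?B"
        using CB(3)[OF that] by (simp add: wavg_def em en)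
      then have "ennreal a * emeasure \<mu> ?B \<le> emeasure \<nu> ?B / emeasure \<mu> ?B * emeasure \<mu> ?B"
        by (intro mult_right_mono) auto
      also have "\<dots> = emeasure \<nu> ?B"
        using fin by (simp add: ennreal_divide_times)
      finally have "ennreal (D / a) * (ennreal a * emeasure \<mu> ?B) \<le> ennreal (D / a) * emeasure \<nu> ?B"
        by (intro mult_left_mono) auto
      moreover have "ennreal (D / a) * (ennreal a * emeasure \<mu> ?B) = ennreal D * emeasure \<mu> ?B"
        using a D(1) by (simp add: mult.assoc[symmetric] flip: ennreal_mult)
      ultimately show ?thesis
        using D(2)[OF CB(1)[OF that], of "fst i"] by (simp add: em)
    qed
    have "(\<integral>\<^sup>+i. emeasure \<nu> (ball (fst i) (snd i)) \<partial>count_space C) = emeasure \<nu> (\<Union>i\<in>C. ball (fst i) (snd i))"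
      using C by (intro emeasure_UN_countable[symmetric])
        (auto simp: disjoint_family_on_def pairwise_def disjnt_def)
    also have "\<dots> \<le> emeasure \<nu> (space \<nu>)"
      by (rule emeasure_space)
    also have "\<dots> = (\<integral>\<^sup>+x. \<psi> x * v x \<partial>lebesgue)"
      by (simp add: \<nu>_def emeasure_density)
    finally have total: "(\<integral>\<^sup>+i. emeasure \<nu> (ball (fst i) (snd i)) \<partial>count_space C) \<le> (\<integral>\<^sup>+x. \<psi> x * v x \<partial>lebesgue)" .
    have "emeasure \<mu> (S R) \<le> emeasure \<mu> (\<Union>i\<in>C. ball (fst i) (5 * snd i))"
      using C by (intro emeasure_mono) (auto intro!: sets.countable_UN')
    also have "\<dots> \<le> (\<integral>\<^sup>+i. emeasure \<mu> (ball (fst i) (5 * snd i)) \<partial>count_space C)"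
      using C(1) by (intro emeasure_UN_countable_le) auto
    also have "\<dots> \<le> (\<integral>\<^sup>+i. ennreal (D / a) * emeasure \<nu> (ball (fst i) (snd i)) \<partial>count_space C)"
      using each by (intro nn_integral_mono) auto
    also have "\<dots> = ennreal (D / a) * (\<integral>\<^sup>+i. emeasure \<nu> (ball (fst i) (snd i)) \<partial>count_space C)"
      by (rule nn_integral_cmult) auto
    also have "\<dots> \<le> ennreal (D / a) * (\<integral>\<^sup>+x. \<psi> x * v x \<partial>lebesgue)"
      by (rule mult_left_mono[OF total]) simp
    finally show "emeasure \<mu> (S R) \<le> ennreal (D / a) * (\<integral>\<^sup>+x. \<psi> x * v x \<partial>lebesgue)" .
  qed
  finally show ?thesis .
qed

text \<open>
  The pointwise identity behind the layer-cake formula.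
\<close>

lemma nn_integral_powr_below:
  assumes \<alpha>: "0 < \<alpha>"
  shows "(\<integral>\<^sup>+t. ennreal (t powr (\<alpha> - 1)) * indicator {t. 0 < t \<and> ennreal t < y} t \<partial>lborel)
    = y pow\<^sub>\<infinity> \<alpha> * ennreal (1 / \<alpha>)"
proof -
  have fin: "(\<integral>\<^sup>+t. ennreal (t powr (\<alpha> - 1)) * indicator {t. 0 < t \<and> ennreal t < ennreal c} t \<partial>lborel)
    = ennreal c pow\<^sub>\<infinity> \<alpha> * ennreal (1 / \<alpha>)" if c: "0 \<le> c" for c
  proof -
    have "(\<integral>\<^sup>+t. ennreal (t powr (\<alpha> - 1)) * indicator {t. 0 < t \<and> ennreal t < ennreal c} t \<partial>lborel)
      = (\<integral>\<^sup>+t. ennreal (t powr (\<alpha> - 1)) * indicator {0..c} t \<partial>lborel)"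
      using AE_lborel_singleton[of "0 :: real"] AE_lborel_singleton[of c]
    proof (intro nn_integral_cong_AE, eventually_elim)
      case (elim t)
      then show ?case
        by (cases "0 < t") (auto simp: ennreal_less_iff split: split_indicator)
    qed
    also have "\<dots> = ennreal (c powr (\<alpha> - 1 + 1) / (\<alpha> - 1 + 1))"
      using \<alpha> c by (intro nn_integral_has_integral_lebesgue' has_integral_powr_from_0) auto
    also have "\<dots> = ennreal c pow\<^sub>\<infinity> \<alpha> * ennreal (1 / \<alpha>)"
      using \<alpha> c by (simp add: ennpow_ennreal_nonneg flip: ennreal_mult)
    finally show ?thesis .
  qed
  show ?thesis
  proof (cases y)
    case top
    have "ennreal (real n) \<le> (\<integral>\<^sup>+t. ennreal (t powr (\<alpha> - 1)) * indicator {t. 0 < t \<and> ennreal t < y} t \<partial>lborel)" for n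
    proof -
      define c where "c = (\<alpha> * real n) powr (1 / \<alpha>)"
      have "ennreal (real n) = ennreal c pow\<^sub>\<infinity> \<alpha> * ennreal (1 / \<alpha>)"
        using \<alpha> by (simp add: c_def ennpow_ennreal_nonneg powr_powr flip: ennreal_mult)
      also have "\<dots> = (\<integral>\<^sup>+t. ennreal (t powr (\<alpha> - 1)) * indicator {t. 0 < t \<and> ennreal t < ennreal c} t \<partial>lborel)"
        by (rule fin[symmetric]) (simp add: c_def)
      also have "\<dots> \<le> (\<integral>\<^sup>+t. ennreal (t powr (\<alpha> - 1)) * indicator {t. 0 < t \<and> ennreal t < y} t \<partial>lborel)"
        using top by (intro nn_integral_mono) (auto split: split_indicator)
      finally show ?thesis .
    qed
    then have "(\<integral>\<^sup>+t. ennreal (t powr (\<alpha> - 1)) * indicator {t. 0 < t \<and> ennreal t < y} t \<partial>lborel) = \<infinity>"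
      by (metis ennreal_Ex_less_of_nat ennreal_of_nat_eq_real_of_nat infinity_ennreal_def linorder_not_less top.not_eq_extremum)
    then show ?thesis
      using \<alpha> top by (simp add: ennpow_def ennreal_top_mult)
  qed (use fin in simp)
qed

text \<open>
  The part of \<open>\<psi>\<close> below \<open>a/2\<close> contributes at most \<open>a/2\<close> to its maximal function; the weak-type
  inequality is applied to the rest. This is the step that interpolates between \<open>L\<^sup>1\<close> and \<open>L\<^sup>\<infinity>\<close>.
\<close>

lemma wmax_weak_type_truncated:
  fixes v \<psi> :: "real ^ 'n \<Rightarrow> ennreal"
  assumes v: "v \<in> A1_plain" and D: "0 < D" "\<And>c r. 0 < r \<Longrightarrow>
    (\<integral>\<^sup>+x\<in>ball c (5 * r). v x \<partial>lebesgue) \<le> ennreal D * (\<integral>\<^sup>+x\<in>ball c r. v x \<partial>lebesgue)"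
    and \<psi> [measurable]: "\<psi> \<in> borel_measurable lebesgue" and a: "0 < a"
  shows "(\<integral>\<^sup>+x\<in>{x. ennreal a < wmax v \<psi> x}. v x \<partial>lebesgue)
    \<le> ennreal (2 * D / a) * (\<integral>\<^sup>+x\<in>{x. ennreal a < 2 * \<psi> x}. \<psi> x * v x \<partial>lebesgue)"
proof -
  note v_meas [measurable] = A1D(1)[OF v]
  define \<phi> where "\<phi> x = \<psi> x * indicator {x. ennreal a < 2 * \<psi> x} x" for x
  have \<phi> [measurable]: "\<phi> \<in> borel_measurable lebesgue"
    unfolding \<phi>_def by measurable
  have \<psi>_le: "\<psi> x \<le> ennreal (a / 2) + \<phi> x" for x
  proof (cases "ennreal a < 2 * \<psi> x")
    case False
    then have "2 * \<psi> x \<le> 2 * ennreal (a / 2)"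
      using a by (simp add: not_less flip: ennreal_numeral ennreal_mult)
    then have "\<psi> x \<le> ennreal (a / 2)"
      by (simp add: ennreal_mult_le_mult_iff)
    then show ?thesis
      by (simp add: add_increasing2)
  qed (simp add: \<phi>_def)
  have avg: "wavg v B \<psi> \<le> ennreal (a / 2) + wavg v B \<phi>" if [measurable]: "B \<in> balls" for B
  proof -
    have fin: "0 < (\<integral>\<^sup>+x\<in>B. v x \<partial>lebesgue)" "(\<integral>\<^sup>+x\<in>B. v x \<partial>lebesgue) < \<infinity>"
      using ball_integral_pos[OF v_meas that A1D(2)[OF v]] A1_plain_integral_finite[OF v that] by auto
    have "wavg v B \<psi> \<le> (\<integral>\<^sup>+x. (ennreal (a / 2) * (v x * indicator B x) + \<phi> x * v x * indicator B x) \<partial>lebesgue) / (\<integral>\<^sup>+x\<in>B. v x \<partial>lebesgue)"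
      unfolding wavg_def using \<psi>_le
      by (intro divide_right_mono_ennreal nn_integral_mono) (auto intro: mult_right_mono simp flip: distrib_right split: split_indicator)
    also have "\<dots> = (ennreal (a / 2) * (\<integral>\<^sup>+x\<in>B. v x \<partial>lebesgue) + (\<integral>\<^sup>+x\<in>B. \<phi> x * v x \<partial>lebesgue)) / (\<integral>\<^sup>+x\<in>B. v x \<partial>lebesgue)"
      using that by (subst nn_integral_add) (auto simp: nn_integral_cmult)
    also have "\<dots> = ennreal (a / 2) + wavg v B \<phi>"
      using fin by (simp add: wavg_def add_divide_distrib_ennreal ennreal_mult_divide_eq)
    finally show ?thesis .
  qed
  have wm: "wmax v \<psi> x \<le> ennreal (a / 2) + wmax v \<phi> x" for x
    unfolding wmax_def[of v \<psi>]
    by (intro SUP_least) (auto intro!: order_trans[OF avg] add_left_mono wavg_le_wmax)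
  have "{x. ennreal a < wmax v \<psi> x} \<subseteq> {x. ennreal (a / 2) < wmax v \<phi> x}"
  proof clarify
    fix x assume *: "ennreal a < wmax v \<psi> x"
    show "ennreal (a / 2) < wmax v \<phi> x"
    proof (rule ccontr)
      assume "\<not> ennreal (a / 2) < wmax v \<phi> x"
      then have "wmax v \<psi> x \<le> ennreal (a / 2) + ennreal (a / 2)"
        using wm[of x] by (meson add_left_mono not_less order_trans)
      also have "\<dots> = ennreal a"
        using a by (subst ennreal_plus[symmetric]) auto
      finally show False
        using * by simp
    qed
  qed
  then have "(\<integral>\<^sup>+x\<in>{x. ennreal a < wmax v \<psi> x}. v x \<partial>lebesgue) \<le> (\<integral>\<^sup>+x\<in>{x. ennreal (a / 2) < wmax v \<phi> x}. v x \<partial>lebesgue)"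
    by (intro nn_integral_mono) (auto split: split_indicator)
  also have "\<dots> \<le> ennreal (D / (a / 2)) * (\<integral>\<^sup>+x. \<phi> x * v x \<partial>lebesgue)"
    using a by (intro wmax_weak_type[OF v D \<phi>]) auto
  also have "\<dots> = ennreal (2 * D / a) * (\<integral>\<^sup>+x\<in>{x. ennreal a < 2 * \<psi> x}. \<psi> x * v x \<partial>lebesgue)"
    by (simp add: \<phi>_def mult_ac)
  finally show ?thesis .
qed

lemma sigma_finite_lebesgue: "sigma_finite_measure (lebesgue :: 'a :: euclidean_space measure)"
proof
  obtain A :: "'a set set" where "countable A" "A \<subseteq> sets lborel" "\<Union>A = space lborel" "\<forall>a\<in>A. emeasure lborel a \<noteq> \<infinity>"
    using lborel.sigma_finite_countable by blast
  then show "\<exists>A. countable A \<and> A \<subseteq> sets lebesgue \<and> \<Union>A = space (lebesgue :: 'a measure) \<and> (\<forall>a\<in>A. emeasure lebesgue a \<noteq> \<infinity>)"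
    by (intro exI[of _ A]) (auto simp: subset_eq)
qed

lemma nn_integral_layer_cake:
  fixes g v :: "'a :: euclidean_space \<Rightarrow> ennreal"
  assumes \<alpha>: "0 < \<alpha>" and [measurable]: "g \<in> borel_measurable lebesgue" "v \<in> borel_measurable lebesgue"
  shows "(\<integral>\<^sup>+x. g x pow\<^sub>\<infinity> \<alpha> * v x \<partial>lebesgue) = ennreal \<alpha> *
    (\<integral>\<^sup>+t. ennreal (t powr (\<alpha> - 1)) * (\<integral>\<^sup>+x\<in>{x. ennreal t < g x}. v x \<partial>lebesgue) * indicator {0<..} t \<partial>lborel)"
proof -
  interpret sigma_finite_measure "lebesgue :: 'a measure" by (rule sigma_finite_lebesgue)
  interpret pair_sigma_finite "lebesgue :: 'a measure" "lborel :: real measure" ..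
  have ind: "indicator {t. 0 < t \<and> ennreal t < g x} t = (indicator {x. ennreal t < g x} x * indicator {0<..} t :: ennreal)" for x t
    by (auto split: split_indicator)
  have "ennreal \<alpha> * ennreal (1 / \<alpha>) = 1"
    using \<alpha> by (simp flip: ennreal_mult)
  then have "g x pow\<^sub>\<infinity> \<alpha> * v x = ennreal \<alpha> * ((g x pow\<^sub>\<infinity> \<alpha> * ennreal (1 / \<alpha>)) * v x)" for x
    by (metis (no_types, lifting) mult.assoc mult.commute mult_1)
  then have "(\<integral>\<^sup>+x. g x pow\<^sub>\<infinity> \<alpha> * v x \<partial>lebesgue)
    = (\<integral>\<^sup>+x. ennreal \<alpha> * ((g x pow\<^sub>\<infinity> \<alpha> * ennreal (1 / \<alpha>)) * v x) \<partial>lebesgue)"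
    by (intro nn_integral_cong)
  also have "\<dots> = ennreal \<alpha> * (\<integral>\<^sup>+x. (g x pow\<^sub>\<infinity> \<alpha> * ennreal (1 / \<alpha>)) * v x \<partial>lebesgue)"
    by (rule nn_integral_cmult) measurable
  also have "(\<integral>\<^sup>+x. (g x pow\<^sub>\<infinity> \<alpha> * ennreal (1 / \<alpha>)) * v x \<partial>lebesgue)
    = (\<integral>\<^sup>+x. \<integral>\<^sup>+t. ennreal (t powr (\<alpha> - 1)) * indicator {t. 0 < t \<and> ennreal t < g x} t * v x \<partial>lborel \<partial>lebesgue)"
    using \<alpha> by (intro nn_integral_cong) (subst nn_integral_multc, simp_all add: nn_integral_powr_below)
  also have "(\<integral>\<^sup>+x. \<integral>\<^sup>+t. ennreal (t powr (\<alpha> - 1)) * indicator {t. 0 < t \<and> ennreal t < g x} t * v x \<partial>lborel \<partial>lebesgue)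
    = (\<integral>\<^sup>+t. \<integral>\<^sup>+x. ennreal (t powr (\<alpha> - 1)) * indicator {t. 0 < t \<and> ennreal t < g x} t * v x \<partial>lebesgue \<partial>lborel)"
    by (rule Fubini'[symmetric]) measurable
  also have "\<dots> = (\<integral>\<^sup>+t. ennreal (t powr (\<alpha> - 1)) * (\<integral>\<^sup>+x\<in>{x. ennreal t < g x}. v x \<partial>lebesgue) * indicator {0<..} t \<partial>lborel)"
  proof (intro nn_integral_cong)
    fix t :: real
    have "(\<integral>\<^sup>+x. ennreal (t powr (\<alpha> - 1)) * indicator {t. 0 < t \<and> ennreal t < g x} t * v x \<partial>lebesgue)
      = (\<integral>\<^sup>+x. ennreal (t powr (\<alpha> - 1)) * indicator {0<..} t * (v x * indicator {x. ennreal t < g x} x) \<partial>lebesgue)"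
      by (intro nn_integral_cong) (simp add: ind mult_ac)
    also have "\<dots> = ennreal (t powr (\<alpha> - 1)) * indicator {0<..} t * (\<integral>\<^sup>+x\<in>{x. ennreal t < g x}. v x \<partial>lebesgue)"
      by (rule nn_integral_cmult) measurable
    finally show "(\<integral>\<^sup>+x. ennreal (t powr (\<alpha> - 1)) * indicator {t. 0 < t \<and> ennreal t < g x} t * v x \<partial>lebesgue)
      = ennreal (t powr (\<alpha> - 1)) * (\<integral>\<^sup>+x\<in>{x. ennreal t < g x}. v x \<partial>lebesgue) * indicator {0<..} t"
      by (simp add: mult_ac)
  qed
  finally show ?thesis .
qed

text \<open>
  Marcinkiewicz interpolation: insert the truncated weak-type inequality into the layer-cake formula
  for the maximal function and recognize the layer-cake formula for \<open>2\<psi>\<close> with the exponent \<open>q - 1\<close>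
  and the weight \<open>\<psi> v\<close>.
\<close>

lemma wmax_strong_type:
  fixes v :: "real ^ 'n \<Rightarrow> ennreal"
  assumes v: "v \<in> A1_plain" and q: "1 < q"
  obtains C where "0 < C" "\<And>\<psi>. \<psi> \<in> borel_measurable lebesgue \<Longrightarrow>
    (\<integral>\<^sup>+x. wmax v \<psi> x pow\<^sub>\<infinity> q * v x \<partial>lebesgue) \<le> ennreal C * (\<integral>\<^sup>+x. \<psi> x pow\<^sub>\<infinity> q * v x \<partial>lebesgue)"
proof -
  note v_meas [measurable] = A1D(1)[OF v]
  obtain D where D: "0 < D" "\<And>c r. 0 < r \<Longrightarrow>
    (\<integral>\<^sup>+x\<in>ball c (5 * r). v x \<partial>lebesgue) \<le> ennreal D * (\<integral>\<^sup>+x\<in>ball c r. v x \<partial>lebesgue)"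
    using A1_plain_doubling[OF v] by blast
  interpret sigma_finite_measure "lebesgue :: (real ^ 'n) measure"
    by (rule sigma_finite_lebesgue)
  have [measurable]: "(indicator {0<..} :: real \<Rightarrow> ennreal) \<in> borel_measurable lborel"
    by simp
  define C where "C = q * (2 * D) * 2 powr (q - 1) / (q - 1)"
  have "(\<integral>\<^sup>+x. wmax v \<psi> x pow\<^sub>\<infinity> q * v x \<partial>lebesgue) \<le> ennreal C * (\<integral>\<^sup>+x. \<psi> x pow\<^sub>\<infinity> q * v x \<partial>lebesgue)"
    if [measurable]: "\<psi> \<in> borel_measurable lebesgue" for \<psi>
  proof -
    define J where "J = (\<integral>\<^sup>+t. ennreal (t powr (q - 1 - 1)) * (\<integral>\<^sup>+x\<in>{x. ennreal t < 2 * \<psi> x}. \<psi> x * v x \<partial>lebesgue) * indicator {0<..} t \<partial>lborel)"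
    have "(\<integral>\<^sup>+x. wmax v \<psi> x pow\<^sub>\<infinity> q * v x \<partial>lebesgue) = ennreal q *
      (\<integral>\<^sup>+t. ennreal (t powr (q - 1)) * (\<integral>\<^sup>+x\<in>{x. ennreal t < wmax v \<psi> x}. v x \<partial>lebesgue) * indicator {0<..} t \<partial>lborel)"
      using q by (intro nn_integral_layer_cake) auto
    also have "\<dots> \<le> ennreal q * (ennreal (2 * D) * J)"
    proof (rule mult_left_mono)
      have "(\<integral>\<^sup>+t. ennreal (t powr (q - 1)) * (\<integral>\<^sup>+x\<in>{x. ennreal t < wmax v \<psi> x}. v x \<partial>lebesgue) * indicator {0<..} t \<partial>lborel)
        \<le> (\<integral>\<^sup>+t. ennreal (2 * D) * (ennreal (t powr (q - 1 - 1)) * (\<integral>\<^sup>+x\<in>{x. ennreal t < 2 * \<psi> x}. \<psi> x * v x \<partial>lebesgue) * indicator {0<..} t) \<partial>lborel)"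
      proof (intro nn_integral_mono)
        fix t :: real
        show "ennreal (t powr (q - 1)) * (\<integral>\<^sup>+x\<in>{x. ennreal t < wmax v \<psi> x}. v x \<partial>lebesgue) * indicator {0<..} t
          \<le> ennreal (2 * D) * (ennreal (t powr (q - 1 - 1)) * (\<integral>\<^sup>+x\<in>{x. ennreal t < 2 * \<psi> x}. \<psi> x * v x \<partial>lebesgue) * indicator {0<..} t)"
        proof (cases "0 < t")
          case True
          have eq: "ennreal (t powr (q - 1)) * ennreal (2 * D / t) = ennreal (2 * D) * ennreal (t powr (q - 1 - 1))"
            using True D(1) by (simp add: powr_diff power2_eq_square field_simps flip: ennreal_mult)
          have "ennreal (t powr (q - 1)) * (\<integral>\<^sup>+x\<in>{x. ennreal t < wmax v \<psi> x}. v x \<partial>lebesgue)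
            \<le> ennreal (t powr (q - 1)) * (ennreal (2 * D / t) * (\<integral>\<^sup>+x\<in>{x. ennreal t < 2 * \<psi> x}. \<psi> x * v x \<partial>lebesgue))"
            using True by (intro mult_left_mono wmax_weak_type_truncated[OF v D]) auto
          then show ?thesis
            using True by (simp add: mult.assoc[symmetric] eq)
        qed simp
      qed
      also have "\<dots> = ennreal (2 * D) * J"
        unfolding J_def by (rule nn_integral_cmult) measurable
      finally show "(\<integral>\<^sup>+t. ennreal (t powr (q - 1)) * (\<integral>\<^sup>+x\<in>{x. ennreal t < wmax v \<psi> x}. v x \<partial>lebesgue) * indicator {0<..} t \<partial>lborel) \<le> ennreal (2 * D) * J" .
    qed simp
    also have "\<dots> = ennreal (q * (2 * D)) * J"
      using q D(1) by (simp add: ennreal_mult mult.assoc)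
    also have "J = ennreal (1 / (q - 1)) * (\<integral>\<^sup>+x. (2 * \<psi> x) pow\<^sub>\<infinity> (q - 1) * (\<psi> x * v x) \<partial>lebesgue)"
      using q unfolding J_def by (subst nn_integral_layer_cake) (auto simp: mult.assoc[symmetric] simp flip: ennreal_mult)
    also have "(\<integral>\<^sup>+x. (2 * \<psi> x) pow\<^sub>\<infinity> (q - 1) * (\<psi> x * v x) \<partial>lebesgue) = (\<integral>\<^sup>+x. ennreal (2 powr (q - 1)) * (\<psi> x pow\<^sub>\<infinity> q * v x) \<partial>lebesgue)"
    proof (intro nn_integral_cong)
      fix x
      have "(2 * \<psi> x) pow\<^sub>\<infinity> (q - 1) = ennreal (2 powr (q - 1)) * \<psi> x pow\<^sub>\<infinity> (q - 1)"
        using q ennpow_ennreal[of 2 "q - 1"] by (subst ennpow_mult) auto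
      moreover have "\<psi> x pow\<^sub>\<infinity> (q - 1) * \<psi> x = \<psi> x pow\<^sub>\<infinity> q"
        using q ennpow_add[of "q - 1" 1 "\<psi> x"] by auto
      ultimately show "(2 * \<psi> x) pow\<^sub>\<infinity> (q - 1) * (\<psi> x * v x) = ennreal (2 powr (q - 1)) * (\<psi> x pow\<^sub>\<infinity> q * v x)"
        by (metis mult.assoc)
    qed
    also have "\<dots> = ennreal (2 powr (q - 1)) * (\<integral>\<^sup>+x. \<psi> x pow\<^sub>\<infinity> q * v x \<partial>lebesgue)"
      by (rule nn_integral_cmult) measurable
    also have "ennreal (q * (2 * D)) * (ennreal (1 / (q - 1)) * (ennreal (2 powr (q - 1)) * (\<integral>\<^sup>+x. \<psi> x pow\<^sub>\<infinity> q * v x \<partial>lebesgue)))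
      = ennreal C * (\<integral>\<^sup>+x. \<psi> x pow\<^sub>\<infinity> q * v x \<partial>lebesgue)"
      using q D(1) by (simp add: C_def mult.assoc[symmetric] flip: ennreal_mult)
    finally show ?thesis .
  qed
  moreover have "0 < C"
    using q D(1) by (simp add: C_def)
  ultimately show ?thesis
    using that by blast
qed

section \<open>Weights of class A-infinity built from A1 weights\<close>

lemma A1_plain_ball:
  fixes v :: "real ^ 'n \<Rightarrow> ennreal"
  assumes v: "v \<in> A1_plain" and B: "B \<in> balls"
  shows "0 < (\<integral>\<^sup>+x\<in>B. v x \<partial>lebesgue)" "(\<integral>\<^sup>+x\<in>B. v x \<partial>lebesgue) < \<infinity>"
  using ball_integral_pos[OF A1D(1)[OF v] B A1D(2)[OF v]] A1_plain_integral_finite[OF v B] by auto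

lemma wavg_chain:
  assumes v: "v \<in> A1_plain" and B: "B \<in> balls"
  shows "wavg (\<lambda>_. 1) B (\<lambda>x. v x * u x) = wavg v B u * wavg (\<lambda>_. 1) B v"
proof -
  define V where "V = (\<integral>\<^sup>+x\<in>B. v x \<partial>lebesgue)"
  have V: "0 < V" "V < \<infinity>"
    using A1_plain_ball[OF v B] by (simp_all add: V_def)
  have "wavg v B u * wavg (\<lambda>_. 1) B v = (\<integral>\<^sup>+x\<in>B. u x * v x \<partial>lebesgue) * inverse (emeasure lebesgue B) * (V / V)"
    using B by (simp add: wavg_def V_def divide_ennreal_def mult_ac)
  also have "V / V = 1"
    using V by simp
  also have "(\<integral>\<^sup>+x\<in>B. u x * v x \<partial>lebesgue) * inverse (emeasure lebesgue B) * 1 = wavg (\<lambda>_. 1) B (\<lambda>x. v x * u x)"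
    using B by (simp add: wavg_def divide_ennreal_def mult_ac)
  finally show ?thesis ..
qed

text \<open>
  Averages can be taken in two steps: the Lebesgue average of \<open>v u\<close> is the average of \<open>u\<close> with respect
  to \<open>v dx\<close> times the Lebesgue average of \<open>v\<close>. Each factor is bounded by its \<open>A\<^sub>1\<close> condition.
\<close>

lemma A1_mult:
  fixes u v :: "real ^ 'n \<Rightarrow> ennreal"
  assumes v: "v \<in> A1_plain" and u: "u \<in> A1 v"
  shows "(\<lambda>x. v x * u x) \<in> A1_plain"
proof -
  note [measurable] = A1D(1)[OF v] A1D(1)[OF u]
  obtain K where K: "0 < K" "\<And>B x. B \<in> balls \<Longrightarrow> x \<in> B \<Longrightarrow> wavg (\<lambda>_. 1) B v \<le> ennreal K * v x"
    using A1D(4)[OF v] by blast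
  obtain L where L: "0 < L" "\<And>B x. B \<in> balls \<Longrightarrow> x \<in> B \<Longrightarrow> wavg v B u \<le> ennreal L * u x"
    using A1D(4)[OF u] by blast
  have "wavg (\<lambda>_. 1) B (\<lambda>x. v x * u x) \<le> ennreal (L * K) * (v x * u x)" if "B \<in> balls" "x \<in> B" for B x
  proof -
    have "wavg (\<lambda>_. 1) B (\<lambda>x. v x * u x) = wavg v B u * wavg (\<lambda>_. 1) B v"
      by (rule wavg_chain[OF v that(1)])
    also have "\<dots> \<le> (ennreal L * u x) * (ennreal K * v x)"
      using that K L by (intro mult_mono) auto
    also have "\<dots> = ennreal (L * K) * (v x * u x)"
      using K L by (simp add: ennreal_mult mult_ac)
    finally show ?thesis .
  qed
  moreover have "AE x in lebesgue. v x * u x < \<infinity>"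
    using A1D(3)[OF v] A1D(3)[OF u] by eventually_elim (simp add: ennreal_mult_less_top)
  moreover have "0 < v x * u x" for x
    using A1D(2)[OF v, of x] A1D(2)[OF u, of x] by (simp add: ennreal_zero_less_mult_iff)
  ultimately show ?thesis
    using K(1) L(1) unfolding A1_def by (auto intro!: exI[of _ "L * K"])
qed

text \<open>
  The exponents in the \<open>A\<^sub>t\<close> condition of \<open>v u\<^bsup>1-t\<^esup>\<close> cancel: here \<open>c\<close> and \<open>U\<close> are the averages of \<open>v\<close> and
  \<open>u\<close>, and the product does not depend on them.
\<close>

lemma A_class_constant_powr:
  fixes c U K L t :: real
  assumes "0 < c" "0 < U" "0 < K" "0 < L" "1 < t"
  shows "((U / L) powr (1 - t) * c) * ((c / K) powr (- t / (t - 1)) * (U * c)) powr (t - 1) = L powr (t - 1) * K powr t"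
proof -
  obtain c' U' K' L' where e: "c = exp c'" "U = exp U'" "K = exp K'" "L = exp L'"
    using assms by (metis exp_ln)
  have p: "exp x powr y = exp (y * x)" for x y :: real
    by (simp add: powr_def)
  have "- t / (t - 1) * (c' - K') * (t - 1) = - t * (c' - K')"
    using assms by simp
  then show ?thesis
    using assms unfolding e p exp_diff[symmetric] exp_add[symmetric] by (simp add: algebra_simps)
qed

text \<open>
  The easy half of the factorization of \<open>A\<^sub>t\<close> weights, with the second factor relative to \<open>v dx\<close>. On a
  ball, \<open>u\<close> and \<open>v\<close> are bounded below by multiples of their averages. The bound for \<open>u\<close> controls
  \<open>v u\<^bsup>1-t\<^esup>\<close> by a multiple of \<open>v\<close>. The dual weight \<open>(v u\<^bsup>1-t\<^esup>)\<^bsup>1-t'\<^esup>\<close> is equal to \<open>v\<^bsup>-t'\<^esup> (u v)\<close>, and the bound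
  for \<open>v\<close> controls it by a multiple of \<open>u v\<close>.
\<close>

lemma A1_factor_A_class:
  fixes u v :: "real ^ 'n \<Rightarrow> ennreal"
  assumes v: "v \<in> A1_plain" and u: "u \<in> A1 v" and t: "1 < t"
  shows "(\<lambda>x. v x * u x pow\<^sub>\<infinity> (1 - t)) \<in> A_class t"
proof -
  note [measurable] = A1D(1)[OF v] A1D(1)[OF u]
  define w where "w x = v x * u x pow\<^sub>\<infinity> (1 - t)" for x
  obtain K where K: "0 < K" "\<And>B x. B \<in> balls \<Longrightarrow> x \<in> B \<Longrightarrow> wavg (\<lambda>_. 1) B v \<le> ennreal K * v x"
    using A1D(4)[OF v] by blast
  obtain L where L: "0 < L" "\<And>B x. B \<in> balls \<Longrightarrow> x \<in> B \<Longrightarrow> wavg v B u \<le> ennreal L * u x"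
    using A1D(4)[OF u] by blast
  have "((\<integral>\<^sup>+x\<in>B. w x \<partial>lebesgue) / emeasure lebesgue B)
        * ((\<integral>\<^sup>+x\<in>B. w x pow\<^sub>\<infinity> (1 - t / (t - 1)) \<partial>lebesgue) / emeasure lebesgue B) pow\<^sub>\<infinity> (t - 1)
      \<le> ennreal (L powr (t - 1) * K powr t)" if B [measurable]: "B \<in> balls" for B
  proof -
    obtain V where V: "(\<integral>\<^sup>+x\<in>B. v x \<partial>lebesgue) = ennreal V" "0 < V"
      using A1_plain_ball[OF v B] by (cases "\<integral>\<^sup>+x\<in>B. v x \<partial>lebesgue") auto
    obtain b where b: "emeasure lebesgue B = ennreal b" "0 < b"
      using emeasure_balls[OF B] by (cases "emeasure lebesgue B") auto
    have uv: "0 < (\<integral>\<^sup>+x\<in>B. u x * v x \<partial>lebesgue)" "(\<integral>\<^sup>+x\<in>B. u x * v x \<partial>lebesgue) < \<infinity>"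
      using A1_plain_ball[OF A1_mult[OF v u] B] by (simp_all add: mult.commute)
    then obtain W where W: "(\<integral>\<^sup>+x\<in>B. u x * v x \<partial>lebesgue) = ennreal W" "0 < W"
      by (cases "\<integral>\<^sup>+x\<in>B. u x * v x \<partial>lebesgue") auto
    define U where "U = W / V"
    have U: "0 < U" "wavg v B u = ennreal U"
      using V W by (simp_all add: U_def wavg_def divide_ennreal)
    define c where "c = V / b"
    have c: "0 < c" "wavg (\<lambda>_. 1) B v = ennreal c"
      using V b B by (simp_all add: c_def wavg_def divide_ennreal)
    have scale: "ennreal (a / k) \<le> y" if "ennreal a \<le> ennreal k * y" "0 < k" "0 < a" for a k y
      using that by (cases y) (auto simp: field_simps simp flip: ennreal_mult)
    have lower: "ennreal (c / K) \<le> v x" "ennreal (U / L) \<le> u x" if "x \<in> B" for x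
      using K(2)[OF B that] L(2)[OF B that] c U K(1) L(1) by (auto intro!: scale)
    have "(\<integral>\<^sup>+x\<in>B. w x \<partial>lebesgue) \<le> (\<integral>\<^sup>+x. ennreal ((U / L) powr (1 - t)) * (v x * indicator B x) \<partial>lebesgue)"
    proof (intro nn_integral_mono)
      fix x
      have "u x pow\<^sub>\<infinity> (1 - t) \<le> ennreal ((U / L) powr (1 - t))" if "x \<in> B"
        using ennpow_antimono[OF _ lower(2)[OF that], of "1 - t"] t U(1) L(1) by (simp add: ennpow_ennreal)
      then show "w x * indicator B x \<le> ennreal ((U / L) powr (1 - t)) * (v x * indicator B x)"
        by (auto simp: w_def mult.commute[of _ "v x"] intro: mult_left_mono split: split_indicator)
    qed
    also have "\<dots> = ennreal ((U / L) powr (1 - t) * V)"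
      using V by (subst nn_integral_cmult) (auto simp: ennreal_mult)
    finally have "(\<integral>\<^sup>+x\<in>B. w x \<partial>lebesgue) / emeasure lebesgue B \<le> ennreal ((U / L) powr (1 - t) * V) / ennreal b"
      unfolding b(1) by (rule divide_right_mono_ennreal)
    also have "\<dots> = ennreal ((U / L) powr (1 - t) * c)"
      using V b by (simp add: divide_ennreal c_def)
    finally have 1: "(\<integral>\<^sup>+x\<in>B. w x \<partial>lebesgue) / emeasure lebesgue B \<le> ennreal ((U / L) powr (1 - t) * c)" .
    have "(\<integral>\<^sup>+x\<in>B. w x pow\<^sub>\<infinity> (1 - t / (t - 1)) \<partial>lebesgue)
      \<le> (\<integral>\<^sup>+x. ennreal ((c / K) powr (- t / (t - 1))) * (u x * v x * indicator B x) \<partial>lebesgue)"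
      using A1D(3)[OF v] A1D(3)[OF u]
    proof (intro nn_integral_mono_AE, eventually_elim)
      case (elim x)
      have pos: "0 < v x" "0 < u x"
        using A1D(2)[OF v] A1D(2)[OF u] by auto
      have e: "(1 - t) * (1 - t / (t - 1)) = 1"
        using t by (simp add: field_simps)
      have "w x pow\<^sub>\<infinity> (1 - t / (t - 1)) = v x pow\<^sub>\<infinity> (1 - t / (t - 1)) * u x"
        using pos elim by (simp add: w_def ennpow_mult ennpow_ennpow e)
      also have "v x pow\<^sub>\<infinity> (1 - t / (t - 1)) = v x * v x pow\<^sub>\<infinity> (- t / (t - 1))"
        using pos elim ennpow_add[of 1 "- t / (t - 1)" "v x"] by simp
      finally have "w x pow\<^sub>\<infinity> (1 - t / (t - 1)) = v x pow\<^sub>\<infinity> (- t / (t - 1)) * (u x * v x)"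
        by (simp add: mult_ac)
      moreover have "v x pow\<^sub>\<infinity> (- t / (t - 1)) \<le> ennreal ((c / K) powr (- t / (t - 1)))" if "x \<in> B"
      proof -
        have "- t / (t - 1) \<le> 0"
          using t by simp
        then have "v x pow\<^sub>\<infinity> (- t / (t - 1)) \<le> ennreal (c / K) pow\<^sub>\<infinity> (- t / (t - 1))"
          by (rule ennpow_antimono[OF _ lower(1)[OF that]])
        then show ?thesis
          using c K(1) by (simp add: ennpow_ennreal)
      qed
      ultimately show ?case
        by (auto intro: mult_right_mono split: split_indicator)
    qed
    also have "\<dots> = ennreal ((c / K) powr (- t / (t - 1)) * W)"
      using W by (subst nn_integral_cmult) (auto simp: ennreal_mult)
    finally have "(\<integral>\<^sup>+x\<in>B. w x pow\<^sub>\<infinity> (1 - t / (t - 1)) \<partial>lebesgue) / emeasure lebesgue B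
      \<le> ennreal ((c / K) powr (- t / (t - 1)) * W) / ennreal b"
      unfolding b(1) by (rule divide_right_mono_ennreal)
    also have "\<dots> = ennreal ((c / K) powr (- t / (t - 1)) * (U * c))"
      using V W b by (simp add: divide_ennreal c_def U_def)
    finally have "((\<integral>\<^sup>+x\<in>B. w x pow\<^sub>\<infinity> (1 - t / (t - 1)) \<partial>lebesgue) / emeasure lebesgue B) pow\<^sub>\<infinity> (t - 1)
      \<le> ennreal ((c / K) powr (- t / (t - 1)) * (U * c)) pow\<^sub>\<infinity> (t - 1)"
      using t by (intro ennpow_mono) auto
    also have "\<dots> = ennreal (((c / K) powr (- t / (t - 1)) * (U * c)) powr (t - 1))"
      using U(1) c(1) K(1) by (intro ennpow_ennreal) auto
    finally have 2: "((\<integral>\<^sup>+x\<in>B. w x pow\<^sub>\<infinity> (1 - t / (t - 1)) \<partial>lebesgue) / emeasure lebesgue B) pow\<^sub>\<infinity> (t - 1)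
      \<le> ennreal (((c / K) powr (- t / (t - 1)) * (U * c)) powr (t - 1))" .
    have "ennreal ((U / L) powr (1 - t) * c) * ennreal (((c / K) powr (- t / (t - 1)) * (U * c)) powr (t - 1))
      = ennreal (((U / L) powr (1 - t) * c) * (((c / K) powr (- t / (t - 1)) * (U * c)) powr (t - 1)))"
      using c(1) by (intro ennreal_mult[symmetric]) auto
    also have "((U / L) powr (1 - t) * c) * (((c / K) powr (- t / (t - 1)) * (U * c)) powr (t - 1))
      = L powr (t - 1) * K powr t"
      using c(1) U(1) K(1) L(1) t by (rule A_class_constant_powr)
    finally have "ennreal ((U / L) powr (1 - t) * c) * ennreal (((c / K) powr (- t / (t - 1)) * (U * c)) powr (t - 1))
      = ennreal (L powr (t - 1) * K powr t)" .
    then show ?thesis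
      using mult_mono[OF 1 2] by simp
  qed
  then have "(SUP B\<in>balls. ((\<integral>\<^sup>+x\<in>B. w x \<partial>lebesgue) / emeasure lebesgue B)
        * ((\<integral>\<^sup>+x\<in>B. w x pow\<^sub>\<infinity> (1 - t / (t - 1)) \<partial>lebesgue) / emeasure lebesgue B) pow\<^sub>\<infinity> (t - 1))
      \<le> ennreal (L powr (t - 1) * K powr t)"
    by (rule SUP_least)
  also have "\<dots> < \<infinity>"
    by simp
  finally have "(SUP B\<in>balls. ((\<integral>\<^sup>+x\<in>B. w x \<partial>lebesgue) / emeasure lebesgue B)
        * ((\<integral>\<^sup>+x\<in>B. w x pow\<^sub>\<infinity> (1 - t / (t - 1)) \<partial>lebesgue) / emeasure lebesgue B) pow\<^sub>\<infinity> (t - 1)) < \<infinity>" .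
  moreover have "AE x in lebesgue. 0 < w x \<and> w x < \<infinity>"
    using A1D(3)[OF v] A1D(3)[OF u]
  proof eventually_elim
    case (elim x)
    then show ?case
      using A1D(2)[OF v, of x] A1D(2)[OF u, of x] ennpow_pos[of "u x" "1 - t"] ennpow_finite[of "u x" "1 - t"]
      by (auto simp: w_def ennreal_zero_less_mult_iff ennreal_mult_less_top)
  qed
  moreover have "w \<in> borel_measurable lebesgue"
    unfolding w_def by measurable
  ultimately have "w \<in> A_class t"
    by (simp add: A_class_def)
  then show ?thesis
    by (simp add: w_def[abs_def])
qed

text \<open>
  This is the factorization with a constant second factor.
\<close>

lemma A1_plain_A_infinity:
  fixes v :: "real ^ 'n \<Rightarrow> ennreal"
  assumes v: "v \<in> A1_plain"
  shows "v \<in> A_infinity"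
proof -
  have "wavg v B (\<lambda>_. 1) = 1" if "B \<in> balls" for B
    using A1_plain_ball[OF v that] by (simp add: wavg_def)
  then have "(\<lambda>_. 1) \<in> A1 v"
    by (auto simp: A1_def intro!: exI[of _ 1])
  then have "(\<lambda>x. v x * 1 pow\<^sub>\<infinity> (1 - 2)) \<in> A_class 2"
    by (intro A1_factor_A_class[OF v]) auto
  then show ?thesis
    by (auto simp: A_infinity_def intro!: bexI[of _ 2])
qed

lemma ennreal_divide_le_1_iff: "0 < a \<Longrightarrow> x / ennreal a \<le> 1 \<longleftrightarrow> x \<le> ennreal a"
  by (cases x) (auto simp: divide_ennreal ennreal_le_1 ennreal_top_divide top_unique)

text \<open>
  The algorithm of Rubio de Francia in \<open>L\<^sup>q(v)\<close>, a variable Lebesgue space of constant exponent with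
  the weight \<open>v\<^bsup>1/q\<^esup>\<close>.
\<close>

lemma Lq_A1_majorant:
  fixes v \<psi> :: "real ^ 'n \<Rightarrow> ennreal"
  assumes v: "v \<in> A1_plain" and q: "1 < q" and \<psi> [measurable]: "\<psi> \<in> borel_measurable lebesgue"
    and I: "0 < (\<integral>\<^sup>+x. \<psi> x pow\<^sub>\<infinity> q * v x \<partial>lebesgue)" "(\<integral>\<^sup>+x. \<psi> x pow\<^sub>\<infinity> q * v x \<partial>lebesgue) < \<infinity>"
  obtains u where "u \<in> A1 v" "\<And>x. \<psi> x \<le> u x" "(\<integral>\<^sup>+x. u x pow\<^sub>\<infinity> q * v x \<partial>lebesgue) < \<infinity>"
proof -
  note v_meas [measurable] = A1D(1)[OF v]
  define \<omega> where "\<omega> x = v x pow\<^sub>\<infinity> (1 / q)" for x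
  have [measurable]: "\<omega> \<in> borel_measurable lebesgue"
    unfolding \<omega>_def by measurable
  have iff: "var_bounded (\<lambda>_. ennreal q) (\<lambda>x. h x * \<omega> x) l \<longleftrightarrow> (\<integral>\<^sup>+x. h x pow\<^sub>\<infinity> q * v x \<partial>lebesgue) \<le> ennreal (l powr q)"
    if [measurable]: "h \<in> borel_measurable lebesgue" and l: "0 < l" for h l
  proof -
    have "(h x * \<omega> x / ennreal l) pow\<^sub>\<infinity> q = h x pow\<^sub>\<infinity> q * v x / ennreal (l powr q)" for x
      using q l by (simp add: ennpow_divide ennpow_mult ennpow_ennpow \<omega>_def)
    then have "(\<integral>\<^sup>+x. (h x * \<omega> x / ennreal l) pow\<^sub>\<infinity> q \<partial>lebesgue) = (\<integral>\<^sup>+x. h x pow\<^sub>\<infinity> q * v x \<partial>lebesgue) / ennreal (l powr q)"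
      by (simp add: nn_integral_divide)
    then show ?thesis
      using q l by (simp add: var_bounded_def ennreal_divide_le_1_iff)
  qed
  obtain C where C: "0 < C" "\<And>\<psi>. \<psi> \<in> borel_measurable lebesgue \<Longrightarrow>
    (\<integral>\<^sup>+x. wmax v \<psi> x pow\<^sub>\<infinity> q * v x \<partial>lebesgue) \<le> ennreal C * (\<integral>\<^sup>+x. \<psi> x pow\<^sub>\<infinity> q * v x \<partial>lebesgue)"
    using wmax_strong_type[OF v q] by blast
  have bdd: "max_bounded_on v (\<lambda>_. ennreal q) \<omega> (C powr (1 / q))"
    unfolding max_bounded_on_def
  proof (intro ballI allI impI)
    fix h :: "real ^ 'n \<Rightarrow> ennreal" and l :: real
    assume h: "h \<in> borel_measurable lebesgue" and l: "0 < l" and b: "var_bounded (\<lambda>_. ennreal q) (\<lambda>x. h x * \<omega> x) l"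
    have "(\<integral>\<^sup>+x. wmax v h x pow\<^sub>\<infinity> q * v x \<partial>lebesgue) \<le> ennreal C * (\<integral>\<^sup>+x. h x pow\<^sub>\<infinity> q * v x \<partial>lebesgue)"
      by (rule C(2)[OF h])
    also have "\<dots> \<le> ennreal C * ennreal (l powr q)"
      using b iff[OF h l] by (intro mult_left_mono) auto
    also have "\<dots> = ennreal ((C powr (1 / q) * l) powr q)"
      using C(1) l q by (simp add: powr_mult powr_powr ennreal_mult)
    finally show "var_bounded (\<lambda>_. ennreal q) (\<lambda>x. wmax v h x * \<omega> x) (C powr (1 / q) * l)"
      using C(1) l by (subst iff) auto
  qed
  obtain i where i: "(\<integral>\<^sup>+x. \<psi> x pow\<^sub>\<infinity> q * v x \<partial>lebesgue) = ennreal i" "0 < i"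
    using I by (cases "\<integral>\<^sup>+x. \<psi> x pow\<^sub>\<infinity> q * v x \<partial>lebesgue") auto
  have pos: "0 < (\<integral>\<^sup>+x. \<psi> x * v x \<partial>lebesgue)"
  proof (rule ccontr)
    assume "\<not> 0 < (\<integral>\<^sup>+x. \<psi> x * v x \<partial>lebesgue)"
    then have "AE x in lebesgue. \<psi> x * v x = 0"
      by (subst nn_integral_0_iff_AE[symmetric]) auto
    then have "AE x in lebesgue. \<psi> x pow\<^sub>\<infinity> q * v x = 0"
      by eventually_elim (use q in \<open>auto simp: ennpow_zero\<close>)
    then have "(\<integral>\<^sup>+x. \<psi> x pow\<^sub>\<infinity> q * v x \<partial>lebesgue) = 0"
      by (subst nn_integral_0_iff_AE) auto
    with I show False by simp
  qed
  have "var_bounded (\<lambda>_. ennreal q) (\<lambda>x. \<psi> x * \<omega> x) (i powr (1 / q))"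
    using i q by (subst iff) (auto simp: powr_powr)
  moreover have "AE x in lebesgue. 0 < \<omega> x"
    using A1D(3)[OF v] by eventually_elim (use A1D(2)[OF v] in \<open>auto simp: \<omega>_def ennpow_pos\<close>)
  ultimately obtain u where u: "u \<in> A1 v" "\<And>x. \<psi> x \<le> u x" "var_bounded (\<lambda>_. ennreal q) (\<lambda>x. u x * \<omega> x) (4 * i powr (1 / q))"
    using rubio_de_francia[of v "\<lambda>_. ennreal q" \<omega> "C powr (1 / q)" \<psi> "i powr (1 / q)"] bdd C(1) q i pos A1_plain_ball(2)[OF v]
    by auto
  then have "(\<integral>\<^sup>+x. u x pow\<^sub>\<infinity> q * v x \<partial>lebesgue) \<le> ennreal ((4 * i powr (1 / q)) powr q)"
    using i A1D(1)[OF u(1)] by (subst iff[symmetric]) auto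
  also have "\<dots> < \<infinity>" by simp
  finally show ?thesis
    using that u by blast
qed

text \<open>
  Apply the previous lemma to the \<open>q\<close>-th root of \<open>F\<^sub>0\<close> and let \<open>F = u\<^sup>q\<close>, so that \<open>v F\<^bsup>1-r\<^esup>\<close> is
  \<open>v u\<^bsup>q(1-r)\<^esup>\<close>. For \<open>r < 1\<close> the choice \<open>q = 1/(1-r)\<close> gives \<open>v u\<close>, an \<open>A\<^sub>1\<close> weight; for \<open>r > 1\<close> any \<open>q > 1\<close>
  gives a weight \<open>v u\<^bsup>1-t\<^esup>\<close> with \<open>t > 1\<close>; for \<open>r = 1\<close> the weight is \<open>v\<close> itself.
\<close>

lemma L1_majorant:
  fixes v F0 :: "real ^ 'n \<Rightarrow> ennreal"
  assumes v: "v \<in> A1_plain" and r: "0 < r" and F0 [measurable]: "F0 \<in> borel_measurable lebesgue"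
    and I: "0 < (\<integral>\<^sup>+x. F0 x * v x \<partial>lebesgue)" "(\<integral>\<^sup>+x. F0 x * v x \<partial>lebesgue) < \<infinity>"
  obtains F where "F \<in> borel_measurable lebesgue" "\<And>x. F0 x \<le> F x" "(\<integral>\<^sup>+x. F x * v x \<partial>lebesgue) < \<infinity>"
    "(\<lambda>x. v x * F x pow\<^sub>\<infinity> (1 - r)) \<in> A_infinity"
proof -
  have root: "\<exists>u. u \<in> A1 v \<and> (\<forall>x. F0 x \<le> u x pow\<^sub>\<infinity> q) \<and> (\<integral>\<^sup>+x. u x pow\<^sub>\<infinity> q * v x \<partial>lebesgue) < \<infinity>"
    if q: "1 < q" for q
  proof -
    have e: "(F0 x pow\<^sub>\<infinity> (1 / q)) pow\<^sub>\<infinity> q = F0 x" for x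
      using q by (simp add: ennpow_ennpow)
    obtain u where u: "u \<in> A1 v" "\<And>x. F0 x pow\<^sub>\<infinity> (1 / q) \<le> u x" "(\<integral>\<^sup>+x. u x pow\<^sub>\<infinity> q * v x \<partial>lebesgue) < \<infinity>"
      using Lq_A1_majorant[OF v q, of "\<lambda>x. F0 x pow\<^sub>\<infinity> (1 / q)"] I by (auto simp: e)
    moreover have "F0 x \<le> u x pow\<^sub>\<infinity> q" for x
      using ennpow_mono[OF _ u(2)[of x], of q] q by (simp add: e)
    ultimately show ?thesis by blast
  qed
  consider "r < 1" | "r = 1" | "1 < r" by linarith
  then show ?thesis
  proof cases
    case 1
    define q where "q = 1 / (1 - r)"
    have q: "1 < q" "q * (1 - r) = 1"
      using 1 r by (auto simp: q_def field_simps)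
    obtain u where u: "u \<in> A1 v" "\<And>x. F0 x \<le> u x pow\<^sub>\<infinity> q" "(\<integral>\<^sup>+x. u x pow\<^sub>\<infinity> q * v x \<partial>lebesgue) < \<infinity>"
      using root[OF q(1)] by blast
    note [measurable] = A1D(1)[OF u(1)]
    show ?thesis
    proof (rule that[of "\<lambda>x. u x pow\<^sub>\<infinity> q"])
      show "(\<lambda>x. v x * (u x pow\<^sub>\<infinity> q) pow\<^sub>\<infinity> (1 - r)) \<in> A_infinity"
        using A1_plain_A_infinity[OF A1_mult[OF v u(1)]] by (simp add: ennpow_ennpow q)
    qed (use u in auto)
  next
    case 2
    then show ?thesis
      using that[of F0] I A1_plain_A_infinity[OF v] by simp
  next
    case 3
    \<comment> \<open>With \<open>q = 2\<close> the exponent \<open>t\<close> is determined by \<open>2 (1 - r) = 1 - t\<close>.\<close>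
    obtain u where u: "u \<in> A1 v" "\<And>x. F0 x \<le> u x pow\<^sub>\<infinity> 2" "(\<integral>\<^sup>+x. u x pow\<^sub>\<infinity> 2 * v x \<partial>lebesgue) < \<infinity>"
      using root[of 2] by auto
    note [measurable] = A1D(1)[OF u(1)]
    show ?thesis
    proof (rule that[of "\<lambda>x. u x pow\<^sub>\<infinity> 2"])
      have "2 * (1 - r) = 1 - (2 * r - 1)" by simp
      then show "(\<lambda>x. v x * (u x pow\<^sub>\<infinity> 2) pow\<^sub>\<infinity> (1 - r)) \<in> A_infinity"
        using A1_factor_A_class[OF v u(1), of "2 * r - 1"] 3
        by (auto simp: ennpow_ennpow A_infinity_def intro!: bexI[of _ "2 * r - 1"])
    qed (use u in auto)
  qed
qed

section \<open>Passing from the exponent r to the exponent one\<close>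

lemma split_small_exponent:
  assumes "0 < r" "r < 1" "0 < c" "\<phi> \<le> ennreal c * F"
  shows "\<phi> \<le> ennreal (c powr (1 - r)) * (\<phi> pow\<^sub>\<infinity> r * F pow\<^sub>\<infinity> (1 - r))"
proof -
  have "\<phi> = \<phi> pow\<^sub>\<infinity> r * \<phi> pow\<^sub>\<infinity> (1 - r)"
    using assms ennpow_add[of r "1 - r" \<phi>] by simp
  also have "\<dots> \<le> \<phi> pow\<^sub>\<infinity> r * (ennreal c * F) pow\<^sub>\<infinity> (1 - r)"
    using assms by (intro mult_left_mono ennpow_mono) auto
  also have "\<dots> = ennreal (c powr (1 - r)) * (\<phi> pow\<^sub>\<infinity> r * F pow\<^sub>\<infinity> (1 - r))"
    using assms by (simp add: ennpow_mult ennpow_ennreal mult_ac)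
  finally show ?thesis .
qed

text \<open>
  If \<open>\<phi>\<close> exceeds \<open>c F\<close>, then \<open>\<phi>\<^bsup>1-r\<^esup>\<close> is at most \<open>(c F)\<^bsup>1-r\<^esup>\<close>, because \<open>1 - r\<close> is not positive. This
  dichotomy takes the place of Hoelder's inequality.
\<close>

lemma split_large_exponent:
  assumes "1 \<le> r" "0 < c"
  shows "\<phi> \<le> ennreal (c powr (1 - r)) * (\<phi> pow\<^sub>\<infinity> r * F pow\<^sub>\<infinity> (1 - r)) + ennreal c * F"
proof (cases "\<phi> \<le> ennreal c * F")
  case True
  then show ?thesis
    by (simp add: add_increasing)
next
  case False
  have F: "F < \<infinity>"
    using False assms(2) by (cases F) (auto simp: ennreal_mult_top)
  have \<phi>: "0 < \<phi>"
    using False by (auto simp: zero_less_iff_neq_zero)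
  have "\<phi> \<le> ennreal (c powr (1 - r)) * (\<phi> pow\<^sub>\<infinity> r * F pow\<^sub>\<infinity> (1 - r))"
  proof (cases "\<phi> = \<infinity>")
    case True
    have "F pow\<^sub>\<infinity> (1 - r) \<noteq> 0"
      using F assms(1) by (cases F) (auto simp: ennpow_def enn2real_eq_0_iff)
    moreover have "\<phi> pow\<^sub>\<infinity> r = top"
      using True assms(1) by (simp add: ennpow_def)
    ultimately show ?thesis
      using assms(2) by (simp add: ennreal_top_mult ennreal_mult_top)
  next
    case False
    with \<phi> have "\<phi> = \<phi> pow\<^sub>\<infinity> r * \<phi> pow\<^sub>\<infinity> (1 - r)"
      using ennpow_add[of r "1 - r" \<phi>] by (simp add: less_top)
    also have "\<dots> \<le> \<phi> pow\<^sub>\<infinity> r * (ennreal c * F) pow\<^sub>\<infinity> (1 - r)"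
      using assms \<open>\<not> \<phi> \<le> ennreal c * F\<close> by (intro mult_left_mono ennpow_antimono) auto
    also have "\<dots> = ennreal (c powr (1 - r)) * (\<phi> pow\<^sub>\<infinity> r * F pow\<^sub>\<infinity> (1 - r))"
      using assms by (subst ennpow_mult) (simp_all add: ennpow_ennreal mult_ac)
    finally show ?thesis .
  qed
  then show ?thesis
    by (simp add: add_increasing2)
qed

lemma ennpow_majorant:
  assumes "0 < r" "0 < c" "\<gamma> \<le> ennreal c * F"
  shows "\<gamma> pow\<^sub>\<infinity> r * F pow\<^sub>\<infinity> (1 - r) \<le> ennreal (c powr r) * F"
proof -
  have "\<gamma> pow\<^sub>\<infinity> r * F pow\<^sub>\<infinity> (1 - r) \<le> (ennreal c * F) pow\<^sub>\<infinity> r * F pow\<^sub>\<infinity> (1 - r)"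
    using assms by (intro mult_right_mono ennpow_mono) auto
  also have "\<dots> = ennreal (c powr r) * (F pow\<^sub>\<infinity> r * F pow\<^sub>\<infinity> (1 - r))"
    using assms by (simp add: ennpow_mult ennpow_ennreal mult_ac)
  finally have "\<gamma> pow\<^sub>\<infinity> r * F pow\<^sub>\<infinity> (1 - r) \<le> ennreal (c powr r) * (F pow\<^sub>\<infinity> r * F pow\<^sub>\<infinity> (1 - r))" .
  moreover have "F pow\<^sub>\<infinity> r * F pow\<^sub>\<infinity> (1 - r) \<le> F"
  proof (cases "0 < F \<and> F < \<infinity>")
    case True
    then show ?thesis
      using ennpow_add[of r "1 - r" F] by simp
  next
    case False
    then have "F = 0 \<or> F = \<infinity>"
      by (auto simp: zero_less_iff_neq_zero less_top[symmetric])
    then show ?thesis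
      using assms(1) by (auto simp: ennpow_zero)
  qed
  ultimately show ?thesis
    by (meson mult_left_mono order_trans zero_le)
qed

text \<open>
  All the pairs of the sequence share one majorant \<open>F\<close>, built from the series \<open>F\<^sub>0\<close>, hence one weight and one
  constant \<open>C\<^sub>0\<close>. The factor \<open>2\<^bsup>N+1\<^esup>\<close> undoes the weight of the \<open>N\<close>-th pair in \<open>F\<^sub>0\<close>. The function
  \<open>\<gamma>\<^sub>N\<close> enters \<open>F\<^sub>0\<close> divided by \<open>\<epsilon>\<^sub>N\<close>, so that the bound \<open>\<gamma>\<^sub>N \<le> 2\<^bsup>N+1\<^esup> \<epsilon>\<^sub>N F\<close> keeps the gain \<open>\<epsilon>\<^sub>N\<close>; the
  exponent \<open>min r 1\<close> is what remains of the gain after returning from the exponent \<open>r\<close> to one.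
\<close>

lemma extrapolation_A1_sequence:
  fixes v :: "real ^ 'n \<Rightarrow> ennreal" and \<phi> \<gamma> :: "nat \<Rightarrow> real ^ 'n \<Rightarrow> ennreal"
  assumes v: "v \<in> A1_plain" and r: "0 < r" and \<epsilon>: "\<And>N. 0 < \<epsilon> N"
    and meas [measurable]: "\<And>N. \<phi> N \<in> borel_measurable lebesgue" "\<And>N. \<gamma> N \<in> borel_measurable lebesgue"
    and \<phi>: "\<And>N. (\<integral>\<^sup>+x. \<phi> N x * v x \<partial>lebesgue) \<le> ennreal m"
    and \<gamma>: "\<And>N. (\<integral>\<^sup>+x. \<gamma> N x * v x \<partial>lebesgue) \<le> ennreal (\<epsilon> N * m)"
    and hyp: "\<And>w0. w0 \<in> A_infinity \<Longrightarrow> \<exists>C>0. \<forall>N. (\<integral>\<^sup>+x. \<phi> N x pow\<^sub>\<infinity> r * w0 x \<partial>lebesgue) < \<infinity> \<longrightarrow>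
      (\<integral>\<^sup>+x. \<phi> N x pow\<^sub>\<infinity> r * w0 x \<partial>lebesgue) \<le> ennreal C * (\<integral>\<^sup>+x. \<gamma> N x pow\<^sub>\<infinity> r * w0 x \<partial>lebesgue)"
  shows "\<exists>C. \<forall>N. (\<integral>\<^sup>+x. \<phi> N x * v x \<partial>lebesgue) \<le> ennreal (C * 2 ^ Suc N * \<epsilon> N powr min r 1)"
proof -
  note v_meas [measurable] = A1D(1)[OF v]
  define F0 where "F0 x = (\<Sum>N. ennreal ((1/2) ^ Suc N) * (\<phi> N x + \<gamma> N x / ennreal (\<epsilon> N)))" for x
  have [measurable]: "F0 \<in> borel_measurable lebesgue"
    unfolding F0_def by measurable
  define a where "a N = (2::real) ^ Suc N" for N
  have a: "0 < a N" for N by (simp add: a_def)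
  have F0_ge: "\<phi> N x + \<gamma> N x / ennreal (\<epsilon> N) \<le> ennreal (a N) * F0 x" for N x
  proof -
    have "ennreal ((1/2) ^ Suc N) * (\<phi> N x + \<gamma> N x / ennreal (\<epsilon> N)) \<le> F0 x"
      unfolding F0_def
      using sum_le_suminf[of "\<lambda>N. ennreal ((1/2) ^ Suc N) * (\<phi> N x + \<gamma> N x / ennreal (\<epsilon> N))" "{N}"] by simp
    then have "ennreal (a N) * (ennreal ((1/2) ^ Suc N) * (\<phi> N x + \<gamma> N x / ennreal (\<epsilon> N))) \<le> ennreal (a N) * F0 x"
      by (rule mult_left_mono) simp
    moreover have "ennreal (a N) * ennreal ((1/2) ^ Suc N) = 1"
      using a[of N] by (subst ennreal_mult[symmetric]) (auto simp: a_def power_mult_distrib[symmetric] simp del: power_Suc)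
    ultimately show ?thesis
      by (simp add: mult.assoc[symmetric])
  qed
  have "(\<integral>\<^sup>+x. F0 x * v x \<partial>lebesgue)
    = (\<integral>\<^sup>+x. (\<Sum>N. ennreal ((1/2) ^ Suc N) * (\<phi> N x * v x + \<gamma> N x * v x / ennreal (\<epsilon> N))) \<partial>lebesgue)"
    unfolding F0_def by (subst ennreal_suminf_multc[symmetric]) (simp add: divide_ennreal_def distrib_left distrib_right mult_ac)
  also have "\<dots> = (\<Sum>N. ennreal ((1/2) ^ Suc N) * ((\<integral>\<^sup>+x. \<phi> N x * v x \<partial>lebesgue) + (\<integral>\<^sup>+x. \<gamma> N x * v x \<partial>lebesgue) / ennreal (\<epsilon> N)))"
    by (simp add: nn_integral_suminf nn_integral_cmult nn_integral_add nn_integral_divide del: power_Suc)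
  also have "\<dots> \<le> (\<Sum>N. ennreal ((1/2) ^ Suc N) * (ennreal m + ennreal m))"
  proof (intro suminf_le mult_left_mono add_mono \<phi>)
    fix N
    have "(\<integral>\<^sup>+x. \<gamma> N x * v x \<partial>lebesgue) / ennreal (\<epsilon> N) \<le> ennreal (\<epsilon> N * m) / ennreal (\<epsilon> N)"
      by (intro divide_right_mono_ennreal \<gamma>)
    also have "\<dots> \<le> ennreal m"
    proof (cases "0 \<le> m")
      case True
      then show ?thesis
        using \<epsilon>[of N] by (simp add: divide_ennreal)
    next
      case False
      then show ?thesis
        using \<epsilon>[of N] by (simp add: ennreal_neg mult_nonneg_nonpos)
    qed
    finally show "(\<integral>\<^sup>+x. \<gamma> N x * v x \<partial>lebesgue) / ennreal (\<epsilon> N) \<le> ennreal m" .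
  qed auto
  also have "\<dots> = ennreal m + ennreal m"
    by (simp only: ennreal_suminf_multc suminf_half mult_1)
  also have "\<dots> < \<infinity>"
    by simp
  finally have fin: "(\<integral>\<^sup>+x. F0 x * v x \<partial>lebesgue) < \<infinity>" .
  \<comment> \<open>If \<open>F\<^sub>0\<close> vanishes almost everywhere, so do all the \<open>\<phi>\<^sub>N\<close>.\<close>
  show ?thesis
  proof (cases "(\<integral>\<^sup>+x. F0 x * v x \<partial>lebesgue) = 0")
    case True
    have "(\<integral>\<^sup>+x. \<phi> N x * v x \<partial>lebesgue) = 0" for N
    proof -
      have "\<phi> N x * v x \<le> ennreal (a N) * (F0 x * v x)" for x
      proof -
        have "\<phi> N x \<le> ennreal (a N) * F0 x"
          using F0_ge[of N x] by (rule order_trans[rotated]) simp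
        then show ?thesis
          by (simp add: mult.assoc[symmetric] mult_right_mono)
      qed
      then have "(\<integral>\<^sup>+x. \<phi> N x * v x \<partial>lebesgue) \<le> (\<integral>\<^sup>+x. ennreal (a N) * (F0 x * v x) \<partial>lebesgue)"
        by (rule nn_integral_mono)
      also have "\<dots> = 0"
        using True by (subst nn_integral_cmult) auto
      finally show ?thesis by simp
    qed
    then show ?thesis by simp
  next
    case False
    then obtain F where F [measurable]: "F \<in> borel_measurable lebesgue" and F0F: "\<And>x. F0 x \<le> F x"
      and Fint: "(\<integral>\<^sup>+x. F x * v x \<partial>lebesgue) < \<infinity>" and w0: "(\<lambda>x. v x * F x pow\<^sub>\<infinity> (1 - r)) \<in> A_infinity"
      using L1_majorant[OF v r, of F0] fin by (auto simp: zero_less_iff_neq_zero)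
    obtain k where k: "(\<integral>\<^sup>+x. F x * v x \<partial>lebesgue) = ennreal k" "0 \<le> k"
      using Fint by (cases "\<integral>\<^sup>+x. F x * v x \<partial>lebesgue") auto
    obtain C0 where C0: "0 < C0" "\<And>N. (\<integral>\<^sup>+x. \<phi> N x pow\<^sub>\<infinity> r * (v x * F x pow\<^sub>\<infinity> (1 - r)) \<partial>lebesgue) < \<infinity> \<Longrightarrow>
      (\<integral>\<^sup>+x. \<phi> N x pow\<^sub>\<infinity> r * (v x * F x pow\<^sub>\<infinity> (1 - r)) \<partial>lebesgue)
        \<le> ennreal C0 * (\<integral>\<^sup>+x. \<gamma> N x pow\<^sub>\<infinity> r * (v x * F x pow\<^sub>\<infinity> (1 - r)) \<partial>lebesgue)"
      using hyp[OF w0] by blast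
    have \<phi>F: "\<phi> N x \<le> ennreal (a N) * F x" for N x
    proof -
      have "\<phi> N x \<le> \<phi> N x + \<gamma> N x / ennreal (\<epsilon> N)" by simp
      also have "\<dots> \<le> ennreal (a N) * F x"
        using F0_ge[of N x] F0F[of x] by (meson mult_left_mono order_trans zero_le)
      finally show ?thesis .
    qed
    have \<gamma>F: "\<gamma> N x \<le> ennreal (\<epsilon> N * a N) * F x" for N x
    proof -
      have "\<gamma> N x / ennreal (\<epsilon> N) \<le> \<phi> N x + \<gamma> N x / ennreal (\<epsilon> N)" by simp
      also have "\<dots> \<le> ennreal (a N) * F x"
        using F0_ge[of N x] F0F[of x] by (meson mult_left_mono order_trans zero_le)
      finally have "ennreal (\<epsilon> N) * (\<gamma> N x / ennreal (\<epsilon> N)) \<le> ennreal (\<epsilon> N) * (ennreal (a N) * F x)"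
        by (rule mult_left_mono) simp
      then show ?thesis
        using \<epsilon>[of N] a[of N] by (simp add: ennreal_times_divide mult_divide_eq_ennreal mult.commute[of "ennreal (\<epsilon> N)"] ennreal_mult mult.assoc)
    qed
    have weighted: "(\<integral>\<^sup>+x. g x pow\<^sub>\<infinity> r * (v x * F x pow\<^sub>\<infinity> (1 - r)) \<partial>lebesgue) \<le> ennreal (d powr r * k)"
      if "\<And>x. g x \<le> ennreal d * F x" "0 < d" for g d
    proof -
      have "g x pow\<^sub>\<infinity> r * (v x * F x pow\<^sub>\<infinity> (1 - r)) \<le> ennreal (d powr r) * (F x * v x)" for x
        using mult_right_mono[OF ennpow_majorant[OF r that(2) that(1)[of x]], of "v x"] by (simp add: mult_ac)
      then have "(\<integral>\<^sup>+x. g x pow\<^sub>\<infinity> r * (v x * F x pow\<^sub>\<infinity> (1 - r)) \<partial>lebesgue) \<le> (\<integral>\<^sup>+x. ennreal (d powr r) * (F x * v x) \<partial>lebesgue)"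
        by (rule nn_integral_mono)
      also have "\<dots> = ennreal (d powr r * k)"
        using k by (subst nn_integral_cmult) (auto simp: ennreal_mult)
      finally show ?thesis .
    qed
    have est: "(\<integral>\<^sup>+x. \<phi> N x pow\<^sub>\<infinity> r * (v x * F x pow\<^sub>\<infinity> (1 - r)) \<partial>lebesgue) \<le> ennreal (C0 * ((\<epsilon> N * a N) powr r * k))" for N
    proof -
      have "(\<integral>\<^sup>+x. \<phi> N x pow\<^sub>\<infinity> r * (v x * F x pow\<^sub>\<infinity> (1 - r)) \<partial>lebesgue) < \<infinity>"
        using weighted[of "\<phi> N" "a N"] \<phi>F a[of N] by (auto intro: le_less_trans)
      then have "(\<integral>\<^sup>+x. \<phi> N x pow\<^sub>\<infinity> r * (v x * F x pow\<^sub>\<infinity> (1 - r)) \<partial>lebesgue)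
          \<le> ennreal C0 * (\<integral>\<^sup>+x. \<gamma> N x pow\<^sub>\<infinity> r * (v x * F x pow\<^sub>\<infinity> (1 - r)) \<partial>lebesgue)"
        by (rule C0(2))
      also have "\<dots> \<le> ennreal C0 * ennreal ((\<epsilon> N * a N) powr r * k)"
        using \<gamma>F a[of N] \<epsilon>[of N] by (intro mult_left_mono weighted) auto
      also have "\<dots> = ennreal (C0 * ((\<epsilon> N * a N) powr r * k))"
        using C0(1) k(2) by (simp add: ennreal_mult)
      finally show ?thesis .
    qed
    have "(\<integral>\<^sup>+x. \<phi> N x * v x \<partial>lebesgue) \<le> ennreal ((C0 + 1) * k * a N * \<epsilon> N powr min r 1)" for N
    proof (cases "r < 1")
      case True
      have "\<phi> N x * v x \<le> ennreal (a N powr (1 - r)) * (\<phi> N x pow\<^sub>\<infinity> r * (v x * F x pow\<^sub>\<infinity> (1 - r)))" for x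
        using mult_right_mono[OF split_small_exponent[OF r True a \<phi>F], of "v x"] by (simp add: mult_ac)
      then have "(\<integral>\<^sup>+x. \<phi> N x * v x \<partial>lebesgue)
        \<le> (\<integral>\<^sup>+x. ennreal (a N powr (1 - r)) * (\<phi> N x pow\<^sub>\<infinity> r * (v x * F x pow\<^sub>\<infinity> (1 - r))) \<partial>lebesgue)"
        by (rule nn_integral_mono)
      also have "\<dots> = ennreal (a N powr (1 - r)) * (\<integral>\<^sup>+x. \<phi> N x pow\<^sub>\<infinity> r * (v x * F x pow\<^sub>\<infinity> (1 - r)) \<partial>lebesgue)"
        by (rule nn_integral_cmult) measurable
      also have "\<dots> \<le> ennreal (a N powr (1 - r)) * ennreal (C0 * ((\<epsilon> N * a N) powr r * k))"
        by (intro mult_left_mono est) auto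
      also have "\<dots> = ennreal (C0 * k * a N * \<epsilon> N powr r)"
      proof -
        have "a N powr (1 - r) * a N powr r = a N"
          using a[of N] by (simp flip: powr_add)
        then have "a N powr (1 - r) * (C0 * ((\<epsilon> N * a N) powr r * k)) = C0 * k * a N * \<epsilon> N powr r"
          using a[of N] \<epsilon>[of N] by (simp add: powr_mult mult_ac)
        moreover have "ennreal (a N powr (1 - r)) * ennreal (C0 * ((\<epsilon> N * a N) powr r * k))
          = ennreal (a N powr (1 - r) * (C0 * ((\<epsilon> N * a N) powr r * k)))"
          using C0(1) k(2) by (intro ennreal_mult[symmetric]) auto
        ultimately show ?thesis
          by (simp only:)
      qed
      also have "\<dots> \<le> ennreal ((C0 + 1) * k * a N * \<epsilon> N powr min r 1)"
        using True k(2) a[of N] by (intro ennreal_leI) (auto simp: min_def intro!: mult_right_mono)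
      finally show ?thesis .
    next
      case False
      then have r1: "1 \<le> r" by simp
      define c where "c = \<epsilon> N * a N"
      have c: "0 < c" using a \<epsilon> by (simp add: c_def)
      have "\<phi> N x * v x \<le> ennreal (c powr (1 - r)) * (\<phi> N x pow\<^sub>\<infinity> r * (v x * F x pow\<^sub>\<infinity> (1 - r))) + ennreal c * (F x * v x)" for x
        using mult_right_mono[OF split_large_exponent[OF r1 c, of "\<phi> N x" "F x"] zero_le, of "v x"]
        by (simp only: distrib_right) (simp only: mult_ac)
      then have "(\<integral>\<^sup>+x. \<phi> N x * v x \<partial>lebesgue)
        \<le> (\<integral>\<^sup>+x. ennreal (c powr (1 - r)) * (\<phi> N x pow\<^sub>\<infinity> r * (v x * F x pow\<^sub>\<infinity> (1 - r))) + ennreal c * (F x * v x) \<partial>lebesgue)"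
        by (rule nn_integral_mono)
      also have "\<dots> = ennreal (c powr (1 - r)) * (\<integral>\<^sup>+x. \<phi> N x pow\<^sub>\<infinity> r * (v x * F x pow\<^sub>\<infinity> (1 - r)) \<partial>lebesgue) + ennreal c * ennreal k"
        by (subst nn_integral_add) (auto simp: nn_integral_cmult k(1))
      also have "\<dots> \<le> ennreal (c powr (1 - r)) * ennreal (C0 * (c powr r * k)) + ennreal c * ennreal k"
        using est[of N] by (intro add_mono mult_left_mono) (auto simp: c_def)
      also have "\<dots> = ennreal ((C0 + 1) * k * a N * \<epsilon> N powr min r 1)"
      proof -
        have e1: "c powr (1 - r) * c powr r = c"
          using c by (simp flip: powr_add)
        have e2: "c powr (1 - r) * (C0 * (c powr r * k)) = C0 * k * (c powr (1 - r) * c powr r)"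
          by (simp only: mult_ac)
        have "c powr (1 - r) * (C0 * (c powr r * k)) + c * k = C0 * k * c + c * k"
          by (simp only: e2 e1)
        also have "\<dots> = (C0 + 1) * k * c"
          by (simp add: algebra_simps)
        finally have "c powr (1 - r) * (C0 * (c powr r * k)) + c * k = (C0 + 1) * k * c" .
        moreover have "(C0 + 1) * k * a N * \<epsilon> N powr min r 1 = (C0 + 1) * k * c"
          using r1 \<epsilon>[of N] by (simp add: c_def min_def)
        moreover have "ennreal (c powr (1 - r)) * ennreal (C0 * (c powr r * k)) + ennreal c * ennreal k
          = ennreal (c powr (1 - r) * (C0 * (c powr r * k)) + c * k)"
          using C0(1) k(2) c by (subst ennreal_plus) (auto simp: ennreal_mult)
        ultimately show ?thesis
          by (simp only:)
      qed
      finally show ?thesis .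
    qed
    then show ?thesis
      by (auto simp: a_def)
  qed
qed

section \<open>The variable exponent and the power s\<close>

text \<open>
  The essential infimum is the supremum of a sequence of lower bounds, each valid off a null set.
\<close>

lemma AE_essinf_le: "AE x in M. essinf M f \<le> f x"
proof -
  let ?Z = "{z. AE x in M. z \<le> f x}"
  have "0 \<in> ?Z" by simp
  then have "?Z \<noteq> {}" by blast
  then obtain z :: "nat \<Rightarrow> ennreal" where z: "range z \<subseteq> ?Z" "Sup ?Z = (SUP i. z i)"
    using ennreal_Sup_countable_SUP[of ?Z] by blast
  then have "AE x in M. \<forall>i. z i \<le> f x"
    unfolding AE_all_countable by blast
  then show ?thesis
    by eventually_elim (auto simp: essinf_def z(2) intro: SUP_least)
qed

text \<open>
  A function in the space is finite almost everywhere, so that it agrees with a real function up to a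
  null set, which averages do not see. The constant grows by a factor two in \<open>var_norm_le_double\<close>, and
  by another one to make the inequality strict for \<open>var_bounded_of_norm\<close>.
\<close>

lemma max_bounded_on_of_maximal_bounded:
  fixes q \<omega> :: "real ^ 'n \<Rightarrow> ennreal"
  assumes M: "maximal_bounded q \<omega>" and q: "\<And>x. 1 \<le> q x"
    and [measurable]: "q \<in> borel_measurable lebesgue" "\<omega> \<in> borel_measurable lebesgue"
    and \<omega>: "AE x in lebesgue. 0 < \<omega> x"
  obtains C where "0 < C" "max_bounded_on (\<lambda>_. 1) q \<omega> C"
proof -
  obtain C where C: "0 < C" "\<And>f. f \<in> borel_measurable lebesgue \<Longrightarrow> wvar_norm q \<omega> (\<lambda>x. ennreal \<bar>f x\<bar>) < \<infinity> \<Longrightarrow>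
    wvar_norm q \<omega> (maximal f) \<le> ennreal C * wvar_norm q \<omega> (\<lambda>x. ennreal \<bar>f x\<bar>)"
    using M unfolding maximal_bounded_def by blast
  have "max_bounded_on (\<lambda>_. 1) q \<omega> (4 * C)"
    unfolding max_bounded_on_def
  proof (intro ballI allI impI)
    fix h :: "real ^ 'n \<Rightarrow> ennreal" and l :: real
    assume h [measurable]: "h \<in> borel_measurable lebesgue" and l: "0 < l" and b: "var_bounded q (\<lambda>x. h x * \<omega> x) l"
    have "AE x in lebesgue. h x * \<omega> x < \<infinity>"
      using less_le_trans[OF zero_less_one q] by (intro var_bounded_AE_finite[OF b l]) auto
    then have fin: "AE x in lebesgue. h x < \<infinity>"
      using \<omega> by eventually_elim (auto simp: ennreal_mult_less_top)
    define f where "f x = enn2real (h x)" for x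
    have [measurable]: "f \<in> borel_measurable lebesgue"
      unfolding f_def by measurable
    have f: "AE x in lebesgue. ennreal \<bar>f x\<bar> = h x"
      using fin by eventually_elim (simp add: f_def)
    have "maximal f = wmax (\<lambda>_. 1) h"
    proof -
      have "(\<integral>\<^sup>+y\<in>B. ennreal \<bar>f y\<bar> \<partial>lebesgue) / emeasure lebesgue B = wavg (\<lambda>_. 1) B h" if "B \<in> balls" for B
      proof -
        have "(\<integral>\<^sup>+y\<in>B. ennreal \<bar>f y\<bar> \<partial>lebesgue) = (\<integral>\<^sup>+y\<in>B. h y * 1 \<partial>lebesgue)"
          using f by (intro nn_integral_cong_AE) (auto elim: eventually_mono)
        then show ?thesis
          using that by (simp add: wavg_def)
      qed
      then show ?thesis
        by (intro ext) (auto simp: maximal_def wmax_def intro!: SUP_cong)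
    qed
    moreover have "wvar_norm q \<omega> (\<lambda>x. ennreal \<bar>f x\<bar>) \<le> ennreal (2 * l)"
      unfolding wvar_norm_def
    proof (rule var_norm_le_double)
      show "var_bounded q (\<lambda>x. ennreal \<bar>f x\<bar> * \<omega> x) l"
        using f by (intro var_bounded_mono[OF b l order_refl]) (auto elim!: eventually_mono)
    qed (use l q in auto)
    moreover from this have "wvar_norm q \<omega> (\<lambda>x. ennreal \<bar>f x\<bar>) < \<infinity>"
      by (auto intro: le_less_trans)
    ultimately have "var_norm q (\<lambda>x. wmax (\<lambda>_. 1) h x * \<omega> x) \<le> ennreal C * ennreal (2 * l)"
      using C(2)[of f] by (simp add: wvar_norm_def) (meson mult_left_mono order_trans zero_le)
    also have "\<dots> = ennreal (C * (2 * l))"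
      using C(1) l by (intro ennreal_mult[symmetric]) auto
    also have "\<dots> < ennreal (4 * C * l)"
      using C(1) l by (intro ennreal_lessI) auto
    finally show "var_bounded q (\<lambda>x. wmax (\<lambda>_. 1) h x * \<omega> x) (4 * C * l)"
      by (rule var_bounded_of_norm)
  qed
  then show ?thesis
    using C(1) by (intro that[of "4 * C"]) auto
qed

lemma var_bounded_finite_exponent:
  assumes "\<And>x. p x < \<infinity>"
  shows "var_bounded p k l \<longleftrightarrow> (\<integral>\<^sup>+x. (k x / ennreal l) pow\<^sub>\<infinity> enn2real (p x) \<partial>lebesgue) \<le> 1"
proof -
  have "p x \<noteq> top" for x
    using assms[of x] by auto
  then show ?thesis
    by (simp add: var_bounded_def)
qed

lemma var_norm_le_of_bounded:
  fixes p k :: "real ^ 'n \<Rightarrow> ennreal"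
  assumes "\<And>x. p x < \<infinity>" "var_bounded p k l" "0 < l"
  shows "var_norm p k \<le> ennreal l"
proof (rule var_norm_le)
  have p: "p x \<noteq> top" for x
    using assms(1)[of x] by auto
  have "esssup lebesgue (\<lambda>_ :: real ^ 'n. 0 :: ennreal) \<le> 0"
    by (rule esssup_I) auto
  then show "var_modular p k l \<le> 1"
    using assms(2) p by (simp add: var_modular_def var_bounded_def)
qed (rule assms)

text \<open>
  The rescaling identity between the norms of \<open>L\<^sup>p\<close> and \<open>L\<^bsup>p/s\<^esup>\<close>.
\<close>

lemma var_bounded_power:
  fixes p k :: "real ^ 'n \<Rightarrow> ennreal"
  assumes p: "\<And>x. 0 < p x \<and> p x < \<infinity>" and s: "0 < s" and a: "0 < a" and b: "0 < b"
  shows "var_bounded (\<lambda>x. p x / ennreal s) (\<lambda>x. (k x / ennreal a) pow\<^sub>\<infinity> s) (b powr s) \<longleftrightarrow> var_bounded p k (a * b)"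
proof -
  have fin: "p x / ennreal s < \<infinity>" for x
    using p[of x] s by (simp add: ennreal_divide_eq_top_iff less_top[symmetric])
  have "((k x / ennreal a) pow\<^sub>\<infinity> s / ennreal (b powr s)) pow\<^sub>\<infinity> enn2real (p x / ennreal s)
    = (k x / ennreal (a * b)) pow\<^sub>\<infinity> enn2real (p x)" for x
  proof -
    have e: "s * enn2real (p x / ennreal s) = enn2real (p x)"
      using p[of x] s by (cases "p x") (auto simp: divide_ennreal)
    have "(k x / ennreal a) pow\<^sub>\<infinity> s / ennreal (b powr s) = (k x / ennreal a / ennreal b) pow\<^sub>\<infinity> s"
      using s b by (simp add: ennpow_divide)
    also have "k x / ennreal a / ennreal b = k x / ennreal (a * b)"
      using a b by (simp add: divide_ennreal_def inverse_ennreal mult.assoc flip: ennreal_mult)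
    finally show ?thesis
      by (simp add: ennpow_ennpow e)
  qed
  then show ?thesis
    using p fin by (simp add: var_bounded_finite_exponent)
qed

section \<open>Extrapolation\<close>

theorem theorem2p24:
  fixes \<F> :: "((real ^ 'n \<Rightarrow> ennreal) \<times> (real ^ 'n \<Rightarrow> ennreal)) set"
    and p w :: "real ^ 'n \<Rightarrow> ennreal"
    and p0 :: real
  assumes "\<And>f g. (f, g) \<in> \<F> \<Longrightarrow> f \<in> borel_measurable lebesgue \<and> g \<in> borel_measurable lebesgue"
    and "0 < p0"
    and "\<And>w0. w0 \<in> A_infinity \<Longrightarrow>
      \<exists>C>0. \<forall>(f, g) \<in> \<F>. (\<integral>\<^sup>+x. f x pow\<^sub>\<infinity> p0 * w0 x \<partial>lebesgue) < \<infinity> \<longrightarrow>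
        (\<integral>\<^sup>+x. f x pow\<^sub>\<infinity> p0 * w0 x \<partial>lebesgue)
          \<le> ennreal C * (\<integral>\<^sup>+x. g x pow\<^sub>\<infinity> p0 * w0 x \<partial>lebesgue)"
    and "p \<in> exponents0"
    and "w \<in> borel_measurable lebesgue"
    and "\<exists>s>0. ennreal s \<le> essinf lebesgue p \<and>
      (\<lambda>x. w x pow\<^sub>\<infinity> s) \<in> A_var (\<lambda>x. p x / ennreal s) \<and>
      maximal_bounded (\<lambda>x. conj_exp (p x / ennreal s)) (\<lambda>x. w x pow\<^sub>\<infinity> (- s))"
  shows "\<exists>C>0. \<forall>(f, g) \<in> \<F>. wvar_norm p w f < \<infinity> \<longrightarrow>
    wvar_norm p w f \<le> ennreal C * wvar_norm p w g"
proof (rule ccontr)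
  assume fails: "\<not> (\<exists>C>0. \<forall>(f, g) \<in> \<F>. wvar_norm p w f < \<infinity> \<longrightarrow>
    wvar_norm p w f \<le> ennreal C * wvar_norm p w g)"
  obtain s where s: "0 < s" "ennreal s \<le> essinf lebesgue p"
    and W: "(\<lambda>x. w x pow\<^sub>\<infinity> s) \<in> A_var (\<lambda>x. p x / ennreal s)"
    and M: "maximal_bounded (\<lambda>x. conj_exp (p x / ennreal s)) (\<lambda>x. w x pow\<^sub>\<infinity> (- s))"
    using assms(6) by blast
  have p [measurable]: "p \<in> borel_measurable lebesgue" and p_pos: "\<And>x. 0 < p x \<and> p x < \<infinity>"
    using assms(4) by (auto simp: exponents0_def)
  note w_meas [measurable] = assms(5)
  define P where "P x = p x / ennreal s" for x
  have [measurable]: "P \<in> borel_measurable lebesgue"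
    unfolding P_def by measurable
  have P_fin: "P x < \<infinity>" for x
    using p_pos[of x] s(1) by (simp add: P_def ennreal_divide_eq_top_iff less_top[symmetric])
  have P_ge: "AE x in lebesgue. 1 \<le> P x"
    using AE_essinf_le[of lebesgue p]
  proof eventually_elim
    case (elim x)
    then have "ennreal s \<le> p x"
      using s(2) by (rule order_trans[rotated])
    then have "ennreal s / ennreal s \<le> P x"
      unfolding P_def by (rule divide_right_mono_ennreal)
    then show ?case
      using s(1) by simp
  qed
  define q where "q x = conj_exp (P x)" for x
  have q_meas [measurable]: "q \<in> borel_measurable lebesgue" and q_ge: "\<And>x. 1 \<le> q x"
    unfolding q_def by (measurable, rule conj_exp_ge_1)
  define \<omega> where "\<omega> x = w x pow\<^sub>\<infinity> (- s)" for x
  have \<omega>_meas [measurable]: "\<omega> \<in> borel_measurable lebesgue"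
    unfolding \<omega>_def by measurable
  have "AE x in lebesgue. 0 < w x pow\<^sub>\<infinity> s \<and> w x pow\<^sub>\<infinity> s < \<infinity>"
    using W by (simp add: A_var_def)
  then have w_pos: "AE x in lebesgue. 0 < w x \<and> w x < \<infinity>"
    by eventually_elim (use s(1) in \<open>auto simp: zero_less_iff_neq_zero less_top[symmetric] ennpow_eq_0_iff ennpow_eq_top_iff[simplified]\<close>)
  have \<omega>_pos: "AE x in lebesgue. 0 < \<omega> x"
    using w_pos by eventually_elim (auto simp: \<omega>_def ennpow_pos)
  have w\<omega>: "AE x in lebesgue. w x pow\<^sub>\<infinity> s * \<omega> x = 1"
    using w_pos by eventually_elim (use ennpow_add[of s "- s"] in \<open>auto simp: \<omega>_def\<close>)
  obtain CM where CM: "0 < CM" "max_bounded_on (\<lambda>_. 1) q \<omega> CM"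
    using max_bounded_on_of_maximal_bounded[of q \<omega>] M q_ge \<omega>_pos by (auto simp: q_def[abs_def] P_def \<omega>_def[abs_def])

  define r where "r = p0 / s"
  have r: "0 < r" "s * r = p0"
    using assms(2) s(1) by (auto simp: r_def)
  define \<rho> where "\<rho> = min r 1"
  have \<rho>: "0 < \<rho>" using r by (simp add: \<rho>_def)
  \<comment> \<open>The gain \<open>\<epsilon>\<^sub>N\<^sup>\<rho> = 16\<^bsup>-(N+1)\<^esup>\<close> beats the loss \<open>8\<^bsup>N+1\<^esup>\<close>: a factor \<open>4\<^bsup>N+1\<^esup>\<close> from summing the test
      functions and \<open>2\<^bsup>N+1\<^esup>\<close> from \<open>extrapolation_A1_sequence\<close>.\<close>
  define \<epsilon> where "\<epsilon> N = ((1/16) ^ Suc N :: real) powr (1 / \<rho>)" for N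
  have \<epsilon>: "0 < \<epsilon> N" "\<epsilon> N powr \<rho> = (1/16) ^ Suc N" for N
    using \<rho> by (simp_all add: \<epsilon>_def powr_powr)

  have "\<exists>f g. (f, g) \<in> \<F> \<and> wvar_norm p w f < \<infinity> \<and> ennreal (\<epsilon> N powr (- 1 / s)) * wvar_norm p w g < wvar_norm p w f" for N
  proof -
    have "0 < \<epsilon> N powr (- 1 / s)" using \<epsilon>(1)[of N] by simp
    then obtain z where "z \<in> \<F>" "\<not> (case z of (f, g) \<Rightarrow> wvar_norm p w f < \<infinity> \<longrightarrow>
        wvar_norm p w f \<le> ennreal (\<epsilon> N powr (- 1 / s)) * wvar_norm p w g)"
      using fails by blast
    then show ?thesis
      by (cases z) (auto simp: not_le)
  qed
  then obtain f g where fg: "\<And>N. (f N, g N) \<in> \<F>" and f_fin: "\<And>N. wvar_norm p w (f N) < \<infinity>"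
    and gap: "\<And>N. ennreal (\<epsilon> N powr (- 1 / s)) * wvar_norm p w (g N) < wvar_norm p w (f N)"
    by metis
  have [measurable]: "f N \<in> borel_measurable lebesgue" "g N \<in> borel_measurable lebesgue" for N
    using assms(1)[OF fg] by auto
  define a where "a N = enn2real (wvar_norm p w (f N))" for N
  have a_norm: "wvar_norm p w (f N) = ennreal (a N)" for N
    using f_fin[of N] by (simp add: a_def)
  have a: "0 < a N" for N
    using le_less_trans[OF zero_le gap[of N]] by (simp add: a_norm)
  have g_small: "wvar_norm p w (g N) < ennreal (a N * \<epsilon> N powr (1 / s))" for N
  proof (cases "wvar_norm p w (g N)")
    case (real b)
    have "\<epsilon> N powr (- 1 / s) * b < a N"
      using gap[of N] real unfolding a_norm by (simp add: ennreal_less_iff flip: ennreal_mult)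
    then have "\<epsilon> N powr (1 / s) * (\<epsilon> N powr (- 1 / s) * b) < \<epsilon> N powr (1 / s) * a N"
      using \<epsilon>(1)[of N] by (intro mult_strict_left_mono) auto
    moreover have "\<epsilon> N powr (1 / s) * \<epsilon> N powr (- 1 / s) = 1"
      using \<epsilon>(1)[of N] by (simp flip: powr_add)
    ultimately have "b < \<epsilon> N powr (1 / s) * a N"
      by (simp only: mult.assoc[symmetric] mult_1_left)
    then have "b < a N * \<epsilon> N powr (1 / s)"
      by (simp only: mult.commute)
    then show ?thesis
      using real by (simp add: ennreal_less_iff)
  next
    case top
    then show ?thesis
      using gap[of N] \<epsilon>(1)[of N] by (simp add: ennreal_mult_top)
  qed
  define \<phi> where "\<phi> N x = (f N x / ennreal (a N)) pow\<^sub>\<infinity> s" for N x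
  define \<gamma> where "\<gamma> N x = (g N x / ennreal (a N)) pow\<^sub>\<infinity> s" for N x
  have [measurable]: "\<phi> N \<in> borel_measurable lebesgue" "\<gamma> N \<in> borel_measurable lebesgue" for N
    unfolding \<phi>_def \<gamma>_def by measurable
  have rescale: "(k x / ennreal (a N)) pow\<^sub>\<infinity> s * w x pow\<^sub>\<infinity> s = (k x * w x / ennreal (a N)) pow\<^sub>\<infinity> s"
    for k :: "real ^ 'n \<Rightarrow> ennreal" and N x
  proof -
    have "k x * w x / ennreal (a N) = (k x / ennreal (a N)) * w x"
      by (simp add: divide_ennreal_def mult_ac)
    then show ?thesis
      using s(1) by (simp add: ennpow_mult)
  qed
  have vb: "var_bounded P (\<lambda>x. (k x / ennreal (a N)) pow\<^sub>\<infinity> s * w x pow\<^sub>\<infinity> s) (b powr s)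
      \<longleftrightarrow> var_bounded p (\<lambda>x. k x * w x) (a N * b)" if "0 < b" for k b N
    using var_bounded_power[of p s "a N" b "\<lambda>x. k x * w x"] p_pos s(1) a that by (simp add: rescale P_def[abs_def])
  have \<phi>_norm: "var_bounded P (\<lambda>x. \<phi> N x * w x pow\<^sub>\<infinity> s) (2 powr s)" for N
    unfolding \<phi>_def
  proof (subst vb)
    show "var_bounded p (\<lambda>x. f N x * w x) (a N * 2)"
      using a_norm[of N] a[of N] by (intro var_bounded_of_norm) (auto simp: wvar_norm_def intro: ennreal_lessI)
  qed simp
  have \<gamma>_norm: "var_bounded P (\<lambda>x. \<gamma> N x * w x pow\<^sub>\<infinity> s) (\<epsilon> N)" for N
  proof -
    have "var_bounded p (\<lambda>x. g N x * w x) (a N * \<epsilon> N powr (1 / s))"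
      using g_small[of N] by (intro var_bounded_of_norm) (simp add: wvar_norm_def)
    then have "var_bounded P (\<lambda>x. \<gamma> N x * w x pow\<^sub>\<infinity> s) ((\<epsilon> N powr (1 / s)) powr s)"
      unfolding \<gamma>_def using \<epsilon>(1)[of N] by (subst vb) auto
    then show ?thesis
      using s(1) \<epsilon>(1)[of N] by (simp add: powr_powr)
  qed
  \<comment> \<open>Half of the norm is not an admissible bound, so duality provides test functions.\<close>
  define c where "c = (1/2 :: real) powr s"
  have c: "0 < c" by (simp add: c_def)
  have "\<exists>h\<in>borel_measurable lebesgue. var_bounded q h 1 \<and> ennreal c \<le> (\<integral>\<^sup>+x. \<phi> N x * w x pow\<^sub>\<infinity> s * h x \<partial>lebesgue)" for N
    unfolding q_def
  proof (rule var_dual)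
    have "\<not> var_bounded P (\<lambda>x. \<phi> N x * w x pow\<^sub>\<infinity> s) c"
      unfolding \<phi>_def c_def
    proof (subst vb)
      show "\<not> var_bounded p (\<lambda>x. f N x * w x) (a N * (1/2))"
      proof
        assume "var_bounded p (\<lambda>x. f N x * w x) (a N * (1/2))"
        then have "wvar_norm p w (f N) \<le> ennreal (a N * (1/2))"
          unfolding wvar_norm_def using p_pos a[of N] by (intro var_norm_le_of_bounded) auto
        then show False
          using a[of N] by (simp add: a_norm)
      qed
    qed simp
    then show "1 < (\<integral>\<^sup>+x. (\<phi> N x * w x pow\<^sub>\<infinity> s / ennreal c) pow\<^sub>\<infinity> enn2real (P x) \<partial>lebesgue)"
      using P_fin by (simp add: var_bounded_finite_exponent not_le)
    show "AE x in lebesgue. \<phi> N x * w x pow\<^sub>\<infinity> s < \<infinity>"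
      using P_ge by (intro var_bounded_AE_finite[OF \<phi>_norm]) (auto elim!: eventually_mono intro: less_le_trans[OF zero_less_one])
  qed (use c P_fin P_ge in auto)
  then have "\<forall>N. \<exists>h. h \<in> borel_measurable lebesgue \<and> var_bounded q h 1 \<and>
      ennreal c \<le> (\<integral>\<^sup>+x. \<phi> N x * w x pow\<^sub>\<infinity> s * h x \<partial>lebesgue)"
    by blast
  from choice[OF this] obtain h where h_meas [measurable]: "\<And>N. h N \<in> borel_measurable lebesgue"
    and h: "\<And>N. var_bounded q (h N) 1" "\<And>N. ennreal c \<le> (\<integral>\<^sup>+x. \<phi> N x * w x pow\<^sub>\<infinity> s * h N x \<partial>lebesgue)"
    by blast
  \<comment> \<open>One function that dominates all the test functions, up to factors \<open>4\<^bsup>N+1\<^esup>\<close>.\<close>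
  define \<eta> where "\<eta> x = (\<Sum>N. ennreal ((1/4) ^ Suc N) * h N x) * w x pow\<^sub>\<infinity> s" for x
  have \<eta>_meas [measurable]: "\<eta> \<in> borel_measurable lebesgue"
    unfolding \<eta>_def by measurable
  have h_le: "w x pow\<^sub>\<infinity> s * h N x \<le> ennreal (4 ^ Suc N) * \<eta> x" for N x
  proof -
    have "ennreal ((1/4) ^ Suc N) * h N x \<le> (\<Sum>N. ennreal ((1/4) ^ Suc N) * h N x)"
      using sum_le_suminf[of "\<lambda>N. ennreal ((1/4) ^ Suc N) * h N x" "{N}"] by simp
    then have "ennreal (4 ^ Suc N) * (ennreal ((1/4) ^ Suc N) * h N x * w x pow\<^sub>\<infinity> s) \<le> ennreal (4 ^ Suc N) * \<eta> x"
      unfolding \<eta>_def by (intro mult_left_mono mult_right_mono) auto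
    moreover have "ennreal (4 ^ Suc N) * ennreal ((1/4) ^ Suc N) = 1"
      by (subst ennreal_mult[symmetric]) (auto simp: power_mult_distrib[symmetric] simp del: power_Suc)
    moreover have "ennreal (4 ^ Suc N) * (ennreal ((1/4) ^ Suc N) * h N x * w x pow\<^sub>\<infinity> s)
        = (ennreal (4 ^ Suc N) * ennreal ((1/4) ^ Suc N)) * (w x pow\<^sub>\<infinity> s * h N x)"
      by (simp only: mult_ac)
    ultimately show ?thesis
      by (simp only: mult_1_left)
  qed
  have pairing: "ennreal c \<le> ennreal (4 ^ Suc N) * (\<integral>\<^sup>+x. \<phi> N x * \<eta> x \<partial>lebesgue)" for N
  proof -
    have "ennreal c \<le> (\<integral>\<^sup>+x. \<phi> N x * (w x pow\<^sub>\<infinity> s * h N x) \<partial>lebesgue)"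
      using h(2)[of N] by (simp add: mult.assoc)
    also have "\<dots> \<le> (\<integral>\<^sup>+x. ennreal (4 ^ Suc N) * (\<phi> N x * \<eta> x) \<partial>lebesgue)"
      by (intro nn_integral_mono) (subst mult.left_commute, intro mult_left_mono h_le zero_le)
    also have "\<dots> = ennreal (4 ^ Suc N) * (\<integral>\<^sup>+x. \<phi> N x * \<eta> x \<partial>lebesgue)"
      by (rule nn_integral_cmult) measurable
    finally show ?thesis .
  qed
  have \<eta>_norm: "var_bounded q (\<lambda>x. \<eta> x * \<omega> x) 1"
  proof -
    have "var_bounded q (\<lambda>x. ennreal ((1/4) ^ Suc N) * h N x) ((1/4) ^ Suc N * 1)" for N
      by (intro var_bounded_cmult h) auto
    then have "var_bounded q (\<lambda>x. \<Sum>N. ennreal ((1/4) ^ Suc N) * h N x) 1"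
      using q_ge by (intro var_bounded_suminf) auto
    moreover have "AE x in lebesgue. \<eta> x * \<omega> x \<le> (\<Sum>N. ennreal ((1/4) ^ Suc N) * h N x)"
      using w\<omega> by eventually_elim (simp add: \<eta>_def mult.assoc del: power_Suc)
    ultimately show ?thesis
      by (rule var_bounded_mono[OF _ zero_less_one order_refl])
  qed
  have \<eta>_pos: "0 < (\<integral>\<^sup>+x. \<eta> x * 1 \<partial>lebesgue)"
  proof (rule ccontr)
    assume "\<not> 0 < (\<integral>\<^sup>+x. \<eta> x * 1 \<partial>lebesgue)"
    then have "AE x in lebesgue. \<eta> x = 0"
      by (subst (asm) not_gr_zero, subst (asm) nn_integral_0_iff_AE) auto
    then have "(\<integral>\<^sup>+x. \<phi> 0 x * \<eta> x \<partial>lebesgue) = 0"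
      by (subst nn_integral_0_iff_AE) (auto elim: eventually_mono)
    then show False
      using pairing[of 0] c by simp
  qed
  have ball_fin: "(\<integral>\<^sup>+x\<in>B. 1 \<partial>(lebesgue :: (real ^ 'n) measure)) < \<infinity>" if "B \<in> balls" for B
    using emeasure_balls[OF that] that by simp
  obtain H where H: "H \<in> A1_plain" "\<And>x. \<eta> x \<le> H x" "var_bounded q (\<lambda>x. H x * \<omega> x) (4 * 1)"
    using rubio_de_francia[OF CM(2) CM(1) q_ge \<eta>_norm zero_less_one \<eta>_pos _ q_meas \<omega>_meas \<eta>_meas ball_fin \<omega>_pos]
    by auto
  note [measurable] = A1D(1)[OF H(1)]
  have dual: "(\<integral>\<^sup>+x. k x * H x \<partial>lebesgue) \<le> ennreal (2 * l * 4)"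
    if "var_bounded P (\<lambda>x. k x * w x pow\<^sub>\<infinity> s) l" "0 < l" and [measurable]: "k \<in> borel_measurable lebesgue" for k l
  proof -
    have "(\<integral>\<^sup>+x. k x * H x \<partial>lebesgue) = (\<integral>\<^sup>+x. (k x * w x pow\<^sub>\<infinity> s) * (H x * \<omega> x) \<partial>lebesgue)"
      using w\<omega>
    proof (intro nn_integral_cong_AE, eventually_elim)
      case (elim x)
      have "(k x * w x pow\<^sub>\<infinity> s) * (H x * \<omega> x) = k x * H x * (w x pow\<^sub>\<infinity> s * \<omega> x)"
        by (simp only: mult_ac)
      then show ?case
        by (simp add: elim)
    qed
    also have "\<dots> \<le> ennreal (2 * l * 4)"
      using that H(3) P_fin P_ge by (intro var_hoelder[of P]) (auto simp: q_def[abs_def])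
    finally show ?thesis .
  qed
  \<comment> \<open>A common bound for the pairings of \<open>\<phi>\<^sub>N\<close> and of \<open>\<gamma>\<^sub>N / \<epsilon>\<^sub>N\<close> with \<open>H\<close>.\<close>
  define m where "m = 8 * 2 powr s"
  have m: "8 \<le> m"
    using s(1) ge_one_powr_ge_zero[of 2 s] by (simp add: m_def)
  have "\<exists>C. \<forall>N. (\<integral>\<^sup>+x. \<phi> N x * H x \<partial>lebesgue) \<le> ennreal (C * 2 ^ Suc N * \<epsilon> N powr min r 1)"
  proof (rule extrapolation_A1_sequence[OF H(1) r(1) \<epsilon>(1)])
    show "(\<integral>\<^sup>+x. \<phi> N x * H x \<partial>lebesgue) \<le> ennreal m" for N
      using dual[OF \<phi>_norm[of N]] by (simp add: m_def)
    show "(\<integral>\<^sup>+x. \<gamma> N x * H x \<partial>lebesgue) \<le> ennreal (\<epsilon> N * m)" for N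
    proof -
      have "(\<integral>\<^sup>+x. \<gamma> N x * H x \<partial>lebesgue) \<le> ennreal (2 * \<epsilon> N * 4)"
        by (rule dual[OF \<gamma>_norm \<epsilon>(1)]) measurable
      also have "\<dots> \<le> ennreal (\<epsilon> N * m)"
        using m \<epsilon>(1)[of N] by (intro ennreal_leI) simp
      finally show ?thesis .
    qed
    fix w0 :: "real ^ 'n \<Rightarrow> ennreal"
    assume w0: "w0 \<in> A_infinity"
    then have [measurable]: "w0 \<in> borel_measurable lebesgue"
      by (auto simp: A_infinity_def A_class_def)
    have rescale0: "(\<integral>\<^sup>+x. ((k x / ennreal (a N)) pow\<^sub>\<infinity> s) pow\<^sub>\<infinity> r * w0 x \<partial>lebesgue)
        = (\<integral>\<^sup>+x. k x pow\<^sub>\<infinity> p0 * w0 x \<partial>lebesgue) / ennreal (a N powr p0)"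
      if [measurable]: "k \<in> borel_measurable lebesgue" for k N
    proof -
      have "((k x / ennreal (a N)) pow\<^sub>\<infinity> s) pow\<^sub>\<infinity> r * w0 x = k x pow\<^sub>\<infinity> p0 * w0 x / ennreal (a N powr p0)" for x
        using assms(2) a[of N] by (simp add: ennpow_ennpow r(2) ennpow_divide) (simp add: divide_ennreal_def mult_ac)
      then show ?thesis
        by (simp add: nn_integral_divide)
    qed
    obtain C where C: "0 < C" "\<And>f g. (f, g) \<in> \<F> \<Longrightarrow> (\<integral>\<^sup>+x. f x pow\<^sub>\<infinity> p0 * w0 x \<partial>lebesgue) < \<infinity> \<Longrightarrow>
        (\<integral>\<^sup>+x. f x pow\<^sub>\<infinity> p0 * w0 x \<partial>lebesgue) \<le> ennreal C * (\<integral>\<^sup>+x. g x pow\<^sub>\<infinity> p0 * w0 x \<partial>lebesgue)"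
      using assms(3)[OF w0] by blast
    have "(\<integral>\<^sup>+x. \<phi> N x pow\<^sub>\<infinity> r * w0 x \<partial>lebesgue) \<le> ennreal C * (\<integral>\<^sup>+x. \<gamma> N x pow\<^sub>\<infinity> r * w0 x \<partial>lebesgue)"
      if "(\<integral>\<^sup>+x. \<phi> N x pow\<^sub>\<infinity> r * w0 x \<partial>lebesgue) < \<infinity>" for N
    proof -
      have "(\<integral>\<^sup>+x. f N x pow\<^sub>\<infinity> p0 * w0 x \<partial>lebesgue) < \<infinity>"
        using that unfolding \<phi>_def by (auto simp: rescale0 ennreal_divide_eq_top_iff less_top[symmetric])
      then have "(\<integral>\<^sup>+x. f N x pow\<^sub>\<infinity> p0 * w0 x \<partial>lebesgue) / ennreal (a N powr p0)
        \<le> ennreal C * (\<integral>\<^sup>+x. g N x pow\<^sub>\<infinity> p0 * w0 x \<partial>lebesgue) / ennreal (a N powr p0)"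
        by (intro divide_right_mono_ennreal C(2) fg)
      then show ?thesis
        unfolding \<phi>_def \<gamma>_def by (simp add: rescale0 ennreal_times_divide)
    qed
    then show "\<exists>C>0. \<forall>N. (\<integral>\<^sup>+x. \<phi> N x pow\<^sub>\<infinity> r * w0 x \<partial>lebesgue) < \<infinity> \<longrightarrow>
      (\<integral>\<^sup>+x. \<phi> N x pow\<^sub>\<infinity> r * w0 x \<partial>lebesgue) \<le> ennreal C * (\<integral>\<^sup>+x. \<gamma> N x pow\<^sub>\<infinity> r * w0 x \<partial>lebesgue)"
      using C(1) by blast
  qed measurable
  then obtain C where "\<forall>N. (\<integral>\<^sup>+x. \<phi> N x * H x \<partial>lebesgue) \<le> ennreal (C * 2 ^ Suc N * \<epsilon> N powr min r 1)"
    by blast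
  then have C: "(\<integral>\<^sup>+x. \<phi> N x * H x \<partial>lebesgue) \<le> ennreal (C * 2 ^ Suc N * (1/16) ^ Suc N)" for N
    by (simp only: \<rho>_def[symmetric] \<epsilon>(2))
  have bound: "c \<le> C * (1/2) ^ Suc N" for N
  proof -
    have "ennreal c \<le> ennreal (4 ^ Suc N) * (\<integral>\<^sup>+x. \<phi> N x * \<eta> x \<partial>lebesgue)"
      by (rule pairing)
    also have "\<dots> \<le> ennreal (4 ^ Suc N) * (\<integral>\<^sup>+x. \<phi> N x * H x \<partial>lebesgue)"
      by (intro mult_left_mono nn_integral_mono H(2) zero_le)
    also have "\<dots> \<le> ennreal (4 ^ Suc N) * ennreal (C * 2 ^ Suc N * (1/16) ^ Suc N)"
      by (intro mult_left_mono C zero_le)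
    also have "\<dots> = ennreal (4 ^ Suc N * (C * 2 ^ Suc N * (1/16) ^ Suc N))"
      by (rule ennreal_mult'[symmetric]) simp
    also have "4 ^ Suc N * (C * 2 ^ Suc N * (1/16) ^ Suc N) = C * ((4 * 2 * (1/16)) ^ Suc N :: real)"
      by (simp only: power_mult_distrib mult_ac)
    also have "(4 * 2 * (1/16) :: real) = 1/2" by simp
    finally show ?thesis
      using c by (subst (asm) ennreal_le_iff2) auto
  qed
  have "(\<lambda>N. C * (1/2) ^ Suc N) \<longlonglongrightarrow> C * 0"
    by (intro tendsto_mult tendsto_const LIMSEQ_Suc LIMSEQ_power_zero) auto
  then have "c \<le> C * 0"
    by (rule LIMSEQ_le_const) (use bound in auto)
  with c show False by simp
qed

end
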